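(* Let $n\ge1$ and consider on $\Gamma(\mathbb{C}^n)$ the following list of $n(2n+3)$ observables, built from the total number operator $N$ and the gates defined in the context: (a) $N$, and $(G_p^{(j)})^\dagger NG_p^{(j)}$, $(G_q^{(j)})^\dagger NG_q^{(j)}$ for $1\le j\le n$ ($2n+1$ observables); (b) $G_{sp}^{(j)}(x,\alpha)^\dagger N\,G_{sp}^{(j)}(x,\alpha)$ for $(x,\alpha)\in\{(\sqrt2,0),(\sqrt3,0),(\sqrt2,\pi/4)\}$ and $1\le j\le n-1$, and for $(x,\alpha)\in\{(\sqrt2,0),(\sqrt2,\pi/4)\}$ and $j=n$ ($3n-1$ observables); (c) $G_{sp}^{(i,j)}(U,x_1,x_2)^\dagger N\,G_{sp}^{(i,j)}(U,x_1,x_2)$ for $1\le i<j\le n$ and $(U,x_1,x_2)\in\{(H,1,2),(H,1,3),(K,1,2),(K,1,3)\}$, where $H=\frac1{\sqrt2}\begin{bmatrix}1&1\\ -1&1\end{bmatrix}$ and $K=\frac1{\sqrt2}\begin{bmatrix}i&1\\ -1&-i\end{bmatrix}$ ($4\cdot\frac{n(n-1)}2$ observables). Each of these observables has spectrum $\{0,1,2,\dots\}$, and their expectation values in an $n$-mode Gaussian state determine the state: if $\rho_g(\mathbf{l},\mathbf{m};S)$ and $\rho_g(\mathbf{l}',\mathbf{m}';S')$ are $n$-mode Gaussian states in which each of the $n(2n+3)$ observables has the same expectation value, then $\mathbf{l}=\mathbf{l}'$, $\mathbf{m}=\mathbf{m}'$ and $S=S'$.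
   Context: $\Gamma(\mathbb{C}^n)=\bigoplus_{r\ge0}(\mathbb{C}^n)^{\circledS r}$ is the boson (symmetric) Fock space over $\mathbb{C}^n$ (inner products are linear in the second variable). For $\mathbf{u}\in\mathbb{C}^n$ the exponential vector is $\mathbf{e}(\mathbf{u})=\bigoplus_{r\ge0}\mathbf{u}^{\otimes r}/\sqrt{r!}$. The Weyl operator $W(\mathbf{u})$ is the unitary operator on $\Gamma(\mathbb{C}^n)$ determined by $W(\mathbf{u})\mathbf{e}(\mathbf{v})=e^{-\frac12\|\mathbf{u}\|^2-\langle\mathbf{u}|\mathbf{v}\rangle}\mathbf{e}(\mathbf{u}+\mathbf{v})$ for all $\mathbf{v}\in\mathbb{C}^n$. A state is a positive operator of trace one. The $n$-mode Gaussian state $\rho_g(\mathbf{l},\mathbf{m};S)$, with $\mathbf{l},\mathbf{m}\in\mathbb{R}^n$ and $S$ a real symmetric $2n\times2n$ matrix satisfying $2S+iJ_{2n}\ge0$, $J_{2n}=\begin{bmatrix} 0 & -I_n \\ I_n & 0 \end{bmatrix}$, is the unique state $\rho$ with $$\mathrm{Tr}\,\rho W(\mathbf{x}+i\mathbf{y})=\exp\left[-i\sqrt2(\mathbf{l}^T\mathbf{x}-\mathbf{m}^T\mathbf{y})-\begin{pmatrix}\mathbf{x}\\ \mathbf{y}\end{pmatrix}^TS\begin{pmatrix}\mathbf{x}\\ \mathbf{y}\end{pmatrix}\right],\quad\mathbf{x},\mathbf{y}\in\mathbb{R}^n.$$ The total number operator $N$ is the self-adjoint operator acting as multiplication by $r$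 on the $r$-particle subspace $(\mathbb{C}^n)^{\circledS r}$, $r=0,1,2,\dots$. For a unitary $V$, the expectation value of $V^\dagger NV$ in a state $\rho$ is $\sum_{k\ge0}k\,\mathrm{Tr}(\rho V^\dagger P_kV)$ with $P_k$ the projection onto the $k$-particle subspace. $Sp(2n)$ is the group of real $2n\times2n$ matrices $L$ with $L^TJ_{2n}L=J_{2n}$. For $L\in Sp(2n)$, $\Gamma(L)$ is the unitary operator on $\Gamma(\mathbb{C}^n)$, unique up to a scalar of modulus one, with $\Gamma(L)W(\mathbf{x}+i\mathbf{y})\Gamma(L)^{-1}=W(\mathbf{x}'+i\mathbf{y}')$ for all $\mathbf{x},\mathbf{y}\in\mathbb{R}^n$, where $\begin{pmatrix}\mathbf{x}'\\ \mathbf{y}'\end{pmatrix}=L\begin{pmatrix}\mathbf{x}\\ \mathbf{y}\end{pmatrix}$. (Conjugation by $\Gamma(L)$ does not depend on the choice of scalar.) Gates. Let $\mathbf{e}_j$ be the standard basis of $\mathbb{C}^n$ and $\tau(L)=(L^{-1})^T$. Displacement gates: $G_p^{(j)}=W(2^{-1/2}\,i\,\mathbf{e}_j)$, $G_q^{(j)}=W(2^{-1/2}\,\mathbf{e}_j)$. One-mode symplectic gates: with $$L(x,\alpha)=R\begin{bmatrix}x&0\\ 0&x^{-1}\end{bmatrix}R^T,\quad R=\begin{bmatrix}\cos\alpha&-\sin\alpha\\ \sin\alpha&\cos\alpha\end{bmatrix},$$ $G_{sp}^{(j)}(x,\alpha)$ is $\Gamma(M)$, where $M\in Sp(2n)$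 acts on the coordinates $(x_j,y_j)^T$ of $(\mathbf{x},\mathbf{y})$ by the matrix $\tau(L(x,\alpha))$ and fixes all other coordinates. Two-mode symplectic gates: for a $2\times2$ matrix $U=\begin{pmatrix}\alpha&\beta\\ -\bar\beta&\bar\alpha\end{pmatrix}$, $\alpha=\alpha_1+i\alpha_2$, $\beta=\beta_1+i\beta_2$, $|\alpha|^2+|\beta|^2=1$, let $$\mathcal{O}=\begin{bmatrix}\alpha_1&-\alpha_2&\beta_1&-\beta_2\\ \alpha_2&\alpha_1&\beta_2&\beta_1\\ -\beta_1&-\beta_2&\alpha_1&\alpha_2\\ \beta_2&-\beta_1&-\alpha_2&\alpha_1\end{bmatrix},\qquad L(U,x_1,x_2)=\mathcal{O}\,\mathrm{diag}(x_1,x_1^{-1},x_2,x_2^{-1})\,\mathcal{O}^T .$$ For $i<j$, $G_{sp}^{(i,j)}(U,x_1,x_2)$ is $\Gamma(M)$, where $M\in Sp(2n)$ acts on the coordinates $(x_i,y_i,x_j,y_j)^T$ of $(\mathbf{x},\mathbf{y})$ by the matrix $\tau(L(U,x_1,x_2))$ and fixes all other coordinates. *)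

theory Defs
  imports "HOL-Analysis.Analysis" "HOL-Combinatorics.Multiset_Permutations"
begin

section \<open>The boson Fock space\<close>

text \<open>
  The index type \<open>'n\<close> enumerates the modes, so that \<open>\<complex>^'n\<close> is the one-particle space.  A tensor in
  the \<open>r\<close>-th tensor power of \<open>\<complex>^'n\<close> is the family of its coordinates, indexed by the words of length
  \<open>r\<close> over \<open>'n\<close> (the tensor product of basis vectors \<open>e\<^sub>i \<otimes> e\<^sub>j \<otimes> \<dots>\<close> corresponds to the word
  \<open>[i, j, \<dots>]\<close>).  It is a symmetric tensor iff the coordinates do not change when the letters of the
  word are permuted.  A square summable function on all words is thus an element of the Hilbert sum
  of all the tensor powers.
\<close>

definition fock_fun :: "('n list \<Rightarrow> complex) \<Rightarrow> bool"
  where "fock_fun f \<longleftrightarrow>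
    (\<forall>u v. mset u = mset v \<longrightarrow> f u = f v) \<and> (\<lambda>w. (cmod (f w))\<^sup>2) summable_on UNIV"

lemma fock_funI:
  assumes "\<And>u v. mset u = mset v \<Longrightarrow> f u = f v" "(\<lambda>w. (cmod (f w))\<^sup>2) summable_on UNIV"
  shows "fock_fun f"
  using assms unfolding fock_fun_def by blast

lemma fock_fun_perm: "fock_fun f \<Longrightarrow> mset u = mset v \<Longrightarrow> f u = f v"
  unfolding fock_fun_def by blast

lemma fock_fun_summable: "fock_fun f \<Longrightarrow> (\<lambda>w. (cmod (f w))\<^sup>2) summable_on UNIV"
  unfolding fock_fun_def by blast

lemma fock_fun_zero: "fock_fun (\<lambda>_. 0)"
  by (rule fock_funI) auto

lemma fock_fun_add:
  assumes f: "fock_fun f" and g: "fock_fun g"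
  shows "fock_fun (\<lambda>w. f w + g w)"
proof (rule fock_funI)
  show "f u + g u = f v + g v" if "mset u = mset v" for u v
    using fock_fun_perm[OF f that] fock_fun_perm[OF g that] by (rule arg_cong2)
  show "(\<lambda>w. (cmod (f w + g w))\<^sup>2) summable_on UNIV"
  proof (rule summable_on_comparison_test)
    show "(\<lambda>w. 2 * ((cmod (f w))\<^sup>2 + (cmod (g w))\<^sup>2)) summable_on UNIV"
      by (intro summable_on_cmult_right summable_on_add fock_fun_summable f g)
    fix w
    have "(cmod (f w + g w))\<^sup>2 \<le> (cmod (f w) + cmod (g w))\<^sup>2"
      by (intro power_mono norm_triangle_ineq) auto
    also have "\<dots> \<le> 2 * ((cmod (f w))\<^sup>2 + (cmod (g w))\<^sup>2)"
      using sum_squares_bound[of "cmod (f w)" "cmod (g w)"]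
      by (simp add: power2_eq_square algebra_simps)
    finally show "(cmod (f w + g w))\<^sup>2 \<le> 2 * ((cmod (f w))\<^sup>2 + (cmod (g w))\<^sup>2)" .
  qed auto
qed

lemma fock_fun_cmult:
  assumes f: "fock_fun f"
  shows "fock_fun (\<lambda>w. c * f w)"
proof (rule fock_funI)
  show "c * f u = c * f v" if "mset u = mset v" for u v
    using fock_fun_perm[OF f that] by (rule arg_cong)
  show "(\<lambda>w. (cmod (c * f w))\<^sup>2) summable_on UNIV"
    using summable_on_cmult_right[OF fock_fun_summable[OF f], of "(cmod c)\<^sup>2"]
    by (simp add: norm_mult power_mult_distrib)
qed

lemma fock_fun_length_restrict:
  assumes f: "fock_fun f"
  shows "fock_fun (\<lambda>w. if length w = k then f w else 0)"
proof (rule fock_funI)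
  show "(if length u = k then f u else 0) = (if length v = k then f v else 0)"
    if "mset u = mset v" for u v
    using fock_fun_perm[OF f that] mset_eq_length[OF that] by presburger
  show "(\<lambda>w. (cmod (if length w = k then f w else 0))\<^sup>2) summable_on UNIV"
    by (rule summable_on_comparison_test[OF fock_fun_summable[OF f]]) auto
qed

typedef 'n fock = "{f :: 'n list \<Rightarrow> complex. fock_fun f}"
  morphisms fock_coord Abs_fock
  using fock_fun_zero by blast

setup_lifting type_definition_fock

lemma fock_coord_fun: "fock_fun (fock_coord f)"
  using fock_coord[of f] by blast

lemmas fock_coord_perm = fock_fun_perm[OF fock_coord_fun]
lemmas fock_coord_square_summable = fock_fun_summable[OF fock_coord_fun]

lift_definition fock_scale :: "complex \<Rightarrow> 'n fock \<Rightarrow> 'n fock"  (infixr \<open>*\<^sub>C\<close> 75)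
  is "\<lambda>c f w. c * f w"
  by (rule fock_fun_cmult)

definition fock_cinner :: "'n fock \<Rightarrow> 'n fock \<Rightarrow> complex"
  where "fock_cinner f g = (\<Sum>\<^sub>\<infinity>w. cnj (fock_coord f w) * fock_coord g w)"

lemma fock_cinner_summable: "(\<lambda>w. cnj (fock_coord f w) * fock_coord g w) summable_on UNIV"
proof -
  have "(\<lambda>w. norm (cnj (fock_coord f w) * fock_coord g w)) summable_on UNIV"
  proof (rule summable_on_comparison_test)
    show "(\<lambda>w. (cmod (fock_coord f w))\<^sup>2 + (cmod (fock_coord g w))\<^sup>2) summable_on UNIV"
      by (intro summable_on_add fock_coord_square_summable)
    fix w
    show "norm (cnj (fock_coord f w) * fock_coord g w)
        \<le> (cmod (fock_coord f w))\<^sup>2 + (cmod (fock_coord g w))\<^sup>2"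
      using sum_squares_bound[of "cmod (fock_coord f w)" "cmod (fock_coord g w)"]
        mult_nonneg_nonneg[of "cmod (fock_coord f w)" "cmod (fock_coord g w)"]
      unfolding norm_mult complex_mod_cnj mult.assoc by (smt (verit) norm_ge_zero)
  qed auto
  then show ?thesis
    by (rule abs_summable_summable)
qed

text \<open>
  The library has no class of complex inner product spaces.  We make the Fock space a real inner
  product space with the real part of \<^const>\<open>fock_cinner\<close>, which gives the correct norm and topology.
\<close>

instantiation fock :: (type) real_inner
begin

lift_definition zero_fock :: "'a fock" is "\<lambda>_. 0"
  by (rule fock_fun_zero)

lift_definition plus_fock :: "'a fock \<Rightarrow> 'a fock \<Rightarrow> 'a fock" is "\<lambda>f g w. f w + g w"
  by (rule fock_fun_add)

lift_definition uminus_fock :: "'a fock \<Rightarrow> 'a fock" is "\<lambda>f w. - f w"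
  using fock_fun_cmult[where c = "-1"] by simp

definition minus_fock :: "'a fock \<Rightarrow> 'a fock \<Rightarrow> 'a fock"
  where "minus_fock f g = f + - g"

definition scaleR_fock :: "real \<Rightarrow> 'a fock \<Rightarrow> 'a fock"
  where "scaleR_fock r f = complex_of_real r *\<^sub>C f"

definition inner_fock :: "'a fock \<Rightarrow> 'a fock \<Rightarrow> real"
  where "inner_fock f g = Re (fock_cinner f g)"

definition norm_fock :: "'a fock \<Rightarrow> real"
  where "norm_fock f = sqrt (inner f f)"

definition sgn_fock :: "'a fock \<Rightarrow> 'a fock"
  where "sgn_fock f = inverse (norm f) *\<^sub>R f"

definition dist_fock :: "'a fock \<Rightarrow> 'a fock \<Rightarrow> real"
  where "dist_fock f g = norm (f - g)"

definition uniformity_fock :: "('a fock \<times> 'a fock) filter"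
  where "uniformity_fock = (INF e\<in>{0<..}. principal {(x, y). dist x y < e})"

definition open_fock :: "'a fock set \<Rightarrow> bool"
  where "open_fock U \<longleftrightarrow> (\<forall>x\<in>U. eventually (\<lambda>(x', y). x' = x \<longrightarrow> y \<in> U) uniformity)"

instance
proof
  fix a b c :: "'a fock" and r s :: real
  show "a + b + c = a + (b + c)" "a + b = b + a" "0 + a = a" "- a + a = 0"
    by (transfer; simp add: algebra_simps)+
  show "a - b = a + - b"
    by (rule minus_fock_def)
  show "r *\<^sub>R (a + b) = r *\<^sub>R a + r *\<^sub>R b" "(r + s) *\<^sub>R a = r *\<^sub>R a + s *\<^sub>R a"
    "r *\<^sub>R s *\<^sub>R a = (r * s) *\<^sub>R a" "1 *\<^sub>R a = a"
    unfolding scaleR_fock_def by (transfer; simp add: algebra_simps)+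
  show "dist a b = norm (a - b)" "sgn a = inverse (norm a) *\<^sub>R a"
    by (simp_all add: dist_fock_def sgn_fock_def)
  show "(uniformity :: ('a fock \<times> 'a fock) filter)
      = (INF e\<in>{0<..}. principal {(x, y). dist x y < e})"
    by (rule uniformity_fock_def)
  show "open U \<longleftrightarrow> (\<forall>x\<in>U. \<forall>\<^sub>F (x', y) in uniformity. x' = x \<longrightarrow> y \<in> U)" for U :: "'a fock set"
    by (rule open_fock_def)
  have "fock_cinner b a = cnj (fock_cinner a b)"
    unfolding fock_cinner_def by (simp add: mult.commute flip: infsum_cnj)
  then show "a \<bullet> b = b \<bullet> a"
    by (simp add: inner_fock_def)
  show "(a + b) \<bullet> c = a \<bullet> c + b \<bullet> c"
    by (simp add: inner_fock_def fock_cinner_def plus_fock.rep_eq ring_distribs infsum_add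
        fock_cinner_summable)
  have "fock_cinner (r *\<^sub>R a) b = complex_of_real r * fock_cinner a b"
    unfolding fock_cinner_def scaleR_fock_def
    by (simp add: fock_scale.rep_eq infsum_cmult_right' mult.assoc)
  then show "(r *\<^sub>R a) \<bullet> b = r * (a \<bullet> b)"
    by (simp add: inner_fock_def)
  have sq: "cnj z * z = complex_of_real ((cmod z)\<^sup>2)" for z
    using complex_norm_square[of z] by (simp add: mult.commute)
  have self: "a \<bullet> a = (\<Sum>\<^sub>\<infinity>w. (cmod (fock_coord a w))\<^sup>2)"
    unfolding inner_fock_def fock_cinner_def
    by (subst infsum_Re[symmetric, OF fock_cinner_summable]) (simp add: sq)
  then show "0 \<le> a \<bullet> a"
    by (simp add: infsum_nonneg)
  show "(a \<bullet> a = 0) = (a = 0)"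
  proof
    assume "a \<bullet> a = 0"
    then have le: "(\<Sum>\<^sub>\<infinity>w. (cmod (fock_coord a w))\<^sup>2) \<le> 0"
      unfolding self by (rule eq_refl)
    have "(cmod (fock_coord a w))\<^sup>2 = 0" for w
      by (rule nonneg_infsum_le_0D[OF le fock_coord_square_summable]) auto
    then have "fock_coord a = fock_coord 0"
      by (simp add: fun_eq_iff zero_fock.rep_eq)
    then show "a = 0"
      unfolding fock_coord_inject .
  next
    assume "a = 0"
    then show "a \<bullet> a = 0"
      unfolding self by (simp add: zero_fock.rep_eq)
  qed
  show "norm a = sqrt (a \<bullet> a)"
    by (rule norm_fock_def)
qed

end

lemma sum_prod_words:
  fixes a :: "'n::finite \<Rightarrow> real"
  shows "(\<Sum>w | length w = r. prod_list (map a w)) = (\<Sum>i\<in>UNIV. a i) ^ r"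
proof (induction r)
  case (Suc r)
  have eq: "{w :: 'n list. length w = Suc r} = (\<lambda>(x, w). x # w) ` (UNIV \<times> {w. length w = r})"
    by (force simp: length_Suc_conv image_iff)
  have "(\<Sum>w | length w = Suc r. prod_list (map a w))
      = (\<Sum>(x, w)\<in>UNIV \<times> {w. length w = r}. a x * prod_list (map a w))"
    unfolding eq by (subst sum.reindex) (auto simp: inj_on_def case_prod_unfold intro!: sum.cong)
  also have "\<dots> = (\<Sum>x\<in>UNIV. a x) * (\<Sum>w | length w = r. prod_list (map a w))"
    by (simp add: sum.cartesian_product[symmetric] sum_product)
  finally show ?case
    using Suc.IH by simp
qed simp

lemma exp_words_summable:
  fixes a :: "'n::finite \<Rightarrow> real"
  assumes "\<And>i. 0 \<le> a i"
  shows "(\<lambda>w. prod_list (map a w) / fact (length w)) summable_on UNIV"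
proof (rule nonneg_bdd_above_summable_on)
  have nn: "0 \<le> prod_list (map a w)" for w
    by (induction w) (auto simp: assms)
  then show "\<And>w. 0 \<le> prod_list (map a w) / fact (length w)"
    by simp
  let ?s = "\<Sum>i\<in>UNIV. a i"
  show "bdd_above (sum (\<lambda>w. prod_list (map a w) / fact (length w)) ` {F. F \<subseteq> UNIV \<and> finite F})"
  proof (rule bdd_aboveI2)
    fix F :: "'n list set"
    assume "F \<in> {F. F \<subseteq> UNIV \<and> finite F}"
    then have fin: "finite F"
      by simp
    define m where "m = Suc (Max (length ` F))"
    have F: "F \<subseteq> (\<Union>r\<in>{..<m}. {w. length w = r})"
      using fin by (auto simp: m_def less_Suc_eq_le)
    have finw: "finite {w :: 'n list. length w = r}" for r
      using finite_lists_length_eq[of "UNIV :: 'n set" r] by simp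
    have "(\<Sum>w\<in>F. prod_list (map a w) / fact (length w))
        \<le> (\<Sum>w\<in>(\<Union>r\<in>{..<m}. {w. length w = r}). prod_list (map a w) / fact (length w))"
      by (rule sum_mono2) (use finw F nn in auto)
    also have "\<dots> = (\<Sum>r<m. \<Sum>w | length w = r. prod_list (map a w) / fact (length w))"
      by (rule sum.UNION_disjoint) (use finw in auto)
    also have "\<dots> = (\<Sum>r<m. ?s ^ r / fact r)"
      by (simp add: sum_prod_words[symmetric] sum_divide_distrib)
    also have "\<dots> \<le> exp ?s"
    proof -
      have s: "(\<lambda>r. ?s ^ r / fact r) sums exp ?s"
        using exp_converges[of ?s] by (simp add: divide_inverse_commute)
      have "0 \<le> ?s"
        by (simp add: assms sum_nonneg)
      then have "(\<Sum>r<m. ?s ^ r / fact r) \<le> (\<Sum>r. ?s ^ r / fact r)"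
        using s by (intro sum_le_suminf) (auto simp: sums_iff)
      then show ?thesis
        using s by (simp add: sums_iff)
    qed
    finally show "(\<Sum>w\<in>F. prod_list (map a w) / fact (length w)) \<le> exp ?s" .
  qed
qed

lift_definition exp_vec :: "complex^'n \<Rightarrow> 'n::finite fock"
  is "\<lambda>u w. prod_list (map (\<lambda>i. u $ i) w) / complex_of_real (sqrt (fact (length w)))"
proof (rule fock_funI)
  fix u :: "complex^'n" and v w :: "'n list"
  assume "mset v = mset w"
  then have "prod_list (map (\<lambda>i. u $ i) v) = prod_list (map (\<lambda>i. u $ i) w)" "length v = length w"
    by (simp_all flip: prod_mset_prod_list size_mset)
  then show "prod_list (map (\<lambda>i. u $ i) v) / complex_of_real (sqrt (fact (length v)))
      = prod_list (map (\<lambda>i. u $ i) w) / complex_of_real (sqrt (fact (length w)))"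
    by simp
next
  fix u :: "complex^'n"
  have "(cmod (prod_list (map (\<lambda>i. u $ i) w)))\<^sup>2 = prod_list (map (\<lambda>i. (cmod (u $ i))\<^sup>2) w)" for w
    by (induction w) (auto simp: norm_mult power_mult_distrib)
  then have "(cmod (prod_list (map (\<lambda>i. u $ i) w) / complex_of_real (sqrt (fact (length w)))))\<^sup>2
      = prod_list (map (\<lambda>i. (cmod (u $ i))\<^sup>2) w) / fact (length w)" for w
    by (simp add: norm_divide power_divide)
  then show "(\<lambda>w. (cmod (prod_list (map (\<lambda>i. u $ i) w) / complex_of_real (sqrt (fact (length w)))))\<^sup>2)
      summable_on UNIV"
    using exp_words_summable[of "\<lambda>i. (cmod (u $ i))\<^sup>2"] by simp
qed

lift_definition particle_proj :: "nat \<Rightarrow> 'n fock \<Rightarrow> 'n fock"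
  is "\<lambda>k f w. if length w = k then f w else 0"
  by (rule fock_fun_length_restrict)

text \<open>
  The occupation number basis: the normalized symmetrizations of the tensor products of basis
  vectors, one for each multiset of modes.
\<close>

lift_definition number_vec :: "'n multiset \<Rightarrow> 'n fock"
  is "\<lambda>A w. if mset w = A then complex_of_real (1 / sqrt (card (permutations_of_multiset A))) else 0"
proof (rule fock_funI)
  fix A :: "'n multiset"
  have "finite {w. mset w = A}"
    using finite_permutations_of_multiset[of A] by (simp add: permutations_of_multiset_def)
  then show "(\<lambda>w. (cmod (if mset w = A
      then complex_of_real (1 / sqrt (card (permutations_of_multiset A))) else 0))\<^sup>2) summable_on UNIV"
    by (intro finite_nonzero_values_imp_summable_on) (auto elim!: rev_finite_subset)
qed simp


section \<open>Operators\<close>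

definition bounded_clinear :: "('n fock \<Rightarrow> 'n fock) \<Rightarrow> bool"
  where "bounded_clinear T \<longleftrightarrow> bounded_linear T \<and> (\<forall>c f. T (c *\<^sub>C f) = c *\<^sub>C T f)"

definition cadjoint :: "('n fock \<Rightarrow> 'n fock) \<Rightarrow> ('n fock \<Rightarrow> 'n fock)"
  where "cadjoint T = (THE B. \<forall>f g. fock_cinner (B f) g = fock_cinner f (T g))"

definition unitary :: "('n fock \<Rightarrow> 'n fock) \<Rightarrow> bool"
  where "unitary V \<longleftrightarrow> bounded_clinear V \<and> surj V \<and>
    (\<forall>f g. fock_cinner (V f) (V g) = fock_cinner f g)"

text \<open>
  The trace is computed in the occupation number basis; for trace class operators it does not depend
  on the orthonormal basis.
\<close>

definition op_trace :: "('n fock \<Rightarrow> 'n fock) \<Rightarrow> complex"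
  where "op_trace T = (\<Sum>\<^sub>\<infinity>A. fock_cinner (number_vec A) (T (number_vec A)))"

definition state :: "('n fock \<Rightarrow> 'n fock) \<Rightarrow> bool"
  where "state \<rho> \<longleftrightarrow> bounded_clinear \<rho> \<and> (\<forall>f. fock_cinner f (\<rho> f) \<in> \<real>\<^sub>\<ge>\<^sub>0) \<and> op_trace \<rho> = 1"

text \<open>
  An unbounded operator is represented by its graph.  The number operator has its maximal domain:
  all \<open>f\<close> for which multiplication by the particle number gives an element of the Fock space.
\<close>

definition number_op :: "('n fock \<times> 'n fock) set"
  where "number_op = {(f, g). \<forall>w. fock_coord g w = of_nat (length w) * fock_coord f w}"

definition conjugate_op ::
    "('n fock \<Rightarrow> 'n fock) \<Rightarrow> ('n fock \<times> 'n fock) set \<Rightarrow> ('n fock \<times> 'n fock) set"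
  where "conjugate_op V A = {(f, cadjoint V g) | f g. (V f, g) \<in> A}"

definition resolvent_set :: "('n fock \<times> 'n fock) set \<Rightarrow> complex set"
  where "resolvent_set A = {z. \<exists>R. bounded_clinear R \<and>
    (\<forall>f. \<exists>h. (R f, h) \<in> A \<and> h - z *\<^sub>C R f = f) \<and>
    (\<forall>f h. (f, h) \<in> A \<longrightarrow> R (h - z *\<^sub>C f) = f)}"

definition op_spectrum :: "('n fock \<times> 'n fock) set \<Rightarrow> complex set"
  where "op_spectrum A = - resolvent_set A"

text \<open>
  The expectation value of \<open>V\<^sup>\<dagger> N V\<close> in the state \<open>\<rho>\<close>, possibly infinite.  The traces are nonnegative
  real numbers.
\<close>

definition expectation_number :: "('n fock \<Rightarrow> 'n fock) \<Rightarrow> ('n fock \<Rightarrow> 'n fock) \<Rightarrow> ennreal"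
  where "expectation_number \<rho> V =
    (\<Sum>k. of_nat k * ennreal (Re (op_trace (\<rho> \<circ> cadjoint V \<circ> particle_proj k \<circ> V))))"


section \<open>Weyl operators and Gaussian states\<close>

definition weyl :: "complex^'n \<Rightarrow> 'n::finite fock \<Rightarrow> 'n fock"
  where "weyl u = (THE W. unitary W \<and>
    (\<forall>v. W (exp_vec v) =
      exp (- complex_of_real ((norm u)\<^sup>2) / 2 - (\<Sum>j\<in>UNIV. cnj (u $ j) * v $ j)) *\<^sub>C exp_vec (u + v)))"

text \<open>
  Vectors of \<open>\<real>\<^bsup>2n\<^esup>\<close> are indexed by \<open>'n + 'n\<close>: the left summand holds \<open>x\<close>, the right summand \<open>y\<close>.
\<close>

definition join :: "real^'n::finite \<Rightarrow> real^'n \<Rightarrow> real^('n + 'n)"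
  where "join x y = (\<chi> a. case a of Inl j \<Rightarrow> x $ j | Inr j \<Rightarrow> y $ j)"

definition cplx :: "real^'n \<Rightarrow> real^'n \<Rightarrow> complex^'n"
  where "cplx x y = (\<chi> j. Complex (x $ j) (y $ j))"

definition symp_J :: "real^('n::finite + 'n)^('n + 'n)"
  where "symp_J = (\<chi> a b. case (a, b) of
      (Inl i, Inr j) \<Rightarrow> if i = j then -1 else 0
    | (Inr i, Inl j) \<Rightarrow> if i = j then 1 else 0
    | _ \<Rightarrow> 0)"

definition complex_psd :: "complex^'m::finite^'m \<Rightarrow> bool"
  where "complex_psd A \<longleftrightarrow> (\<forall>z. (\<Sum>a\<in>UNIV. \<Sum>b\<in>UNIV. cnj (z $ a) * A $ a $ b * z $ b) \<in> \<real>\<^sub>\<ge>\<^sub>0)"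

definition gaussian_state ::
    "('n::finite fock \<Rightarrow> 'n fock) \<Rightarrow> real^'n \<Rightarrow> real^'n \<Rightarrow> real^('n + 'n)^('n + 'n) \<Rightarrow> bool"
  where "gaussian_state \<rho> l m S \<longleftrightarrow>
    transpose S = S \<and>
    complex_psd (\<chi> a b. 2 * complex_of_real (S $ a $ b) + \<i> * complex_of_real (symp_J $ a $ b)) \<and>
    state \<rho> \<and>
    (\<forall>x y. op_trace (\<rho> \<circ> weyl (cplx x y)) =
      exp (- \<i> * complex_of_real (sqrt 2 * (l \<bullet> x - m \<bullet> y))
           - complex_of_real (join x y \<bullet> (S *v join x y))))"


section \<open>Symplectic matrices and gates\<close>

definition symplectic :: "real^('n::finite + 'n)^('n + 'n) \<Rightarrow> bool"
  where "symplectic L \<longleftrightarrow> transpose L ** symp_J ** L = symp_J"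

text \<open>The unitary operators \<open>V\<close> that may be chosen as \<open>\<Gamma>(L)\<close>; they differ by scalars of modulus one.\<close>

definition implements :: "('n::finite fock \<Rightarrow> 'n fock) \<Rightarrow> real^('n + 'n)^('n + 'n) \<Rightarrow> bool"
  where "implements V L \<longleftrightarrow> unitary V \<and>
    (\<forall>x y x' y'. join x' y' = L *v join x y \<longrightarrow> V \<circ> weyl (cplx x y) \<circ> inv V = weyl (cplx x' y'))"

definition tau :: "real^'m::finite^'m \<Rightarrow> real^'m^'m"
  where "tau L = transpose (matrix_inv L)"

definition diag :: "real^'m::finite \<Rightarrow> real^'m^'m"
  where "diag d = (\<chi> a b. if a = b then d $ a else 0)"

text \<open>\<open>embed_coords c A\<close> acts by \<open>A\<close> on the coordinates listed by the injection \<open>c\<close> and fixes the others.\<close>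

definition embed_coords :: "('k::finite \<Rightarrow> 'm::finite) \<Rightarrow> real^'k^'k \<Rightarrow> real^'m^'m"
  where "embed_coords c A = (\<chi> a b.
    if a \<in> range c \<and> b \<in> range c then A $ inv c a $ inv c b
    else if a = b then 1 else 0)"

definition rot :: "real \<Rightarrow> real^2^2"
  where "rot \<alpha> = vector [vector [cos \<alpha>, - sin \<alpha>], vector [sin \<alpha>, cos \<alpha>]]"

definition L1 :: "real \<Rightarrow> real \<Rightarrow> real^2^2"
  where "L1 x \<alpha> = rot \<alpha> ** diag (vector [x, inverse x]) ** transpose (rot \<alpha>)"

definition O4 :: "complex^2^2 \<Rightarrow> real^4^4"
  where "O4 U = (let
      \<alpha>1 = Re (U $ 1 $ 1); \<alpha>2 = Im (U $ 1 $ 1); \<beta>1 = Re (U $ 1 $ 2); \<beta>2 = Im (U $ 1 $ 2)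
    in vector
      [vector [\<alpha>1, - \<alpha>2, \<beta>1, - \<beta>2],
       vector [\<alpha>2, \<alpha>1, \<beta>2, \<beta>1],
       vector [- \<beta>1, - \<beta>2, \<alpha>1, \<alpha>2],
       vector [\<beta>2, - \<beta>1, - \<alpha>2, \<alpha>1]])"

definition L2 :: "complex^2^2 \<Rightarrow> real \<Rightarrow> real \<Rightarrow> real^4^4"
  where "L2 U x1 x2 =
    O4 U ** diag (vector [x1, inverse x1, x2, inverse x2]) ** transpose (O4 U)"

definition mode_coords :: "'n \<Rightarrow> 2 \<Rightarrow> 'n + 'n"
  where "mode_coords j k = (if k = 1 then Inl j else Inr j)"

definition two_mode_coords :: "'n \<Rightarrow> 'n \<Rightarrow> 4 \<Rightarrow> 'n + 'n"
  where "two_mode_coords i j k =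
    (if k = 1 then Inl i else if k = 2 then Inr i else if k = 3 then Inl j else Inr j)"

definition gate_p :: "'n \<Rightarrow> 'n::finite fock \<Rightarrow> 'n fock"
  where "gate_p j = weyl (axis j (\<i> / complex_of_real (sqrt 2)))"

definition gate_q :: "'n \<Rightarrow> 'n::finite fock \<Rightarrow> 'n fock"
  where "gate_q j = weyl (axis j (1 / complex_of_real (sqrt 2)))"

definition matH :: "complex^2^2"
  where "matH = (1 / sqrt 2) *\<^sub>R vector [vector [1, 1], vector [-1, 1]]"

definition matK :: "complex^2^2"
  where "matK = (1 / sqrt 2) *\<^sub>R vector [vector [\<i>, 1], vector [-1, - \<i>]]"

definition modes :: "'n::{finite, linorder} list"
  where "modes = sorted_list_of_set UNIV"

text \<open>
  The list of unitary operators \<open>V\<close> whose observables \<open>V\<^sup>\<dagger> N V\<close> are measured; \<open>\<Gamma>\<close> is a choice of the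
  operators \<open>\<Gamma>(L)\<close>.
\<close>

definition gates ::
    "(real^('n + 'n)^('n + 'n) \<Rightarrow> 'n fock \<Rightarrow> 'n fock) \<Rightarrow> ('n::{finite, linorder} fock \<Rightarrow> 'n fock) list"
  where "gates \<Gamma> =
    [id] @ [gate_p j. j \<leftarrow> modes] @ [gate_q j. j \<leftarrow> modes] @
    [\<Gamma> (embed_coords (mode_coords j) (tau (L1 x \<alpha>))).
      j \<leftarrow> butlast modes, (x, \<alpha>) \<leftarrow> [(sqrt 2, 0), (sqrt 3, 0), (sqrt 2, pi / 4)]] @
    [\<Gamma> (embed_coords (mode_coords (last modes)) (tau (L1 x \<alpha>))).
      (x, \<alpha>) \<leftarrow> [(sqrt 2, 0), (sqrt 2, pi / 4)]] @
    [\<Gamma> (embed_coords (two_mode_coords i j) (tau (L2 U x1 x2))).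
      i \<leftarrow> modes, j \<leftarrow> modes, i < j,
      (U, x1, x2) \<leftarrow> [(matH, 1, 2), (matH, 1, 3), (matK, 1, 2), (matK, 1, 3)]]"

end

(*
  Choosing a Cholesky factorization of a state rho in the occupation number basis gives vectors psi_i
  with Tr(rho T) = sum_i <psi_i, T psi_i>, so that expectations of V^* N V become sums of the quadratic
  form of N at the vectors V psi_i.

  Summing ||(W(h b) - 1) f||^2 / h^2 over the 2n real unit vectors b gives a quantity that increases
  as h is halved and whose limit is the form of 4 N + 2 n at f, also if that is infinite. The
  limit is read off the kernel <e(u), W(z) e(v)> on exponential vectors; these form a core of N, because
  averages of exponential vectors over a grid of roots of unity approximate the occupation number
  basis in the graph norm. Hence 4 <N> + 2 n is minus the Laplacian at 0 of the characteristic
  function, which for a Gaussian state is 2 tr S + 2 |k|^2 with k = (l, -m).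

  A displacement gate shifts k by a unit vector, so that the observables in (a) determine k and tr S. A
  symplectic gate with matrix L replaces S by L S L^T, so that tr (L^T L S) is determined, and the
  listed L give a system of linear equations with the only solution S.
*)
theory Submission
  imports Defs
begin

section \<open>The Fock space is a complex Hilbert space\<close>

text \<open>The obstacle is that N is unbounded, so a Gaussian characteristic function says nothing
  direct about its expectation; even finiteness has to be derived. All sums are therefore taken in
  \<open>ennreal\<close>, where nonnegativity allows exchanging them, and monotonicity under halving
  of the step replaces any consideration of domains. The delicate half is to bound the form of 4 N +
  2 n by the difference quotients at a vector f not known to lie in any domain. There the
  Cauchy-Schwarz inequality of the difference form is applied to f and a particle number truncation
  of f. For the truncation the limit is known, and pairing it with f gives the form of the
  truncation itself, which can be divided out. The Cholesky construction suits a trace that is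
  defined by one fixed basis: on every basis vector the expansion of rho is a finite sum.\<close>

lemma fock_eqI: "(\<And>w. fock_coord f w = fock_coord g w) \<Longrightarrow> f = g"
  by (simp add: fock_coord_inject[symmetric] fun_eq_iff)

lemma fock_coord_minus: "fock_coord (f - g) w = fock_coord f w - fock_coord g w"
  unfolding minus_fock_def plus_fock.rep_eq uminus_fock.rep_eq by simp

lemma fock_coord_scaleR: "fock_coord (r *\<^sub>R f) w = complex_of_real r * fock_coord f w"
  by (simp add: scaleR_fock_def fock_scale.rep_eq)

lemmas fock_coord_simps =
  plus_fock.rep_eq uminus_fock.rep_eq fock_coord_minus zero_fock.rep_eq fock_scale.rep_eq
  fock_coord_scaleR

lemma fock_coord_sum: "fock_coord (sum f A) w = (\<Sum>a\<in>A. fock_coord (f a) w)"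
  by (induction A rule: infinite_finite_induct) (auto simp: fock_coord_simps)

lemma fock_scale_laws:
  "c *\<^sub>C (f + g) = c *\<^sub>C f + c *\<^sub>C g" "c *\<^sub>C (f - g) = c *\<^sub>C f - c *\<^sub>C g"
  "(c + d) *\<^sub>C f = c *\<^sub>C f + d *\<^sub>C f" "c *\<^sub>C d *\<^sub>C f = (c * d) *\<^sub>C f"
  "1 *\<^sub>C f = f" "0 *\<^sub>C f = 0" "c *\<^sub>C 0 = 0" "c *\<^sub>C (r *\<^sub>R f) = r *\<^sub>R (c *\<^sub>C f)"
  "(-1) *\<^sub>C f = - f"
  by (rule fock_eqI; simp add: fock_coord_simps algebra_simps)+

lemma fock_scale_sum: "c *\<^sub>C (\<Sum>a\<in>A. f a) = (\<Sum>a\<in>A. c *\<^sub>C f a)"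
  by (rule fock_eqI) (simp add: fock_coord_simps fock_coord_sum sum_distrib_left)

lemma cinner_has_sum: "((\<lambda>w. cnj (fock_coord f w) * fock_coord g w) has_sum fock_cinner f g) UNIV"
  unfolding fock_cinner_def by (rule has_sum_infsum[OF fock_cinner_summable])

lemma cinner_commute: "fock_cinner g f = cnj (fock_cinner f g)"
  unfolding fock_cinner_def by (simp add: mult.commute flip: infsum_cnj)

lemma cinner_add_right: "fock_cinner f (g + h) = fock_cinner f g + fock_cinner f h"
  by (simp add: fock_cinner_def fock_coord_simps ring_distribs infsum_add fock_cinner_summable)

lemma cinner_scale_right: "fock_cinner f (c *\<^sub>C g) = c * fock_cinner f g"
  unfolding fock_cinner_def fock_coord_simps
  by (simp add: mult.left_commute[of _ c] infsum_cmult_right')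

lemma cinner_add_left: "fock_cinner (f + g) h = fock_cinner f h + fock_cinner g h"
  by (metis cinner_commute cinner_add_right complex_cnj_add)

lemma cinner_scale_left: "fock_cinner (c *\<^sub>C f) g = cnj c * fock_cinner f g"
  by (metis cinner_commute cinner_scale_right complex_cnj_mult)

lemma cinner_self: "fock_cinner f f = complex_of_real ((norm f)\<^sup>2)"
proof -
  have "Im (fock_cinner f f) = 0"
    using arg_cong[OF cinner_commute[of f f], of Im] by simp
  then show ?thesis
    using power2_norm_eq_inner[of f] by (simp add: complex_eq_iff inner_fock_def)
qed

lemma norm_eq_cinner:
  assumes "fock_cinner f f = fock_cinner g g"
  shows "norm f = norm g"
proof -
  have "(norm f)\<^sup>2 = (norm g)\<^sup>2"
    using assms unfolding cinner_self of_real_eq_iff .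
  then show ?thesis
    by (simp add: power2_eq_iff_nonneg)
qed

lemma norm_square_has_sum: "((\<lambda>w. (cmod (fock_coord f w))\<^sup>2) has_sum (norm f)\<^sup>2) UNIV"
proof -
  have "((\<lambda>w. Re (cnj (fock_coord f w) * fock_coord f w)) has_sum Re (fock_cinner f f)) UNIV"
    by (rule has_sum_Re[OF cinner_has_sum])
  moreover have "Re (cnj z * z) = (cmod z)\<^sup>2" for z
    unfolding cmod_power2 by (simp add: power2_eq_square)
  ultimately show ?thesis
    by (simp add: cinner_self)
qed

lemma norm_fock_scale: "norm (c *\<^sub>C f) = cmod c * norm f"
proof -
  have "complex_of_real ((norm (c *\<^sub>C f))\<^sup>2) = (c * cnj c) * complex_of_real ((norm f)\<^sup>2)"
    unfolding cinner_self[symmetric] cinner_scale_left cinner_scale_right by (simp only: mult_ac)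
  also have "\<dots> = complex_of_real ((cmod c * norm f)\<^sup>2)"
    unfolding complex_norm_square[symmetric] by (simp only: of_real_mult power_mult_distrib)
  finally have "(norm (c *\<^sub>C f))\<^sup>2 = (cmod c * norm f)\<^sup>2"
    by (simp only: of_real_eq_iff)
  then show ?thesis
    by (simp add: power2_eq_iff_nonneg)
qed

text \<open>Multiplying \<open>g\<close> by the conjugate of the inner product turns that product
  into its squared modulus, so that Cauchy-Schwarz for the real inner product applies.\<close>

lemma cinner_bound: "cmod (fock_cinner f g) \<le> norm f * norm g"
proof (cases "fock_cinner f g = 0")
  case False
  let ?c = "fock_cinner f g"
  have "(cmod ?c)\<^sup>2 = inner f (cnj ?c *\<^sub>C g)"
    unfolding cmod_power2 by (simp add: inner_fock_def cinner_scale_right power2_eq_square)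
  also have "\<dots> \<le> norm f * norm (cnj ?c *\<^sub>C g)"
    by (rule norm_cauchy_schwarz)
  finally have "cmod ?c * cmod ?c \<le> cmod ?c * (norm f * norm g)"
    by (simp add: norm_fock_scale power2_eq_square mult_ac)
  then show ?thesis
    using False by simp
qed simp

lemma bounded_bilinear_cinner: "bounded_bilinear fock_cinner"
proof
  fix f f' g g' :: "'a fock" and r :: real
  show "fock_cinner (f + f') g = fock_cinner f g + fock_cinner f' g"
    "fock_cinner f (g + g') = fock_cinner f g + fock_cinner f g'"
    by (simp_all add: cinner_add_left cinner_add_right)
  show "fock_cinner (r *\<^sub>R f) g = r *\<^sub>R fock_cinner f g" "fock_cinner f (r *\<^sub>R g) = r *\<^sub>R fock_cinner f g"
    unfolding scaleR_fock_def cinner_scale_left cinner_scale_right by (simp_all add: scaleR_conv_of_real)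
  show "\<exists>K. \<forall>f g :: 'a fock. norm (fock_cinner f g) \<le> norm f * norm g * K"
    by (intro exI[of _ 1]) (simp add: cinner_bound)
qed

lemmas cinner_bilinear =
  bounded_bilinear.add_left[OF bounded_bilinear_cinner]
  bounded_bilinear.add_right[OF bounded_bilinear_cinner]
  bounded_bilinear.diff_left[OF bounded_bilinear_cinner]
  bounded_bilinear.diff_right[OF bounded_bilinear_cinner]
  bounded_bilinear.minus_left[OF bounded_bilinear_cinner]
  bounded_bilinear.minus_right[OF bounded_bilinear_cinner]
  bounded_bilinear.zero_left[OF bounded_bilinear_cinner]
  bounded_bilinear.zero_right[OF bounded_bilinear_cinner]
  cinner_scale_left cinner_scale_right

lemmas cinner_sum_left = bounded_bilinear.sum_left[OF bounded_bilinear_cinner]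
lemmas cinner_sum_right = bounded_bilinear.sum_right[OF bounded_bilinear_cinner]
lemmas tendsto_cinner = bounded_bilinear.tendsto[OF bounded_bilinear_cinner]

lemma bounded_linear_fock_scale: "bounded_linear ((*\<^sub>C) c)"
  by (rule bounded_linear_intro[where K = "cmod c"])
    (simp_all add: fock_scale_laws norm_fock_scale mult.commute)

lemmas tendsto_fock_scale = bounded_linear.tendsto[OF bounded_linear_fock_scale]

lemma cinner_eqI:
  assumes "\<And>g. fock_cinner g f = fock_cinner g f'"
  shows "f = f'"
proof -
  have "fock_cinner (f - f') (f - f') = 0"
    using assms[of "f - f'"] by (simp add: cinner_bilinear)
  then show ?thesis
    by (simp add: cinner_self)
qed

lemma cmod_fock_coord_le: "cmod (fock_coord f w) \<le> norm f"
proof -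
  have "sum (\<lambda>w. (cmod (fock_coord f w))\<^sup>2) {w} \<le> (norm f)\<^sup>2"
    by (rule finite_sum_le_has_sum[OF norm_square_has_sum]) auto
  then show ?thesis
    by (simp add: abs_le_square_iff[symmetric])
qed

lemma norm_fock_leI:
  assumes "\<And>w. cmod (fock_coord f w) \<le> cmod (fock_coord g w)"
  shows "norm f \<le> norm g"
proof -
  have "(norm f)\<^sup>2 \<le> (norm g)\<^sup>2"
    by (rule has_sum_mono[OF norm_square_has_sum norm_square_has_sum]) (simp add: assms power_mono)
  then show ?thesis
    by (simp add: power2_le_iff_abs_le)
qed

text \<open>Coordinates converge, and bounds on sums over finite sets of words survive the limit, as
  in Fatou's lemma. The limit \<open>g\<close> is first recognized as \<open>X M1\<close> plus a
  square summable difference, and only then compared with \<open>X\<close> in norm.\<close>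

instance fock :: (type) complete_space
proof
  fix X :: "nat \<Rightarrow> 'a fock"
  assume X: "Cauchy X"
  have "Cauchy (\<lambda>n. fock_coord (X n) w)" for w
  proof (rule metric_CauchyI)
    fix e :: real assume "0 < e"
    then obtain M where M: "dist (X m) (X n) < e" if "M \<le> m" "M \<le> n" for m n
      using metric_CauchyD[OF X] by blast
    have "dist (fock_coord (X m) w) (fock_coord (X n) w) \<le> dist (X m) (X n)" for m n
      using cmod_fock_coord_le[of "X m - X n" w] by (simp add: dist_norm fock_coord_simps)
    then show "\<exists>M. \<forall>m\<ge>M. \<forall>n\<ge>M. dist (fock_coord (X m) w) (fock_coord (X n) w) < e"
      using M by (meson order_le_less_trans)
  qed
  then have "\<forall>w. \<exists>l. (\<lambda>n. fock_coord (X n) w) \<longlonglongrightarrow> l"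
    by (simp add: Cauchy_convergent_iff convergent_def)
  then obtain g where g: "(\<lambda>n. fock_coord (X n) w) \<longlonglongrightarrow> g w" for w
    by metis
  have perm: "g u = g v" if "mset u = mset v" for u v
    using LIMSEQ_unique[OF g[of u]] g[of v] by (simp add: fock_coord_perm[OF that])
  have tail: "\<exists>M. \<forall>m\<ge>M. \<forall>F. finite F \<longrightarrow> (\<Sum>w\<in>F. (cmod (g w - fock_coord (X m) w))\<^sup>2) \<le> e\<^sup>2"
    if "0 < e" for e
  proof -
    obtain M where M: "dist (X m) (X n) < e" if "M \<le> m" "M \<le> n" for m n
      using metric_CauchyD[OF X \<open>0 < e\<close>] by blast
    have "(\<Sum>w\<in>F. (cmod (g w - fock_coord (X m) w))\<^sup>2) \<le> e\<^sup>2" if "finite F" "M \<le> m" for F m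
    proof (rule LIMSEQ_le_const2)
      show "(\<lambda>n. \<Sum>w\<in>F. (cmod (fock_coord (X n) w - fock_coord (X m) w))\<^sup>2)
          \<longlonglongrightarrow> (\<Sum>w\<in>F. (cmod (g w - fock_coord (X m) w))\<^sup>2)"
        by (intro tendsto_intros g)
      have "(\<Sum>w\<in>F. (cmod (fock_coord (X n) w - fock_coord (X m) w))\<^sup>2) \<le> e\<^sup>2" if "M \<le> n" for n
      proof -
        have "(\<Sum>w\<in>F. (cmod (fock_coord (X n - X m) w))\<^sup>2) \<le> (norm (X n - X m))\<^sup>2"
          by (rule finite_sum_le_has_sum[OF norm_square_has_sum]) (use \<open>finite F\<close> in auto)
        also have "\<dots> \<le> e\<^sup>2"
          using M[OF \<open>M \<le> n\<close> \<open>M \<le> m\<close>] by (intro power_mono) (auto simp: dist_norm)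
        finally show ?thesis
          by (simp add: fock_coord_simps)
      qed
      then show "\<exists>N. \<forall>n\<ge>N. (\<Sum>w\<in>F. (cmod (fock_coord (X n) w - fock_coord (X m) w))\<^sup>2) \<le> e\<^sup>2"
        by blast
    qed
    then show ?thesis
      by blast
  qed
  have diff: "fock_fun (\<lambda>w. g w - fock_coord (X m) w)"
    if "\<forall>F. finite F \<longrightarrow> (\<Sum>w\<in>F. (cmod (g w - fock_coord (X m) w))\<^sup>2) \<le> c" for m c
  proof (rule fock_funI)
    show "g u - fock_coord (X m) u = g v - fock_coord (X m) v" if "mset u = mset v" for u v
      using perm[OF that] fock_coord_perm[OF that, of "X m"] by simp
    show "(\<lambda>w. (cmod (g w - fock_coord (X m) w))\<^sup>2) summable_on UNIV"
      by (rule nonneg_bdd_above_summable_on) (use that in \<open>auto intro!: bdd_aboveI2\<close>)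
  qed
  obtain M1 where M1: "\<forall>F. finite F \<longrightarrow> (\<Sum>w\<in>F. (cmod (g w - fock_coord (X M1) w))\<^sup>2) \<le> 1\<^sup>2"
    using tail[of 1] by auto
  have "fock_fun (\<lambda>w. (g w - fock_coord (X M1) w) + fock_coord (X M1) w)"
    by (rule fock_fun_add[OF diff[OF M1] fock_coord_fun])
  then have gf: "fock_fun g"
    by simp
  define G where "G = Abs_fock g"
  have G: "fock_coord G w = g w" for w
    unfolding G_def using gf by (simp add: Abs_fock_inverse)
  have "X \<longlonglongrightarrow> G"
  proof (rule metric_LIMSEQ_I)
    fix r :: real assume "0 < r"
    then obtain M where M: "\<forall>m\<ge>M. \<forall>F. finite F \<longrightarrow>
        (\<Sum>w\<in>F. (cmod (g w - fock_coord (X m) w))\<^sup>2) \<le> (r / 2)\<^sup>2"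
      using tail[of "r / 2"] by auto
    have "dist (X m) G < r" if "M \<le> m" for m
    proof -
      have "(norm (G - X m))\<^sup>2 \<le> (r / 2)\<^sup>2"
        by (rule has_sum_le_finite_sums[OF norm_square_has_sum])
          (use M that in \<open>auto simp: fock_coord_simps G\<close>)
      then have "norm (G - X m) \<le> r / 2"
        using \<open>0 < r\<close> by (simp add: power2_le_iff_abs_le)
      then show ?thesis
        using \<open>0 < r\<close> by (simp add: dist_norm norm_minus_commute)
    qed
    then show "\<exists>no. \<forall>n\<ge>no. dist (X n) G < r"
      by blast
  qed
  then show "convergent X"
    by (rule convergentI)
qed

section \<open>Exponential vectors and the occupation number basis\<close>

definition cdot :: "complex^'n \<Rightarrow> complex^'n \<Rightarrow> complex"
  where "cdot u v = (\<Sum>j\<in>UNIV. cnj (u $ j) * v $ j)"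

lemma cdot_linear:
  "cdot (u + v) w = cdot u w + cdot v w" "cdot u (v + w) = cdot u v + cdot u w"
  "cdot (- u) w = - cdot u w" "cdot u (- w) = - cdot u w"
  "cdot (r *\<^sub>R u) w = complex_of_real r * cdot u w" "cdot u (r *\<^sub>R w) = complex_of_real r * cdot u w"
  by (simp_all add: cdot_def algebra_simps sum.distrib sum_distrib_left sum_negf scaleR_conv_of_real[where 'a = complex])

lemma cdot_zero: "cdot u 0 = 0" "cdot 0 u = 0"
  by (simp_all add: cdot_def)

lemma cdot_commute: "cdot v u = cnj (cdot u v)"
  by (simp add: cdot_def mult.commute)

lemma cdot_self: "cdot u u = complex_of_real ((norm u)\<^sup>2)"
proof -
  have "(norm u)\<^sup>2 = (\<Sum>j\<in>UNIV. (cmod (u $ j))\<^sup>2)"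
    by (simp add: norm_vec_def L2_set_def sum_nonneg)
  then show ?thesis
    by (simp only: cdot_def of_real_sum complex_norm_square mult.commute)
qed

text \<open>Used with the fibres of \<open>length\<close>, where sums over words become power series
  and norms split by particle number, and with the fibres of \<open>mset\<close>, where it gives
  Parseval's identity.\<close>

lemma has_sum_partition:
  fixes f :: "'a \<Rightarrow> 'c :: {comm_monoid_add, t3_space, topological_comm_monoid_add}"
  assumes f: "(f has_sum s) UNIV" and g: "\<And>b. (f has_sum g b) {a. k a = b}"
  shows "(g has_sum s) UNIV"
proof -
  have "inj_on snd (SIGMA b:UNIV. {a. k a = b})"
    by (auto simp: inj_on_def)
  moreover have "snd ` (SIGMA b:UNIV. {a. k a = b}) = UNIV"
    by force
  ultimately have "((f \<circ> snd) has_sum s) (SIGMA b:UNIV. {a. k a = b})"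
    using f has_sum_reindex by metis
  then show ?thesis
    by (rule has_sum_SigmaD) (simp add: g)
qed

lemma finite_words_length: "finite {w :: 'n::finite list. length w = r}"
  using finite_lists_length_eq[of "UNIV :: 'n set" r] by simp

lemma sum_prod_words_general:
  fixes a :: "'n::finite \<Rightarrow> 'a::comm_semiring_1"
  shows "(\<Sum>w | length w = r. prod_list (map a w)) = (\<Sum>i\<in>UNIV. a i) ^ r"
proof (induction r)
  case (Suc r)
  have eq: "{w :: 'n list. length w = Suc r} = (\<lambda>(x, w). x # w) ` (UNIV \<times> {w. length w = r})"
    by (force simp: length_Suc_conv image_iff)
  have "(\<Sum>w | length w = Suc r. prod_list (map a w))
      = (\<Sum>(x, w)\<in>UNIV \<times> {w. length w = r}. a x * prod_list (map a w))"
    unfolding eq by (subst sum.reindex) (auto simp: inj_on_def case_prod_unfold intro!: sum.cong)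
  also have "\<dots> = (\<Sum>x\<in>UNIV. a x) * (\<Sum>w | length w = r. prod_list (map a w))"
    by (simp add: sum.cartesian_product[symmetric] sum_product)
  finally show ?case
    using Suc.IH by simp
qed simp

lemma words_has_sumD:
  fixes a :: "'n::finite \<Rightarrow> complex"
  assumes "((\<lambda>w. g (length w) * prod_list (map a w)) has_sum s) UNIV"
  shows "(\<lambda>r. g r * (\<Sum>i\<in>UNIV. a i) ^ r) sums s"
proof (rule has_sum_imp_sums, rule has_sum_partition[OF assms, where k = length])
  fix r
  have eq: "(\<Sum>w | length w = r. g (length w) * prod_list (map a w)) = g r * (\<Sum>i\<in>UNIV. a i) ^ r"
    by (simp add: sum_prod_words_general[symmetric] sum_distrib_left)
  show "((\<lambda>w. g (length w) * prod_list (map a w)) has_sum g r * (\<Sum>i\<in>UNIV. a i) ^ r) {w. length w = r}"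
    using has_sum_finite[OF finite_words_length, of "\<lambda>w. g (length w) * prod_list (map a w)" r]
    by (simp only: eq)
qed

lemma cnj_prod_list: "cnj (prod_list xs) = prod_list (map cnj xs)"
  by (induction xs) auto

lemma prod_list_map_mult:
  "prod_list (map (\<lambda>x. f x * g x) xs) = prod_list (map f xs) * (prod_list (map g xs) :: 'a::comm_monoid_mult)"
  by (induction xs) (auto simp: mult_ac)

lemma of_real_sqrt_square: "0 \<le> x \<Longrightarrow> complex_of_real (sqrt x) * complex_of_real (sqrt x) = complex_of_real x"
  by (simp flip: of_real_mult)

lemma cnj_exp_vec_mult:
  "cnj (fock_coord (exp_vec u) w) * fock_coord (exp_vec v) w
    = 1 / fact (length w) * prod_list (map (\<lambda>i. cnj (u $ i) * v $ i) w)"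
  by (simp add: exp_vec.rep_eq cnj_prod_list prod_list_map_mult of_real_sqrt_square o_def)

lemma cinner_exp_vec: "fock_cinner (exp_vec u) (exp_vec v) = exp (cdot u v)"
proof -
  have "(\<lambda>r. 1 / fact r * (\<Sum>i\<in>UNIV. cnj (u $ i) * v $ i) ^ r) sums fock_cinner (exp_vec u) (exp_vec v)"
    using cinner_has_sum[of "exp_vec u" "exp_vec v"] unfolding cnj_exp_vec_mult by (rule words_has_sumD)
  moreover have "(\<lambda>r. 1 / fact r * cdot u v ^ r) sums exp (cdot u v)"
    using exp_converges[of "cdot u v"] by (simp add: scaleR_conv_of_real divide_inverse)
  ultimately show ?thesis
    unfolding cdot_def by (rule sums_unique2)
qed

lemma of_nat_le_two_power_complex: "real r * x \<le> 2 ^ r * x" if "0 \<le> x"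
proof -
  have "real r \<le> 2 ^ r"
    using less_exp[of r] by (metis of_nat_less_iff of_nat_numeral of_nat_power less_imp_le)
  then show ?thesis
    using that by (rule mult_right_mono)
qed

lemma fock_coord_exp_vec_scale:
  "fock_coord (exp_vec (t *\<^sub>R u)) w = complex_of_real t ^ length w * fock_coord (exp_vec u) w"
proof -
  have "prod_list (map (\<lambda>i. complex_of_real t * u $ i) w) = complex_of_real t ^ length w * prod_list (map (\<lambda>i. u $ i) w)"
    by (induction w) auto
  then show ?thesis
    by (simp add: exp_vec.rep_eq scaleR_conv_of_real[where 'a = complex])
qed

lift_definition num_exp_vec :: "complex^'n \<Rightarrow> 'n::finite fock"
  is "\<lambda>u w. of_nat (length w) * fock_coord (exp_vec u) w"
proof (rule fock_funI)
  fix u :: "complex^'n" and v w :: "'n list"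
  assume vw: "mset v = mset w"
  show "of_nat (length v) * fock_coord (exp_vec u) v = of_nat (length w) * fock_coord (exp_vec u) w"
    using fock_coord_perm[OF vw] mset_eq_length[OF vw] by simp
next
  fix u :: "complex^'n"
  show "(\<lambda>w. (cmod (of_nat (length w) * fock_coord (exp_vec u) w))\<^sup>2) summable_on UNIV"
  \<comment> \<open>As r <= 2^r, the coordinates are dominated by those of the exponential vector of
    2 u.\<close>
  proof (rule summable_on_comparison_test[OF fock_coord_square_summable[of "exp_vec (2 *\<^sub>R u)"]])
    fix w
    show "(cmod (of_nat (length w) * fock_coord (exp_vec u) w))\<^sup>2 \<le> (cmod (fock_coord (exp_vec (2 *\<^sub>R u)) w))\<^sup>2"
      unfolding fock_coord_exp_vec_scale norm_mult
      by (intro power_mono) (simp_all add: norm_power of_nat_le_two_power_complex)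
  qed auto
qed

text \<open>N acts on the kernel as x d/dx acts on the exponential series, which yields x exp x at x
  = \<open>cdot u v\<close>.\<close>

lemma cinner_num_exp_vec: "fock_cinner (exp_vec u) (num_exp_vec v) = cdot u v * exp (cdot u v)"
proof -
  have eq: "cnj (fock_coord (exp_vec u) w) * fock_coord (num_exp_vec v) w
      = (of_nat (length w) / fact (length w)) * prod_list (map (\<lambda>i. cnj (u $ i) * v $ i) w)" for w
    using cnj_exp_vec_mult[of u w v] by (simp add: num_exp_vec.rep_eq field_simps)
  have "(\<lambda>r. of_nat r / fact r * (\<Sum>i\<in>UNIV. cnj (u $ i) * v $ i) ^ r) sums fock_cinner (exp_vec u) (num_exp_vec v)"
    using cinner_has_sum[of "exp_vec u" "num_exp_vec v"] unfolding eq
    by (rule words_has_sumD[where g = "\<lambda>r. of_nat r / fact r"])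
  moreover have "(\<lambda>r. of_nat r / fact r * cdot u v ^ r) sums (cdot u v * exp (cdot u v))"
  proof -
    have "(\<lambda>r. cdot u v * (cdot u v ^ r /\<^sub>R fact r)) sums (cdot u v * exp (cdot u v))"
      by (intro sums_mult exp_converges)
    moreover have "cdot u v * (cdot u v ^ r /\<^sub>R fact r) = of_nat (Suc r) / fact (Suc r) * cdot u v ^ Suc r" for r
    proof -
      have "(of_nat (Suc r) :: complex) \<noteq> 0"
        by (rule of_nat_neq_0)
      then show ?thesis
        by (simp add: scaleR_conv_of_real fact_Suc divide_simps del: of_nat_Suc)
    qed
    ultimately have "(\<lambda>r. of_nat (Suc r) / fact (Suc r) * cdot u v ^ Suc r) sums (cdot u v * exp (cdot u v))"
      by simp
    then show ?thesis
      by (subst (asm) sums_Suc_iff) simp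
  qed
  ultimately show ?thesis
    unfolding cdot_def by (rule sums_unique2)
qed

section \<open>Parseval's identity in the occupation number basis\<close>

lemma words_of_mset: "{w. mset w = A} = permutations_of_multiset A"
  by (simp add: permutations_of_multiset_def)

lemma card_permutations_pos: "0 < real (card (permutations_of_multiset A))"
  by (simp add: card_gt_0_iff finite_permutations_of_multiset permutations_of_multiset_nonempty)

lemma cinner_number_vec:
  assumes "mset w = A"
  shows "fock_cinner (number_vec A) f
    = complex_of_real (sqrt (card (permutations_of_multiset A))) * fock_coord f w"
proof -
  let ?c = "real (card (permutations_of_multiset A))"
  have "fock_cinner (number_vec A) f
      = (\<Sum>\<^sub>\<infinity>v\<in>permutations_of_multiset A. complex_of_real (1 / sqrt ?c) * fock_coord f w)"
    unfolding fock_cinner_def number_vec.rep_eq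
  proof (rule infsum_cong_neutral)
    fix v assume "v \<in> UNIV \<inter> permutations_of_multiset A"
    then have "mset v = A"
      by (simp add: permutations_of_multiset_def)
    then show "cnj (if mset v = A then complex_of_real (1 / sqrt ?c) else 0) * fock_coord f v
        = complex_of_real (1 / sqrt ?c) * fock_coord f w"
      using fock_coord_perm[of v w f] assms by simp
  qed (auto simp: permutations_of_multiset_def)
  also have "\<dots> = complex_of_real (?c * (1 / sqrt ?c)) * fock_coord f w"
    by (simp add: finite_permutations_of_multiset)
  also have "?c * (1 / sqrt ?c) = sqrt ?c"
    using card_permutations_pos[of A] by (simp add: real_div_sqrt)
  finally show ?thesis .
qed

lemma parseval_number_vec:
  "((\<lambda>A. fock_cinner f (number_vec A) * fock_cinner (number_vec A) g) has_sum fock_cinner f g) UNIV"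
proof (rule has_sum_partition[OF cinner_has_sum, where k = mset])
  fix A :: "'a multiset"
  let ?c = "real (card (permutations_of_multiset A))"
  obtain w where w: "mset w = A"
    using ex_mset by blast
  have "fock_cinner f (number_vec A) * fock_cinner (number_vec A) g
      = complex_of_real ?c * (cnj (fock_coord f w) * fock_coord g w)"
    unfolding cinner_commute[of f "number_vec A"] cinner_number_vec[OF w]
    using of_real_sqrt_square[of ?c] by (simp add: algebra_simps)
  also have "\<dots> = (\<Sum>v\<in>permutations_of_multiset A. cnj (fock_coord f w) * fock_coord g w)"
    by simp
  also have "\<dots> = (\<Sum>v\<in>permutations_of_multiset A. cnj (fock_coord f v) * fock_coord g v)"
  proof (rule sum.cong[OF refl])
    fix v assume "v \<in> permutations_of_multiset A"
    then have "mset w = mset v"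
      by (simp add: permutations_of_multiset_def w)
    then show "cnj (fock_coord f w) * fock_coord g w = cnj (fock_coord f v) * fock_coord g v"
      using fock_coord_perm by metis
  qed
  finally have eq: "fock_cinner f (number_vec A) * fock_cinner (number_vec A) g
      = (\<Sum>v\<in>permutations_of_multiset A. cnj (fock_coord f v) * fock_coord g v)" .
  show "((\<lambda>v. cnj (fock_coord f v) * fock_coord g v) has_sum
      fock_cinner f (number_vec A) * fock_cinner (number_vec A) g) {v. mset v = A}"
    unfolding words_of_mset eq by (rule has_sum_finite[OF finite_permutations_of_multiset])
qed

section \<open>Orthogonality of characters on a grid of roots of unity\<close>

lemma prod_list_map_count:
  fixes a :: "'n::finite \<Rightarrow> 'a::comm_monoid_mult"
  shows "prod_list (map a w) = (\<Prod>j\<in>UNIV. a j ^ count (mset w) j)"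
proof (induction w)
  case (Cons i w)
  have "(\<Prod>j\<in>UNIV. a j ^ count (mset (i # w)) j) = (\<Prod>j\<in>UNIV. (if j = i then a j else 1) * a j ^ count (mset w) j)"
    by (rule prod.cong) auto
  also have "\<dots> = a i * prod_list (map a w)"
    by (simp add: prod.distrib Cons.IH)
  finally show ?case
    by simp
qed simp

text \<open>If the exponents differ modulo \<open>M\<close>, the base is an \<open>M\<close>-th root
  of unity other than 1 and its geometric sum vanishes.\<close>

lemma root_of_unity_sum:
  fixes a b M :: nat
  assumes "0 < M"
  defines "\<omega> \<equiv> exp (2 * of_real pi * \<i> / of_nat M)"
  shows "(\<Sum>k<M. (\<omega> ^ a * inverse \<omega> ^ b) ^ k) = (if a mod M = b mod M then of_nat M else 0)"
proof -
  have pow: "\<omega> ^ k = exp (2 * of_real pi * \<i> * of_nat k / of_nat M)" for k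
    unfolding \<omega>_def by (simp add: mult_ac flip: exp_of_nat_mult)
  have nz: "\<omega> \<noteq> 0"
    by (simp add: \<omega>_def)
  have one: "\<omega> ^ M = 1"
    unfolding pow using assms(1) by (simp add: exp_two_pi_i)
  have eq: "\<omega> ^ a * inverse \<omega> ^ b = 1 \<longleftrightarrow> a mod M = b mod M"
  proof -
    have "\<omega> ^ a * inverse \<omega> ^ b = 1 \<longleftrightarrow> \<omega> ^ a = \<omega> ^ b"
      using nz by (simp add: field_simps)
    then show ?thesis
      unfolding pow using complex_root_unity_eq[of M a b] assms(1) by simp
  qed
  have "(\<omega> ^ a * inverse \<omega> ^ b) ^ M = (\<omega> ^ M) ^ a * inverse (\<omega> ^ M) ^ b"
    by (simp add: power_mult_distrib power_inverse mult.commute flip: power_mult)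
  then have "(\<omega> ^ a * inverse \<omega> ^ b) ^ M = 1"
    by (simp add: one)
  then show ?thesis
    using eq geometric_sum[of "\<omega> ^ a * inverse \<omega> ^ b" M] by auto
qed

section \<open>Exponential vectors form a core of the number operator\<close>

text \<open>A discrete Fourier transform: every word contributes a product of characters over the
  modes, and orthogonality in each mode keeps only the words whose multiplicities agree with
  \<open>a\<close> modulo \<open>M\<close>.\<close>

lemma torus_sum_coord:
  fixes a :: "'n::finite \<Rightarrow> nat" and w :: "'n list" and \<epsilon> :: real
  assumes "0 < M"
  defines "\<omega> \<equiv> exp (2 * of_real pi * \<i> / of_nat M)"
  shows "(\<Sum>\<kappa>\<in>PiE UNIV (\<lambda>_. {..<M}). (\<Prod>j\<in>UNIV. (inverse \<omega> ^ a j) ^ \<kappa> j) *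
      fock_coord (exp_vec (\<chi> j. complex_of_real \<epsilon> * \<omega> ^ \<kappa> j)) w)
    = (if \<forall>j. count (mset w) j mod M = a j mod M
       then of_nat M ^ CARD('n) * (complex_of_real \<epsilon> ^ length w / complex_of_real (sqrt (fact (length w)))) else 0)"
proof -
  let ?E = "complex_of_real \<epsilon> ^ length w / complex_of_real (sqrt (fact (length w)))"
  have "(\<Prod>j\<in>UNIV. (inverse \<omega> ^ a j) ^ \<kappa> j) * fock_coord (exp_vec (\<chi> j. complex_of_real \<epsilon> * \<omega> ^ \<kappa> j)) w
      = ?E * (\<Prod>j\<in>UNIV. (\<omega> ^ count (mset w) j * inverse \<omega> ^ a j) ^ \<kappa> j)" for \<kappa>
  proof -
    have "prod_list (map (\<lambda>j. complex_of_real \<epsilon> * \<omega> ^ \<kappa> j) w)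
        = complex_of_real \<epsilon> ^ length w * (\<Prod>j\<in>UNIV. (\<omega> ^ \<kappa> j) ^ count (mset w) j)"
      unfolding prod_list_map_mult prod_list_map_count[symmetric]
      by (simp add: map_replicate_const)
    moreover have "(\<Prod>j\<in>UNIV. (inverse \<omega> ^ a j) ^ \<kappa> j) * (\<Prod>j\<in>UNIV. (\<omega> ^ \<kappa> j) ^ count (mset w) j)
        = (\<Prod>j\<in>UNIV. (\<omega> ^ count (mset w) j * inverse \<omega> ^ a j) ^ \<kappa> j)"
      unfolding prod.distrib[symmetric]
      by (rule prod.cong) (simp_all add: power_mult_distrib mult_ac flip: power_mult)
    ultimately show ?thesis
      by (simp add: exp_vec.rep_eq mult_ac)
  qed
  then have "(\<Sum>\<kappa>\<in>PiE UNIV (\<lambda>_. {..<M}). (\<Prod>j\<in>UNIV. (inverse \<omega> ^ a j) ^ \<kappa> j) *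
      fock_coord (exp_vec (\<chi> j. complex_of_real \<epsilon> * \<omega> ^ \<kappa> j)) w)
    = ?E * (\<Sum>\<kappa>\<in>PiE UNIV (\<lambda>_. {..<M}). \<Prod>j\<in>UNIV. (\<omega> ^ count (mset w) j * inverse \<omega> ^ a j) ^ \<kappa> j)"
    by (simp add: sum_distrib_left)
  also have "\<dots> = ?E * (\<Prod>j\<in>UNIV. \<Sum>k<M. (\<omega> ^ count (mset w) j * inverse \<omega> ^ a j) ^ k)"
    by (subst prod_sum_PiE) auto
  also have "(\<Prod>j\<in>UNIV. \<Sum>k<M. (\<omega> ^ count (mset w) j * inverse \<omega> ^ a j) ^ k)
      = (\<Prod>j\<in>UNIV. if count (mset w) j mod M = a j mod M then of_nat M else 0)"
    unfolding \<omega>_def by (rule prod.cong[OF refl], rule root_of_unity_sum[OF assms(1)])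
  also have "\<dots> = (if \<forall>j. count (mset w) j mod M = a j mod M then of_nat M ^ CARD('n) else 0)"
    by auto
  finally show ?thesis
    by (simp add: mult.commute)
qed

text \<open>The modulus exceeds all multiplicities of \<open>A\<close>, so aliasing can only add
  letters. Every unwanted word that survives the averaging is thus longer than \<open>A\<close> and
  brings an extra factor epsilon.\<close>

lemma congruent_multiset_size:
  assumes "\<And>j. count B j mod Suc (size A) = count A j mod Suc (size A)" "B \<noteq> A"
  shows "size A < size B"
proof -
  have "count A j \<le> count B j" for j
  proof -
    have "count A j mod Suc (size A) = count A j"
      by (simp add: count_le_size less_Suc_eq_le)
    then show ?thesis
      using assms(1)[of j] by (metis mod_less_eq_dividend)
  qed
  then have "A \<subset># B"
    using assms(2) by (simp add: subset_mset_def subseteq_mset_def)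
  then show ?thesis
    by (rule mset_subset_size)
qed

text \<open>The generating set is closed under complex multiples, so its real span is a complex
  subspace. As a relation it makes sense before the assignment of \<open>y v\<close> to
  \<open>exp_vec v\<close> is known to extend to an operator; \<open>y\<close> will be
  \<open>num_exp_vec\<close> or the prescribed images under an isometry.\<close>

definition exp_graph :: "(complex^'n \<Rightarrow> 'n fock) \<Rightarrow> ('n::finite fock \<times> 'n fock) set"
  where "exp_graph y = span {(c *\<^sub>C exp_vec v, c *\<^sub>C y v) | c v. True}"

text \<open>
  Averaging the exponential vectors \<open>exp_vec (\<epsilon> \<omega>)\<close> against a character over a grid of roots of unity
  \<open>\<omega>\<close> leaves \<open>number_vec A\<close> and an error of order \<open>\<epsilon>\<close>.
\<close>

lemma number_vec_approx:
  fixes A :: "'n::finite multiset" and \<epsilon> :: real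
  assumes \<epsilon>: "0 < \<epsilon>" "\<epsilon> \<le> 1"
  shows "\<exists>(f, g) \<in> exp_graph num_exp_vec.
    norm (f - number_vec A) \<le> sqrt (fact (size A)) * \<epsilon> * norm (exp_vec 1 :: 'n fock) \<and>
    norm (g - of_nat (size A) *\<^sub>C number_vec A) \<le> sqrt (fact (size A)) * \<epsilon> * norm (num_exp_vec 1 :: 'n fock)"
proof -
  define M where "M = Suc (size A)"
  define \<omega> where "\<omega> = exp (2 * of_real pi * \<i> / of_nat M)"
  let ?c = "real (card (permutations_of_multiset A))"
  \<comment> \<open>\<open>K\<close> makes words with multiset \<open>A\<close> receive exactly
    their coefficient in \<open>number_vec A\<close>, so that the whole error comes from
    aliases.\<close>
  define K where "K = complex_of_real (sqrt (fact (size A)) / sqrt ?c) / (of_nat M ^ CARD('n) * complex_of_real \<epsilon> ^ size A)"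
  let ?I = "PiE (UNIV :: 'n set) (\<lambda>_. {..<M})"
  define v :: "('n \<Rightarrow> nat) \<Rightarrow> complex^'n" where "v = (\<lambda>\<kappa>. \<chi> j. complex_of_real \<epsilon> * \<omega> ^ \<kappa> j)"
  define d where "d = (\<lambda>\<kappa>. K * (\<Prod>j\<in>UNIV. (inverse \<omega> ^ count A j) ^ \<kappa> j))"
  define f where "f = (\<Sum>\<kappa>\<in>?I. d \<kappa> *\<^sub>C exp_vec (v \<kappa>))"
  define g where "g = (\<Sum>\<kappa>\<in>?I. d \<kappa> *\<^sub>C num_exp_vec (v \<kappa>))"
  have "(f, g) = (\<Sum>\<kappa>\<in>?I. (d \<kappa> *\<^sub>C exp_vec (v \<kappa>), d \<kappa> *\<^sub>C num_exp_vec (v \<kappa>)))"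
    unfolding f_def g_def by (simp add: sum_prod)
  also have "\<dots> \<in> exp_graph num_exp_vec"
    unfolding exp_graph_def by (intro span_sum span_base) auto
  finally have fg: "(f, g) \<in> exp_graph num_exp_vec" .
  have M: "0 < M" "(of_nat M :: complex) \<noteq> 0"
    by (simp_all add: M_def del: of_nat_Suc)
  have f_coord: "fock_coord f w = (if \<forall>j. count (mset w) j mod M = count A j mod M
      then complex_of_real (sqrt (fact (size A)) / sqrt ?c) * (complex_of_real \<epsilon> ^ length w / complex_of_real \<epsilon> ^ size A)
        / complex_of_real (sqrt (fact (length w))) else 0)" for w
  proof -
    have "fock_coord f w = K * (\<Sum>\<kappa>\<in>?I. (\<Prod>j\<in>UNIV. (inverse \<omega> ^ count A j) ^ \<kappa> j) * fock_coord (exp_vec (v \<kappa>)) w)"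
      unfolding f_def d_def by (simp add: fock_coord_sum fock_coord_simps sum_distrib_left mult.assoc)
    also have "\<dots> = K * (if \<forall>j. count (mset w) j mod M = count A j mod M
       then of_nat M ^ CARD('n) * (complex_of_real \<epsilon> ^ length w / complex_of_real (sqrt (fact (length w)))) else 0)"
      unfolding v_def \<omega>_def torus_sum_coord[OF M(1)] ..
    finally have eq: "fock_coord f w = \<dots>" .
    show ?thesis
    proof (cases "\<forall>j. count (mset w) j mod M = count A j mod M")
      case True
      then show ?thesis
        unfolding eq K_def if_P[OF True] using M(2) \<epsilon> by (simp add: field_simps)
    next
      case False
      then show ?thesis
        unfolding eq if_not_P[OF False] by simp
    qed
  qed
  have g_coord: "fock_coord g w = of_nat (length w) * fock_coord f w" for w
    unfolding f_def g_def
    by (simp add: fock_coord_sum fock_coord_simps num_exp_vec.rep_eq sum_distrib_left mult_ac)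
  have c1: "1 / sqrt ?c \<le> 1"
    using card_permutations_pos[of A] by simp
  have exp1: "fock_coord (exp_vec 1 :: 'n fock) w = complex_of_real (1 / sqrt (fact (length w)))" for w
    by (simp add: exp_vec.rep_eq map_replicate_const)
  have bound: "cmod (fock_coord (f - number_vec A) w)
      \<le> sqrt (fact (size A)) * \<epsilon> * cmod (fock_coord (exp_vec 1) w)" for w
  proof (cases "mset w = A")
    case True
    then have "size A = length w"
      by auto
    then have "fock_coord (f - number_vec A) w = 0"
      using True \<epsilon> by (simp add: fock_coord_simps f_coord number_vec.rep_eq)
    then show ?thesis
      using \<epsilon> by simp
  next
    case neq: False
    show ?thesis
    proof (cases "\<forall>j. count (mset w) j mod M = count A j mod M")
      case True
      then have "size A < length w"
        using congruent_multiset_size[of "mset w" A] neq by (simp add: M_def)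
      then have "\<epsilon> ^ length w / \<epsilon> ^ size A = \<epsilon> ^ Suc (length w - size A - 1)"
        using \<epsilon> by (simp add: power_diff[symmetric] Suc_diff_Suc)
      also have "\<dots> = \<epsilon> * \<epsilon> ^ (length w - size A - 1)"
        by simp
      also have "\<dots> \<le> \<epsilon> * 1"
        using \<epsilon> by (intro mult_left_mono power_le_one) auto
      finally have le: "\<epsilon> ^ length w / \<epsilon> ^ size A \<le> \<epsilon>"
        by simp
      have "cmod (fock_coord (f - number_vec A) w)
          = sqrt (fact (size A)) * (1 / sqrt ?c) * (\<epsilon> ^ length w / \<epsilon> ^ size A) * (1 / sqrt (fact (length w)))"
        using True neq \<epsilon> by (simp add: fock_coord_simps f_coord number_vec.rep_eq norm_mult norm_divide norm_power)
      also have "\<dots> \<le> sqrt (fact (size A)) * 1 * \<epsilon> * (1 / sqrt (fact (length w)))"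
        using \<epsilon> c1 le by (intro mult_mono mult_nonneg_nonneg) auto
      finally show ?thesis
        by (simp add: exp1 norm_divide)
    next
      case False
      have "fock_coord f w = 0"
        unfolding f_coord if_not_P[OF False] ..
      then have "fock_coord (f - number_vec A) w = 0"
        using neq by (simp add: fock_coord_simps number_vec.rep_eq)
      then show ?thesis
        using \<epsilon> by simp
    qed
  qed
  have "norm (f - number_vec A) \<le> norm ((sqrt (fact (size A)) * \<epsilon>) *\<^sub>R (exp_vec 1 :: 'n fock))"
    by (rule norm_fock_leI) (use bound \<epsilon> in \<open>simp add: fock_coord_scaleR norm_mult\<close>)
  moreover have "norm (g - of_nat (size A) *\<^sub>C number_vec A)
      \<le> norm ((sqrt (fact (size A)) * \<epsilon>) *\<^sub>R (num_exp_vec 1 :: 'n fock))"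
  proof (rule norm_fock_leI)
    fix w :: "'n list"
    \<comment> \<open>\<open>number_vec A\<close> lives on words of length \<open>size A\<close>, so
      the error of \<open>g\<close> is that of \<open>f\<close> multiplied by the word length. This
      turns the bound by \<open>exp_vec 1\<close> into one by \<open>num_exp_vec 1\<close>.\<close>
    have "of_nat (size A) * fock_coord (number_vec A) w = of_nat (length w) * fock_coord (number_vec A) w"
      by (auto simp: number_vec.rep_eq)
    then have "fock_coord (g - of_nat (size A) *\<^sub>C number_vec A) w = of_nat (length w) * fock_coord (f - number_vec A) w"
      by (simp add: fock_coord_simps g_coord right_diff_distrib)
    then have "cmod (fock_coord (g - of_nat (size A) *\<^sub>C number_vec A) w)
        = real (length w) * cmod (fock_coord (f - number_vec A) w)"
      by (simp add: norm_mult)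
    also have "\<dots> \<le> real (length w) * (sqrt (fact (size A)) * \<epsilon> * cmod (fock_coord (exp_vec 1) w))"
      by (intro mult_left_mono bound) simp
    also have "\<dots> = cmod (fock_coord ((sqrt (fact (size A)) * \<epsilon>) *\<^sub>R num_exp_vec 1) w)"
      using \<epsilon> by (simp add: fock_coord_scaleR num_exp_vec.rep_eq norm_mult)
    finally show "cmod (fock_coord (g - of_nat (size A) *\<^sub>C number_vec A) w)
        \<le> cmod (fock_coord ((sqrt (fact (size A)) * \<epsilon>) *\<^sub>R num_exp_vec 1) w)" .
  qed
  ultimately show ?thesis
    using fg \<epsilon> by (intro bexI[of _ "(f, g)"]) auto
qed

lemma number_vec_in_closure: "(number_vec A, of_nat (size A) *\<^sub>C number_vec A) \<in> closure (exp_graph num_exp_vec)"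
proof -
  have "\<exists>p \<in> exp_graph num_exp_vec.
      norm (fst p - number_vec A) \<le> sqrt (fact (size A)) * inverse (real (Suc m)) * norm (exp_vec 1 :: 'a fock) \<and>
      norm (snd p - of_nat (size A) *\<^sub>C number_vec A) \<le> sqrt (fact (size A)) * inverse (real (Suc m)) * norm (num_exp_vec 1 :: 'a fock)" for m
    using number_vec_approx[of "inverse (real (Suc m))" A] by (force simp: inverse_le_1_iff)
  then obtain p where p: "\<And>m. p m \<in> exp_graph num_exp_vec"
      "\<And>m. norm (fst (p m) - number_vec A) \<le> sqrt (fact (size A)) * inverse (real (Suc m)) * norm (exp_vec 1 :: 'a fock)"
      "\<And>m. norm (snd (p m) - of_nat (size A) *\<^sub>C number_vec A) \<le> sqrt (fact (size A)) * inverse (real (Suc m)) * norm (num_exp_vec 1 :: 'a fock)"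
    by metis
  have lim: "(\<lambda>m. a * inverse (real (Suc m)) * b) \<longlonglongrightarrow> 0" for a b :: real
    using tendsto_mult_left[OF LIMSEQ_inverse_real_of_nat, of "a * b"] by (simp add: mult_ac)
  have "(\<lambda>m. fst (p m) - number_vec A) \<longlonglongrightarrow> 0" "(\<lambda>m. snd (p m) - of_nat (size A) *\<^sub>C number_vec A) \<longlonglongrightarrow> 0"
    by (rule Lim_null_comparison[OF always_eventually lim]; use p in blast)+
  then have "(\<lambda>m. fst (p m)) \<longlonglongrightarrow> number_vec A" "(\<lambda>m. snd (p m)) \<longlonglongrightarrow> of_nat (size A) *\<^sub>C number_vec A"
    by (simp_all add: LIM_zero_iff)
  from tendsto_Pair[OF this] show ?thesis
    unfolding closure_sequential using p(1) by (intro exI[of _ p]) simp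
qed

section \<open>Linear structure of the graph and of its closure\<close>

lemma exp_graph_closureI:
  assumes "\<And>m. (f m, g m) \<in> exp_graph y" "f \<longlonglongrightarrow> a" "g \<longlonglongrightarrow> b"
  shows "(a, b) \<in> closure (exp_graph y)"
  unfolding closure_sequential using assms tendsto_Pair[OF assms(2,3)]
  by (intro exI[of _ "\<lambda>m. (f m, g m)"]) simp

lemma exp_graph_closureE:
  assumes "(a, b) \<in> closure (exp_graph y)"
  obtains f g where "\<And>m. (f m, g m) \<in> exp_graph y" "f \<longlonglongrightarrow> a" "g \<longlonglongrightarrow> b"
proof -
  obtain p where p: "\<And>m. p m \<in> exp_graph y" "p \<longlonglongrightarrow> (a, b)"
    using assms unfolding closure_sequential by blast
  show ?thesis
    using that[of "\<lambda>m. fst (p m)" "\<lambda>m. snd (p m)"] p(1) tendsto_fst[OF p(2)] tendsto_snd[OF p(2)]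
    by simp
qed

lemma exp_graph_add: "(f, g) \<in> exp_graph y \<Longrightarrow> (f', g') \<in> exp_graph y \<Longrightarrow> (f + f', g + g') \<in> exp_graph y"
  unfolding exp_graph_def using span_add by fastforce

lemma exp_graph_zero: "(0, 0) \<in> exp_graph y"
  unfolding exp_graph_def zero_prod_def[symmetric] by (rule span_zero)

text \<open>Builds a linear combination one exponential vector at a time; the real coefficient that
  comes from \<open>span\<close> is absorbed into the complex one.\<close>

lemma exp_graph_induct [consumes 1, case_names zero add]:
  assumes "(f, g) \<in> exp_graph y" "P 0 0"
    "\<And>c v f g. (f, g) \<in> exp_graph y \<Longrightarrow> P f g \<Longrightarrow> P (c *\<^sub>C exp_vec v + f) (c *\<^sub>C y v + g)"
  shows "P f g"
proof -
  have "case (f, g) of (f, g) \<Rightarrow> (f, g) \<in> exp_graph y \<and> P f g"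
    using assms(1) unfolding exp_graph_def
  proof (induction rule: span_induct_alt)
    case base
    show ?case
      using assms(2) exp_graph_zero[of y] by (simp add: zero_prod_def exp_graph_def)
  next
    case (step r x z)
    obtain c v where x: "x = (c *\<^sub>C exp_vec v, c *\<^sub>C y v)"
      using step.hyps by blast
    obtain f g where z: "z = (f, g)"
      by (cases z)
    have rx: "r *\<^sub>R x = ((r * c) *\<^sub>C exp_vec v, (r * c) *\<^sub>C y v)"
      unfolding x by (simp add: scaleR_fock_def fock_scale_laws)
    have "r *\<^sub>R x + z \<in> span {(c *\<^sub>C exp_vec v, c *\<^sub>C y v) | c v. True}"
      using step by (intro span_add span_scale[OF span_base]) auto
    then show ?case
      using assms(3)[of f g "r * c" v] step.IH unfolding z rx by (simp add: exp_graph_def)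
  qed
  then show ?thesis
    by simp
qed

lemma exp_graph_scale: "(f, g) \<in> exp_graph y \<Longrightarrow> (c *\<^sub>C f, c *\<^sub>C g) \<in> exp_graph y"
proof (induction rule: exp_graph_induct)
  case zero
  show ?case
    by (simp add: fock_scale_laws exp_graph_zero)
next
  case (add d v f g)
  have "((c * d) *\<^sub>C exp_vec v, (c * d) *\<^sub>C y v) \<in> exp_graph y"
    unfolding exp_graph_def by (rule span_base) blast
  from exp_graph_add[OF this add.IH] show ?case
    by (simp add: fock_scale_laws)
qed

lemma closure_exp_graph_scale: "(f, g) \<in> closure (exp_graph y) \<Longrightarrow> (c *\<^sub>C f, c *\<^sub>C g) \<in> closure (exp_graph y)"
proof (elim exp_graph_closureE)
  fix F G
  assume F: "\<And>m. (F m, G m) \<in> exp_graph y" "F \<longlonglongrightarrow> f" "G \<longlonglongrightarrow> g"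
  show "(c *\<^sub>C f, c *\<^sub>C g) \<in> closure (exp_graph y)"
    by (rule exp_graph_closureI[of "\<lambda>m. c *\<^sub>C F m" "\<lambda>m. c *\<^sub>C G m"])
      (intro exp_graph_scale tendsto_fock_scale F)+
qed

lemma closure_exp_graph_add:
  assumes "(f, g) \<in> closure (exp_graph y)" "(f', g') \<in> closure (exp_graph y)"
  shows "(f + f', g + g') \<in> closure (exp_graph y)"
proof -
  obtain F G where 1: "\<And>m. (F m, G m) \<in> exp_graph y" "F \<longlonglongrightarrow> f" "G \<longlonglongrightarrow> g"
    using assms(1) by (rule exp_graph_closureE) blast
  obtain F' G' where 2: "\<And>m. (F' m, G' m) \<in> exp_graph y" "F' \<longlonglongrightarrow> f'" "G' \<longlonglongrightarrow> g'"
    using assms(2) by (rule exp_graph_closureE) blast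
  show ?thesis
    by (rule exp_graph_closureI[of "\<lambda>m. F m + F' m" "\<lambda>m. G m + G' m"])
      (intro exp_graph_add tendsto_add 1 2)+
qed

lemma closure_exp_graph_zero: "(0, 0) \<in> closure (exp_graph y)"
  using exp_graph_zero closure_subset by blast

lemma closure_exp_graph_sum:
  assumes "\<And>i. i \<in> I \<Longrightarrow> (f i, g i) \<in> closure (exp_graph y)"
  shows "(sum f I, sum g I) \<in> closure (exp_graph y)"
  using assms
  by (induction I rule: infinite_finite_induct)
    (simp_all add: closure_exp_graph_add closure_exp_graph_zero)

section \<open>Particle number projections and truncations\<close>

lemma finite_multisets_size: "finite {A :: 'n::finite multiset. size A = k}"
proof -
  have "{A :: 'n multiset. size A = k} = mset ` {w. length w = k}"
    by (auto simp: image_iff) (metis ex_mset size_mset)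
  then show ?thesis
    by (simp add: finite_words_length)
qed

lemma particle_proj_number_vec:
  fixes f :: "'n::finite fock"
  shows "particle_proj k f = (\<Sum>A | size A = k. fock_cinner (number_vec A) f *\<^sub>C number_vec A)"
proof (rule fock_eqI)
  fix w :: "'n list"
  have summand: "fock_cinner (number_vec A) f * fock_coord (number_vec A) w = (if A = mset w then fock_coord f w else 0)" for A
  proof (cases "mset w = A")
    case True
    then show ?thesis
      unfolding cinner_number_vec[OF True] using card_permutations_pos[of A]
      by (simp add: number_vec.rep_eq)
  qed (auto simp: number_vec.rep_eq)
  have "fock_coord (\<Sum>A | size A = k. fock_cinner (number_vec A) f *\<^sub>C number_vec A) w
      = (\<Sum>A | size A = k. if A = mset w then fock_coord f w else 0)"
    unfolding fock_coord_sum fock_coord_simps summand ..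
  also have "\<dots> = (if length w = k then fock_coord f w else 0)"
    using sum.delta[OF finite_multisets_size, of "mset w" "\<lambda>_. fock_coord f w" k] by simp
  finally show "fock_coord (particle_proj k f) w
      = fock_coord (\<Sum>A | size A = k. fock_cinner (number_vec A) f *\<^sub>C number_vec A) w"
    by (simp add: particle_proj.rep_eq)
qed

text \<open>Finitely many modes allow only finitely many multisets of size \<open>k\<close>, so the
  projected vector is a finite combination of occupation number vectors.\<close>

lemma particle_proj_in_closure: "(particle_proj k f, of_nat k *\<^sub>C particle_proj k f) \<in> closure (exp_graph num_exp_vec)"
proof -
  have "(\<Sum>A | size A = k. fock_cinner (number_vec A) f *\<^sub>C number_vec A,
      \<Sum>A | size A = k. fock_cinner (number_vec A) f *\<^sub>C of_nat (size A) *\<^sub>C number_vec A) \<in> closure (exp_graph num_exp_vec)"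
    by (intro closure_exp_graph_sum closure_exp_graph_scale number_vec_in_closure)
  also have "(\<Sum>A | size A = k. fock_cinner (number_vec A) f *\<^sub>C of_nat (size A) *\<^sub>C number_vec A)
      = of_nat k *\<^sub>C particle_proj k f"
    unfolding particle_proj_number_vec fock_scale_sum
    by (rule sum.cong) (auto simp: fock_scale_laws mult.commute)
  finally show ?thesis
    by (simp only: particle_proj_number_vec)
qed

lemma cinner_particle_proj: "fock_cinner (particle_proj j f) g = fock_cinner f (particle_proj j g)"
  unfolding fock_cinner_def by (rule infsum_cong) (simp add: particle_proj.rep_eq)

lemma particle_proj_idem: "particle_proj j (particle_proj k f) = (if j = k then particle_proj k f else 0)"
  by (rule fock_eqI) (simp add: particle_proj.rep_eq zero_fock.rep_eq)

lemma cinner_particle_proj_orthogonal: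
  "fock_cinner (particle_proj j f) (particle_proj k g) = (if j = k then fock_cinner f (particle_proj k g) else 0)"
  by (simp add: cinner_particle_proj particle_proj_idem cinner_bilinear)

lemma particle_norm_sums: "(\<lambda>k. (norm (particle_proj k f))\<^sup>2) sums (norm f)\<^sup>2"
proof (rule has_sum_imp_sums, rule has_sum_partition[OF norm_square_has_sum, where k = length])
  fix k
  show "((\<lambda>w. (cmod (fock_coord f w))\<^sup>2) has_sum (norm (particle_proj k f))\<^sup>2) {w. length w = k}"
    using norm_square_has_sum[of "particle_proj k f"]
    by (rule has_sum_cong_neutral[THEN iffD1, rotated -1]) (auto simp: particle_proj.rep_eq)
qed

text \<open>The truncation lies in the domain of N whatever \<open>f\<close> is, and
  \<open>truncate_num\<close> is the image of the truncation under N.\<close>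

definition truncate :: "nat \<Rightarrow> 'n fock \<Rightarrow> 'n fock"
  where "truncate K f = (\<Sum>k<K. particle_proj k f)"

definition truncate_num :: "nat \<Rightarrow> 'n fock \<Rightarrow> 'n fock"
  where "truncate_num K f = (\<Sum>k<K. of_nat k *\<^sub>C particle_proj k f)"

lemma truncate_in_closure: "(truncate K f, truncate_num K f) \<in> closure (exp_graph num_exp_vec)"
  unfolding truncate_def truncate_num_def by (intro closure_exp_graph_sum particle_proj_in_closure)

lemma cinner_self_particle_proj: "fock_cinner f (particle_proj k f) = complex_of_real ((norm (particle_proj k f))\<^sup>2)"
  using cinner_particle_proj_orthogonal[of k f k f] by (simp add: cinner_self)

lemma cinner_truncate:
  "fock_cinner f (truncate K f) = complex_of_real (\<Sum>k<K. (norm (particle_proj k f))\<^sup>2)"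
  "fock_cinner (truncate K f) f = complex_of_real (\<Sum>k<K. (norm (particle_proj k f))\<^sup>2)"
  "fock_cinner (truncate K f) (truncate K f) = complex_of_real (\<Sum>k<K. (norm (particle_proj k f))\<^sup>2)"
  "fock_cinner (truncate_num K f) f = complex_of_real (\<Sum>k<K. real k * (norm (particle_proj k f))\<^sup>2)"
  "fock_cinner (truncate_num K f) (truncate K f) = complex_of_real (\<Sum>k<K. real k * (norm (particle_proj k f))\<^sup>2)"
proof -
  have 1: "fock_cinner (particle_proj k f) (truncate K f) = complex_of_real ((norm (particle_proj k f))\<^sup>2)" if "k < K" for k
    using that unfolding truncate_def cinner_sum_right cinner_particle_proj_orthogonal
    by (simp add: sum.delta cinner_self_particle_proj del: of_real_power)
  show "fock_cinner f (truncate K f) = complex_of_real (\<Sum>k<K. (norm (particle_proj k f))\<^sup>2)"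
    "fock_cinner (truncate K f) f = complex_of_real (\<Sum>k<K. (norm (particle_proj k f))\<^sup>2)"
    "fock_cinner (truncate_num K f) f = complex_of_real (\<Sum>k<K. real k * (norm (particle_proj k f))\<^sup>2)"
    by (simp_all add: truncate_def truncate_num_def cinner_sum_right cinner_sum_left cinner_scale_left
        cinner_particle_proj cinner_self_particle_proj)
  have "fock_cinner (truncate K f) (truncate K f) = (\<Sum>k<K. fock_cinner (particle_proj k f) (truncate K f))"
    by (subst (1) truncate_def) (rule cinner_sum_left)
  also have "\<dots> = (\<Sum>k<K. complex_of_real ((norm (particle_proj k f))\<^sup>2))"
    by (rule sum.cong) (auto simp: 1)
  finally show "fock_cinner (truncate K f) (truncate K f) = complex_of_real (\<Sum>k<K. (norm (particle_proj k f))\<^sup>2)"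
    by simp
  have "fock_cinner (truncate_num K f) (truncate K f) = (\<Sum>k<K. of_nat k * fock_cinner (particle_proj k f) (truncate K f))"
    unfolding truncate_num_def cinner_sum_left cinner_scale_left by simp
  also have "\<dots> = (\<Sum>k<K. of_nat k * complex_of_real ((norm (particle_proj k f))\<^sup>2))"
    by (rule sum.cong) (auto simp: 1)
  finally show "fock_cinner (truncate_num K f) (truncate K f) = complex_of_real (\<Sum>k<K. real k * (norm (particle_proj k f))\<^sup>2)"
    by simp
qed

lemma tendsto_truncate: "(\<lambda>K. truncate K f) \<longlonglongrightarrow> f"
proof -
  have "(norm (f - truncate K f))\<^sup>2 = (norm f)\<^sup>2 - (\<Sum>k<K. (norm (particle_proj k f))\<^sup>2)" for K
  proof -
    have "complex_of_real ((norm (f - truncate K f))\<^sup>2)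
        = complex_of_real ((norm f)\<^sup>2 - (\<Sum>k<K. (norm (particle_proj k f))\<^sup>2))"
      unfolding cinner_self[symmetric] cinner_bilinear cinner_truncate by (simp add: cinner_self)
    then show ?thesis
      by (simp only: of_real_eq_iff)
  qed
  moreover have "(\<lambda>K. (norm f)\<^sup>2 - (\<Sum>k<K. (norm (particle_proj k f))\<^sup>2)) \<longlonglongrightarrow> (norm f)\<^sup>2 - (norm f)\<^sup>2"
    by (intro tendsto_diff tendsto_const) (use particle_norm_sums[of f] in \<open>simp add: sums_def\<close>)
  ultimately have "(\<lambda>K. (norm (f - truncate K f))\<^sup>2) \<longlonglongrightarrow> 0"
    by simp
  then have "(\<lambda>K. sqrt ((norm (f - truncate K f))\<^sup>2)) \<longlonglongrightarrow> sqrt 0"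
    by (rule tendsto_real_sqrt)
  then have "(\<lambda>K. norm (truncate K f - f)) \<longlonglongrightarrow> 0"
    by (simp add: norm_minus_commute)
  then show ?thesis
    by (rule LIM_zero_cancel[OF tendsto_norm_zero_cancel])
qed

text \<open>Truncations converge to \<open>f\<close> and are themselves limits of combinations of
  exponential vectors. Nothing is claimed about convergence of \<open>G\<close>, since
  \<open>f\<close> may lie outside the domain of N.\<close>

lemma exp_vec_dense:
  obtains F G where "\<And>m. (F m, G m) \<in> exp_graph num_exp_vec" "F \<longlonglongrightarrow> f"
proof -
  have "f \<in> closure (fst ` exp_graph num_exp_vec)"
  proof (rule closed_sequentially[OF closed_closure _ tendsto_truncate])
    fix K
    obtain F G where "\<And>m. (F m, G m) \<in> exp_graph num_exp_vec" "F \<longlonglongrightarrow> truncate K f"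
      using truncate_in_closure by (rule exp_graph_closureE) blast
    then show "truncate K f \<in> closure (fst ` exp_graph num_exp_vec)"
      unfolding closure_sequential by force
  qed
  then obtain F where F: "\<And>m. F m \<in> fst ` exp_graph num_exp_vec" "F \<longlonglongrightarrow> f"
    unfolding closure_sequential by blast
  then have "\<forall>m. \<exists>g. (F m, g) \<in> exp_graph num_exp_vec"
    by force
  then show ?thesis
    using that F(2) by metis
qed

lemma dense_induct [case_names zero add lim]:
  assumes exp: "P 0" "\<And>c v f. P f \<Longrightarrow> P (c *\<^sub>C exp_vec v + f)"
    and lim: "\<And>F f. (\<And>m. P (F m)) \<Longrightarrow> F \<longlonglongrightarrow> f \<Longrightarrow> P f"
  shows "P f"
proof -
  obtain F G where F: "\<And>m. (F m, G m) \<in> exp_graph num_exp_vec" "F \<longlonglongrightarrow> f"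
    by (rule exp_vec_dense) blast
  have "P (F m)" for m
    using F(1)[of m] by (induction rule: exp_graph_induct) (auto intro: exp)
  then show ?thesis
    using F(2) by (rule lim)
qed

section \<open>Existence of the Weyl operators\<close>

text \<open>Transports density, which is obtained for \<open>num_exp_vec\<close>, to the graph of
  any other assignment \<open>y'\<close>.\<close>

lemma exp_graph_change: "(f, g) \<in> exp_graph y \<Longrightarrow> \<exists>g'. (f, g') \<in> exp_graph y'"
proof (induction rule: exp_graph_induct)
  case zero
  show ?case
    using exp_graph_zero by blast
next
  case (add c v f g)
  then obtain g' where "(f, g') \<in> exp_graph y'"
    by blast
  moreover have "(c *\<^sub>C exp_vec v, c *\<^sub>C y' v) \<in> exp_graph y'"
    unfolding exp_graph_def by (rule span_base) blast
  ultimately show ?case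
    using exp_graph_add by blast
qed

lemma exp_graph_cinner:
  assumes gram: "\<And>u v. fock_cinner (y u) (y v) = fock_cinner (exp_vec u) (exp_vec v)"
    and "(a, b) \<in> exp_graph y" "(a', b') \<in> exp_graph y"
  shows "fock_cinner b b' = fock_cinner a a'"
proof -
  have 1: "fock_cinner (y u) b' = fock_cinner (exp_vec u) a'" for u
    using assms(3) by (induction rule: exp_graph_induct) (simp_all add: cinner_bilinear gram)
  show ?thesis
    using assms(2) by (induction rule: exp_graph_induct) (simp_all add: cinner_bilinear 1)
qed

lemma closure_exp_graph_cinner:
  assumes gram: "\<And>u v. fock_cinner (y u) (y v) = fock_cinner (exp_vec u) (exp_vec v)"
    and "(a, b) \<in> closure (exp_graph y)" "(a', b') \<in> closure (exp_graph y)"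
  shows "fock_cinner b b' = fock_cinner a a'"
proof -
  obtain F G where 1: "\<And>m. (F m, G m) \<in> exp_graph y" "F \<longlonglongrightarrow> a" "G \<longlonglongrightarrow> b"
    using assms(2) by (rule exp_graph_closureE) blast
  obtain F' G' where 2: "\<And>m. (F' m, G' m) \<in> exp_graph y" "F' \<longlonglongrightarrow> a'" "G' \<longlonglongrightarrow> b'"
    using assms(3) by (rule exp_graph_closureE) blast
  have "(\<lambda>m. fock_cinner (G m) (G' m)) \<longlonglongrightarrow> fock_cinner a a'"
    using tendsto_cinner[OF 1(2) 2(2)] by (simp add: exp_graph_cinner[OF gram 1(1) 2(1)])
  then show ?thesis
    using tendsto_cinner[OF 1(3) 2(3)] LIMSEQ_unique by blast
qed

lemma bounded_clinear_isometry:
  assumes add: "\<And>f g. T (f + g) = T f + T g" and scale: "\<And>c f. T (c *\<^sub>C f) = c *\<^sub>C T f"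
    and iso: "\<And>f g. fock_cinner (T f) (T g) = fock_cinner f g"
  shows "bounded_clinear T"
proof -
  have "norm (T f) = norm f" for f
    using iso by (rule norm_eq_cinner)
  then have "bounded_linear T"
    by (intro bounded_linear_intro[where K = 1]) (simp_all add: add scale scaleR_fock_def)
  then show ?thesis
    using scale by (simp add: bounded_clinear_def)
qed

text \<open>
  The closure of the graph is itself the graph of the extension, because equality of the Gram
  matrices makes both of its projections isometric.
\<close>

lemma isometric_extension:
  assumes gram: "\<And>u v. fock_cinner (y u) (y v) = fock_cinner (exp_vec u) (exp_vec v)"
  obtains T where "bounded_clinear T" "\<And>v. T (exp_vec v) = y v"
    "\<And>f g. fock_cinner (T f) (T g) = fock_cinner f g"
proof -
  let ?G = "closure (exp_graph y)"
  note cinner_G = closure_exp_graph_cinner[of y, OF gram]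
  have unique: "b = b'" if "(a, b) \<in> ?G" "(a, b') \<in> ?G" for a b b'
  proof -
    have "(a + (-1) *\<^sub>C a, b + (-1) *\<^sub>C b') \<in> ?G"
      using that by (intro closure_exp_graph_add closure_exp_graph_scale)
    then have "fock_cinner (b - b') (b - b') = fock_cinner (a - a) (a - a)"
      by (intro cinner_G) (simp_all add: fock_scale_laws)
    then show ?thesis
      by (simp add: cinner_self)
  qed
  have ex: "\<exists>b. (a, b) \<in> ?G" for a
  proof -
    obtain F N where F: "\<And>m. (F m, N m) \<in> exp_graph num_exp_vec" "F \<longlonglongrightarrow> a"
      by (rule exp_vec_dense) blast
    have "\<forall>m. \<exists>g. (F m, g) \<in> exp_graph y"
      using exp_graph_change[OF F(1)] by blast
    then obtain G where G: "\<And>m. (F m, G m) \<in> exp_graph y"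
      by metis
    \<comment> \<open>Equal Gram matrices make the correspondence distance preserving, so the images
      of a convergent sequence form a Cauchy sequence.\<close>
    have "dist (G m) (G n) = dist (F m) (F n)" for m n
    proof -
      have "(F m + (-1) *\<^sub>C F n, G m + (-1) *\<^sub>C G n) \<in> exp_graph y"
        by (intro exp_graph_add exp_graph_scale G)
      then have "fock_cinner (G m - G n) (G m - G n) = fock_cinner (F m - F n) (F m - F n)"
        by (intro exp_graph_cinner[of y, OF gram]) (simp_all add: fock_scale_laws)
      then have "(norm (G m - G n))\<^sup>2 = (norm (F m - F n))\<^sup>2"
        unfolding cinner_self by (simp only: of_real_eq_iff)
      then show ?thesis
        by (simp add: dist_norm power2_eq_iff_nonneg)
    qed
    then have "Cauchy G"
      using LIMSEQ_imp_Cauchy[OF F(2)] by (simp add: Cauchy_def)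
    then obtain b where "G \<longlonglongrightarrow> b"
      using Cauchy_convergent_iff convergent_def by blast
    then show ?thesis
      using exp_graph_closureI[of F G] G F(2) by blast
  qed
  define T where "T = (\<lambda>a. SOME b. (a, b) \<in> ?G)"
  have T: "(a, T a) \<in> ?G" for a
    unfolding T_def using ex by (rule someI_ex)
  have iso: "fock_cinner (T f) (T g) = fock_cinner f g" for f g
    by (rule cinner_G[OF T T])
  have "bounded_clinear T"
    by (intro bounded_clinear_isometry iso unique[OF T] closure_exp_graph_add closure_exp_graph_scale T)
  moreover have "T (exp_vec v) = y v" for v
  proof (rule unique[OF T])
    have "(1 *\<^sub>C exp_vec v, 1 *\<^sub>C y v) \<in> exp_graph y"
      unfolding exp_graph_def by (rule span_base) blast
    then show "(exp_vec v, y v) \<in> ?G"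
      using closure_subset by (auto simp: fock_scale_laws)
  qed
  ultimately show ?thesis
    using that iso by blast
qed

section \<open>Bounded and unitary operators\<close>

lemma bounded_clinearD:
  assumes "bounded_clinear T"
  shows "bounded_linear T" "T (c *\<^sub>C f) = c *\<^sub>C T f" "T (f + g) = T f + T g" "T (f - g) = T f - T g" "T 0 = 0"
  using assms bounded_linear.linear[of T] linear_add[of T] linear_diff[of T] linear_0[of T]
  by (auto simp: bounded_clinear_def)

lemma bounded_clinear_eqI:
  assumes S: "bounded_clinear S" and T: "bounded_clinear T" and eq: "\<And>v. S (exp_vec v) = T (exp_vec v)"
  shows "S = T"
proof
  fix f
  show "S f = T f"
  proof (induction f rule: dense_induct)
    case (lim F f)
    have "(\<lambda>m. T (F m)) \<longlonglongrightarrow> S f" "(\<lambda>m. T (F m)) \<longlonglongrightarrow> T f"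
      using bounded_linear.tendsto[OF bounded_clinearD(1)[OF S] lim(2)]
        bounded_linear.tendsto[OF bounded_clinearD(1)[OF T] lim(2)] by (simp_all add: lim(1))
    then show ?case
      by (rule LIMSEQ_unique)
  qed (simp_all add: bounded_clinearD[OF S] bounded_clinearD[OF T] eq)
qed

lemma bounded_clinear_compose: "bounded_clinear S \<Longrightarrow> bounded_clinear T \<Longrightarrow> bounded_clinear (S \<circ> T)"
  unfolding bounded_clinear_def o_def by (auto intro: bounded_linear_compose)

lemma bounded_clinear_id: "bounded_clinear id"
  by (simp add: bounded_clinear_def id_def bounded_linear_ident)

lemma bounded_clinear_scale: "bounded_clinear T \<Longrightarrow> bounded_clinear (\<lambda>f. c *\<^sub>C T f)"
  unfolding bounded_clinear_def
  by (auto simp: fock_scale_laws mult.commute intro: bounded_linear_compose[OF bounded_linear_fock_scale])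

lemma unitaryD:
  assumes "unitary V"
  shows "bounded_clinear V" "fock_cinner (V f) (V g) = fock_cinner f g" "norm (V f) = norm f"
    "bij V" "inv V (V f) = f" "V (inv V f) = f" "fock_cinner f (V g) = fock_cinner (inv V f) g"
    "fock_cinner (V f) g = fock_cinner f (inv V g)"
proof -
  show "bounded_clinear V" "fock_cinner (V f) (V g) = fock_cinner f g"
    using assms by (auto simp: unitary_def)
  have iso: "fock_cinner (V f) (V g) = fock_cinner f g" and surj: "surj V" for f g
    using assms by (auto simp: unitary_def)
  have norm: "norm (V f) = norm f" for f
    using iso by (rule norm_eq_cinner)
  then show "norm (V f) = norm f" .
  have "inj V"
  proof (rule injI)
    fix f g assume "V f = V g"
    then have "norm (V (f - g)) = 0"
      using bounded_clinearD(4)[OF \<open>bounded_clinear V\<close>] by simp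
    then show "f = g"
      by (simp add: norm)
  qed
  then show "bij V" "inv V (V f) = f"
    using surj by (simp_all add: bij_def)
  show VV: "V (inv V f) = f" for f
    using surj by (simp add: surj_f_inv_f)
  show "fock_cinner f (V g) = fock_cinner (inv V f) g" "fock_cinner (V f) g = fock_cinner f (inv V g)"
    using iso[of "inv V f" g] iso[of f "inv V g"] by (simp_all add: VV)
qed

lemma unitary_inv:
  assumes "unitary V"
  shows "unitary (inv V)"
proof -
  note V = unitaryD[OF assms]
  have eqI: "f = g" if "V f = V g" for f g
    using that V(5) by metis
  have iso: "fock_cinner (inv V f) (inv V g) = fock_cinner f g" for f g
    using V(2)[of "inv V f" "inv V g"] by (simp add: V(6))
  have "inv V (f + g) = inv V f + inv V g" for f g
    by (rule eqI) (simp add: V(6) bounded_clinearD[OF V(1)])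
  moreover have "inv V (c *\<^sub>C f) = c *\<^sub>C inv V f" for c f
    by (rule eqI) (simp add: V(6) bounded_clinearD[OF V(1)])
  ultimately have "bounded_clinear (inv V)"
    using iso by (rule bounded_clinear_isometry)
  moreover have "surj (inv V)"
    using V(4) by (simp add: bij_imp_bij_inv bij_is_surj)
  ultimately show ?thesis
    unfolding unitary_def using iso by blast
qed

lemma cadjoint_unitary:
  assumes "unitary V"
  shows "cadjoint V = inv V"
  unfolding cadjoint_def
proof (rule the_equality)
  show "\<forall>f g. fock_cinner (inv V f) g = fock_cinner f (V g)"
    using unitaryD(7)[OF assms] by simp
  fix B
  assume B: "\<forall>f g. fock_cinner (B f) g = fock_cinner f (V g)"
  show "B = inv V"
  proof
    fix f
    show "B f = inv V f"
    proof (rule cinner_eqI)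
      fix g
      have "fock_cinner (B f) g = fock_cinner (inv V f) g"
        using B unitaryD(7)[OF assms] by metis
      then show "fock_cinner g (B f) = fock_cinner g (inv V f)"
        using cinner_commute[of g] by metis
    qed
  qed
qed

lemma unitary_id: "unitary id"
  by (simp add: unitary_def bounded_clinear_id)

section \<open>The Weyl operators and their commutation relations\<close>

definition weyl_coeff :: "complex^'n \<Rightarrow> complex^'n \<Rightarrow> complex"
  where "weyl_coeff u v = exp (- complex_of_real ((norm u)\<^sup>2) / 2 - cdot u v)"

lemma weyl_isometry_exists:
  obtains T :: "'n::finite fock \<Rightarrow> 'n fock" where "bounded_clinear T"
    "\<And>v. T (exp_vec v) = weyl_coeff u v *\<^sub>C exp_vec (u + v)"
    "\<And>f g. fock_cinner (T f) (T g) = fock_cinner f g"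
proof (rule isometric_extension)
  fix v v'
  have "fock_cinner (weyl_coeff u v *\<^sub>C exp_vec (u + v)) (weyl_coeff u v' *\<^sub>C exp_vec (u + v'))
      = exp (cnj (- complex_of_real ((norm u)\<^sup>2) / 2 - cdot u v)
        + (- complex_of_real ((norm u)\<^sup>2) / 2 - cdot u v') + cdot (u + v) (u + v'))"
    unfolding cinner_scale_left cinner_scale_right cinner_exp_vec weyl_coeff_def
    by (simp only: exp_cnj exp_add mult_ac)
  also have "\<dots> = fock_cinner (exp_vec v) (exp_vec v')"
    unfolding cinner_exp_vec
    by (rule arg_cong[of _ _ exp]) (simp add: cdot_linear cdot_self cdot_commute[of v u] add_divide_distrib[symmetric])
  finally show "fock_cinner (weyl_coeff u v *\<^sub>C exp_vec (u + v)) (weyl_coeff u v' *\<^sub>C exp_vec (u + v'))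
      = fock_cinner (exp_vec v) (exp_vec v')" .
qed blast

text \<open>The real part of \<open>cdot u v\<close> is absorbed by the squared norm of
  \<open>u + v\<close>; the imaginary part remains as the phase of the canonical commutation
  relations.\<close>

lemma weyl_coeff_mult:
  "weyl_coeff u (v + w) * weyl_coeff v w = exp (- \<i> * complex_of_real (Im (cdot u v))) * weyl_coeff (u + v) w"
proof -
  have "complex_of_real ((norm (u + v))\<^sup>2) = complex_of_real ((norm u)\<^sup>2) + complex_of_real ((norm v)\<^sup>2) + (cdot u v + cnj (cdot u v))"
    unfolding cdot_self[symmetric] by (simp add: cdot_linear cdot_commute[of v u])
  also have "cdot u v + cnj (cdot u v) = 2 * complex_of_real (Re (cdot u v))"
    by (simp add: complex_add_cnj)
  finally have n: "complex_of_real ((norm (u + v))\<^sup>2)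
      = complex_of_real ((norm u)\<^sup>2) + complex_of_real ((norm v)\<^sup>2) + 2 * complex_of_real (Re (cdot u v))" .
  have "- complex_of_real ((norm u)\<^sup>2) / 2 - cdot u (v + w) + (- complex_of_real ((norm v)\<^sup>2) / 2 - cdot v w)
      = - \<i> * complex_of_real (Im (cdot u v)) + (- complex_of_real ((norm (u + v))\<^sup>2) / 2 - cdot (u + v) w)"
    unfolding n cdot_linear by (subst (2) complex_eq) (simp add: field_simps)
  then show ?thesis
    unfolding weyl_coeff_def exp_add[symmetric] by (rule arg_cong)
qed

text \<open>Stated for arbitrary operators that satisfy the Weyl formula, because it serves to show
  that such an operator is surjective, and thereby that \<open>weyl\<close> exists.\<close>

lemma weyl_isometry_compose:
  assumes S: "bounded_clinear S" "\<And>w. S (exp_vec w) = weyl_coeff u w *\<^sub>C exp_vec (u + w)"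
    and T: "bounded_clinear T" "\<And>w. T (exp_vec w) = weyl_coeff v w *\<^sub>C exp_vec (v + w)"
    and R: "bounded_clinear R" "\<And>w. R (exp_vec w) = weyl_coeff (u + v) w *\<^sub>C exp_vec (u + v + w)"
  shows "S (T f) = exp (- \<i> * complex_of_real (Im (cdot u v))) *\<^sub>C R f"
proof -
  have "weyl_coeff v w * weyl_coeff u (v + w) = exp (- \<i> * complex_of_real (Im (cdot u v))) * weyl_coeff (u + v) w" for w
    using weyl_coeff_mult[of u v w] by (simp only: mult.commute)
  then have "S \<circ> T = (\<lambda>f. exp (- \<i> * complex_of_real (Im (cdot u v))) *\<^sub>C R f)"
    by (intro bounded_clinear_eqI bounded_clinear_compose bounded_clinear_scale S T R)
      (simp add: S T R bounded_clinearD[OF S(1)] fock_scale_laws add.assoc)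
  then show ?thesis
    by (metis comp_apply)
qed

lemma weyl_properties:
  "unitary (weyl u)" "weyl u (exp_vec v) = weyl_coeff u v *\<^sub>C exp_vec (u + v)"
proof -
  obtain S where S: "bounded_clinear S" "\<And>v. S (exp_vec v) = weyl_coeff u v *\<^sub>C exp_vec (u + v)"
    "\<And>f g. fock_cinner (S f) (S g) = fock_cinner f g"
    by (rule weyl_isometry_exists[of u]) blast
  obtain T where T: "bounded_clinear T" "\<And>v. T (exp_vec v) = weyl_coeff (- u) v *\<^sub>C exp_vec (- u + v)"
    by (rule weyl_isometry_exists[of "- u"]) blast
  \<comment> \<open>The identity satisfies the Weyl formula for u + - u = 0, so the operator for
    \<open>- u\<close> becomes a right inverse of \<open>S\<close>.\<close>
  have id: "id (exp_vec w) = weyl_coeff (u + - u) w *\<^sub>C exp_vec (u + - u + w)" for w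
    by (simp add: weyl_coeff_def cdot_zero fock_scale_laws)
  have ST: "S (T f) = f" for f
    using weyl_isometry_compose[OF S(1,2) T bounded_clinear_id id, of f]
    by (simp add: cdot_linear cdot_self fock_scale_laws)
  have "unitary S"
    unfolding unitary_def using S(1,3) ST by (metis surjI)
  moreover have "weyl u = S"
    unfolding weyl_def
  proof (rule the_equality)
    show "unitary S \<and> (\<forall>v. S (exp_vec v) =
      exp (- complex_of_real ((norm u)\<^sup>2) / 2 - (\<Sum>j\<in>UNIV. cnj (u $ j) * v $ j)) *\<^sub>C exp_vec (u + v))"
      using \<open>unitary S\<close> S(2) by (simp add: weyl_coeff_def cdot_def)
    fix W :: "'a fock \<Rightarrow> 'a fock"
    assume W: "unitary W \<and> (\<forall>v. W (exp_vec v) =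
      exp (- complex_of_real ((norm u)\<^sup>2) / 2 - (\<Sum>j\<in>UNIV. cnj (u $ j) * v $ j)) *\<^sub>C exp_vec (u + v))"
    show "W = S"
      by (rule bounded_clinear_eqI) (use W S in \<open>simp_all add: unitaryD weyl_coeff_def cdot_def\<close>)
  qed
  ultimately show "unitary (weyl u)" "weyl u (exp_vec v) = weyl_coeff u v *\<^sub>C exp_vec (u + v)"
    by (simp_all add: S(2))
qed

lemmas unitary_weyl = weyl_properties(1)
lemmas weyl_exp_vec = weyl_properties(2)
lemmas bounded_clinear_weyl = unitaryD(1)[OF unitary_weyl]
lemmas weyl_linear = bounded_clinearD(2-5)[OF bounded_clinear_weyl]

lemma weyl_weyl: "weyl u (weyl v f) = exp (- \<i> * complex_of_real (Im (cdot u v))) *\<^sub>C weyl (u + v) f"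
  by (intro weyl_isometry_compose bounded_clinear_weyl weyl_exp_vec)

lemma weyl_zero:
  fixes f :: "'n::finite fock"
  shows "weyl 0 f = f"
proof -
  have "weyl 0 = (id :: 'n fock \<Rightarrow> 'n fock)"
    by (rule bounded_clinear_eqI)
      (simp_all add: bounded_clinear_weyl bounded_clinear_id weyl_exp_vec weyl_coeff_def cdot_zero fock_scale_laws)
  then show ?thesis
    by simp
qed

lemma weyl_minus: "weyl (- u) (weyl u f) = f" "weyl u (weyl (- u) f) = f"
  by (simp_all add: weyl_weyl cdot_linear cdot_self weyl_zero fock_scale_laws)

lemma inv_weyl: "inv (weyl u) = weyl (- u)"
  by (rule inv_equality) (simp_all add: weyl_minus)

lemma weyl_multiples: "weyl (s *\<^sub>R u) (weyl (t *\<^sub>R u) f) = weyl ((s + t) *\<^sub>R u) f"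
  by (simp add: weyl_weyl cdot_linear cdot_self scaleR_add_left fock_scale_laws)

text \<open>The two commutations contribute equal phases. Hence a displacement changes only the
  linear term in the exponent of a characteristic function.\<close>

lemma weyl_conjugate:
  "weyl (- u) (weyl z (weyl u f)) = exp (- 2 * \<i> * complex_of_real (Im (cdot z u))) *\<^sub>C weyl z f"
proof -
  have "Im (cdot u z) = - Im (cdot z u)"
    by (simp add: cdot_commute[of u z])
  then show ?thesis
    by (simp add: weyl_weyl weyl_linear cdot_linear cdot_self fock_scale_laws exp_add[symmetric] mult.assoc)
qed

section \<open>Difference quotients of the Weyl operators\<close>

text \<open>In the sum over both signs of t the odd powers of t c cancel, and what is left after the
  t^2 term is of order t^4. The range up to 2 allows an application to 2 t with t <= 1 in
  \<open>second_difference_exp_vec_bounded\<close>.\<close>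

lemma second_difference_exp:
  fixes s c :: complex
  obtains C where "0 \<le> C" "\<And>t::real. \<bar>t\<bar> \<le> 2 \<Longrightarrow>
    cmod (exp (- of_real (t\<^sup>2) * s + of_real t * c) + exp (- of_real (t\<^sup>2) * s - of_real t * c) - 2
      - of_real (t\<^sup>2) * (c\<^sup>2 - 2 * s)) \<le> C * t ^ 4"
proof -
  \<comment> \<open>As t^2 <= 2 |t|, both exponents are bounded by |t| R. In \<open>C\<close>, the
    first summand covers the two Taylor remainders, the second the polynomial terms of order t^4,
    with t^2 <= 4 in the cubic one.\<close>
  define R where "R = 2 * cmod s + cmod c"
  have R: "0 \<le> R"
    by (simp add: R_def)
  define C where "C = exp (2 * R) * R ^ 4 / 3 + ((cmod s)\<^sup>2 + 4 * (cmod s) ^ 3 / 3 + cmod s * (cmod c)\<^sup>2)"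
  have "cmod (exp (- of_real (t\<^sup>2) * s + of_real t * c) + exp (- of_real (t\<^sup>2) * s - of_real t * c) - 2
      - of_real (t\<^sup>2) * (c\<^sup>2 - 2 * s)) \<le> C * t ^ 4" if t: "\<bar>t\<bar> \<le> 2" for t :: real
  proof -
    let ?p = "- of_real (t\<^sup>2) * s + of_real t * c"
    let ?q = "- of_real (t\<^sup>2) * s - of_real t * c"
    define r where "r = (\<lambda>z::complex. exp z - (1 + z + z\<^sup>2 / 2 + z ^ 3 / 6))"
    have rem: "cmod (r z) \<le> exp (2 * R) * (t ^ 4 * R ^ 4) / 6" if z: "cmod z \<le> \<bar>t\<bar> * R" for z
    proof -
      have "cmod (r z) \<le> exp \<bar>Re z\<bar> * cmod z ^ 4 / 6"
      proof -
        have "(\<Sum>k\<le>3. z ^ k / fact k) = 1 + z + z\<^sup>2 / 2 + z ^ 3 / 6"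
          by (simp add: eval_nat_numeral)
        moreover have "(fact 3 :: real) = 6" "Suc 3 = (4::nat)"
          by (simp_all add: eval_nat_numeral)
        ultimately show ?thesis
          using Taylor_exp[of z 3] by (simp only: r_def)
      qed
      also have "\<bar>Re z\<bar> \<le> \<bar>t\<bar> * R"
        using abs_Re_le_cmod z order_trans by blast
      also have "\<bar>t\<bar> * R \<le> 2 * R"
        using t R by (rule mult_right_mono)
      also have "cmod z ^ 4 \<le> (\<bar>t\<bar> * R) ^ 4"
        using z by (rule power_mono) simp
      also have "(\<bar>t\<bar> * R) ^ 4 = t ^ 4 * R ^ 4"
        by (simp add: power_mult_distrib)
      finally show ?thesis
        by (simp add: mult_right_mono)
    qed
    have "cmod (of_real (t\<^sup>2) * s) \<le> \<bar>t\<bar> * (2 * cmod s)"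
    proof -
      have "\<bar>t\<bar> * \<bar>t\<bar> \<le> \<bar>t\<bar> * 2"
        using t by (intro mult_left_mono) auto
      then show ?thesis
        by (simp add: norm_mult power2_eq_square mult.assoc[symmetric] mult_right_mono)
    qed
    then have pq: "cmod ?p \<le> \<bar>t\<bar> * R" "cmod ?q \<le> \<bar>t\<bar> * R"
      using norm_triangle_ineq[of "- of_real (t\<^sup>2) * s" "of_real t * c"]
        norm_triangle_ineq4[of "- of_real (t\<^sup>2) * s" "of_real t * c"]
      by (simp_all add: R_def norm_mult distrib_left)
    have rr: "cmod (r ?p + r ?q) \<le> exp (2 * R) * R ^ 4 / 3 * t ^ 4"
    proof -
      have "exp (2 * R) * (t ^ 4 * R ^ 4) / 6 + exp (2 * R) * (t ^ 4 * R ^ 4) / 6 = exp (2 * R) * R ^ 4 / 3 * t ^ 4"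
        by (simp add: mult_ac)
      then show ?thesis
        using norm_triangle_ineq[of "r ?p" "r ?q"] rem[OF pq(1)] rem[OF pq(2)] by linarith
    qed
    define x y where "x = of_real (t\<^sup>2) * s" and "y = of_real t * c"
    define e where "e = s\<^sup>2 - of_real (t\<^sup>2) * s ^ 3 / 3 - s * c\<^sup>2"
    have "exp ?p + exp ?q - 2 - of_real (t\<^sup>2) * (c\<^sup>2 - 2 * s)
        = r ?p + r ?q + (x\<^sup>2 - x ^ 3 / 3 - x * y\<^sup>2)"
      by (simp add: r_def x_def y_def field_simps power2_eq_square power3_eq_cube)
    also have "x\<^sup>2 - x ^ 3 / 3 - x * y\<^sup>2 = of_real (t ^ 4) * e"
      unfolding x_def y_def e_def by (simp add: field_simps power2_eq_square power3_eq_cube power4_eq_xxxx)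
    finally have eq: "exp ?p + exp ?q - 2 - of_real (t\<^sup>2) * (c\<^sup>2 - 2 * s) = r ?p + r ?q + of_real (t ^ 4) * e" .
    have "cmod e \<le> cmod (s\<^sup>2) + cmod (of_real (t\<^sup>2) * s ^ 3 / 3) + cmod (s * c\<^sup>2)"
      unfolding e_def by (intro order_trans[OF norm_triangle_ineq4] add_right_mono order_refl)
    also have "cmod (of_real (t\<^sup>2) * s ^ 3 / 3) \<le> 4 * (cmod s) ^ 3 / 3"
    proof -
      have "t\<^sup>2 \<le> 2\<^sup>2"
        using t abs_le_square_iff[of t 2] by simp
      then have "t\<^sup>2 * cmod s ^ 3 \<le> 4 * cmod s ^ 3"
        by (intro mult_right_mono) auto
      then show ?thesis
        by (simp add: norm_mult norm_power norm_divide)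
    qed
    finally have "cmod e \<le> (cmod s)\<^sup>2 + 4 * (cmod s) ^ 3 / 3 + cmod s * (cmod c)\<^sup>2"
      by (simp add: norm_mult norm_power)
    then have "t ^ 4 * cmod e \<le> t ^ 4 * ((cmod s)\<^sup>2 + 4 * (cmod s) ^ 3 / 3 + cmod s * (cmod c)\<^sup>2)"
      by (rule mult_left_mono) simp
    moreover have "C * t ^ 4 = exp (2 * R) * R ^ 4 / 3 * t ^ 4
        + t ^ 4 * ((cmod s)\<^sup>2 + 4 * (cmod s) ^ 3 / 3 + cmod s * (cmod c)\<^sup>2)"
      by (simp add: C_def algebra_simps)
    moreover have "cmod (of_real (t ^ 4) * e) = t ^ 4 * cmod e"
      by (simp add: norm_mult norm_power)
    ultimately have "cmod (r ?p + r ?q + of_real (t ^ 4) * e) \<le> C * t ^ 4"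
      using norm_triangle_ineq[of "r ?p + r ?q" "of_real (t ^ 4) * e"] rr by linarith
    then show ?thesis
      unfolding eq .
  qed
  moreover have "0 \<le> C"
    by (simp add: C_def R)
  ultimately show ?thesis
    using that by blast
qed

lemma second_difference_limit:
  fixes s c :: complex
  shows "(\<lambda>m. (exp (- of_real (((1/2) ^ m)\<^sup>2) * s + of_real ((1/2) ^ m) * c)
      + exp (- of_real (((1/2) ^ m)\<^sup>2) * s - of_real ((1/2) ^ m) * c) - 2)
      / of_real (((1/2::real) ^ m)\<^sup>2)) \<longlonglongrightarrow> c\<^sup>2 - 2 * s"
proof -
  obtain C where C: "\<And>t::real. \<bar>t\<bar> \<le> 2 \<Longrightarrow>
    cmod (exp (- of_real (t\<^sup>2) * s + of_real t * c) + exp (- of_real (t\<^sup>2) * s - of_real t * c) - 2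
      - of_real (t\<^sup>2) * (c\<^sup>2 - 2 * s)) \<le> C * t ^ 4"
    using second_difference_exp[of s c] by blast
  define E where "E = (\<lambda>t::real. exp (- of_real (t\<^sup>2) * s + of_real t * c)
    + exp (- of_real (t\<^sup>2) * s - of_real t * c) - 2)"
  have le: "cmod (E t / of_real (t\<^sup>2) - (c\<^sup>2 - 2 * s)) \<le> C * t\<^sup>2" if "0 < t" "t \<le> 2" for t
  proof -
    have "E t / of_real (t\<^sup>2) - (c\<^sup>2 - 2 * s) = (E t - of_real (t\<^sup>2) * (c\<^sup>2 - 2 * s)) / of_real (t\<^sup>2)"
      using that by (simp add: field_simps)
    then have "cmod (E t / of_real (t\<^sup>2) - (c\<^sup>2 - 2 * s)) = cmod (E t - of_real (t\<^sup>2) * (c\<^sup>2 - 2 * s)) / t\<^sup>2"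
      by (simp add: norm_divide norm_power)
    also have "\<dots> \<le> C * t ^ 4 / t\<^sup>2"
      using C[of t] that by (intro divide_right_mono) (auto simp: E_def)
    also have "\<dots> = C * t\<^sup>2"
      using that by (simp add: power4_eq_xxxx power2_eq_square)
    finally show ?thesis .
  qed
  have bound: "cmod (E ((1/2) ^ m) / of_real (((1/2) ^ m)\<^sup>2) - (c\<^sup>2 - 2 * s)) \<le> C * ((1/2) ^ m)\<^sup>2" for m
  proof (rule le)
    have "(1/2::real) ^ m \<le> 1"
      by (rule power_le_one) auto
    then show "(1/2::real) ^ m \<le> 2"
      by linarith
  qed simp
  have "(\<lambda>m. (1/2::real) ^ m) \<longlonglongrightarrow> 0"
    by (rule LIMSEQ_realpow_zero) auto
  from tendsto_mult[OF tendsto_const[of C] tendsto_power[OF this, of 2]]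
  have "(\<lambda>m. C * ((1/2::real) ^ m)\<^sup>2) \<longlonglongrightarrow> 0"
    by simp
  then have "(\<lambda>m. E ((1/2) ^ m) / of_real (((1/2) ^ m)\<^sup>2) - (c\<^sup>2 - 2 * s)) \<longlonglongrightarrow> 0"
    by (rule Lim_null_comparison[OF always_eventually[OF allI[OF bound]]])
  then show ?thesis
    unfolding E_def by (rule LIM_zero_cancel)
qed

section \<open>The difference form and its operator\<close>

definition unit_vec :: "'n + 'n \<Rightarrow> complex^'n"
  where "unit_vec b = (case b of Inl j \<Rightarrow> axis j 1 | Inr j \<Rightarrow> axis j \<i>)"

lemma sum_UNIV_Plus:
  fixes f :: "'a::finite + 'b::finite \<Rightarrow> 'c::comm_monoid_add"
  shows "(\<Sum>a\<in>UNIV. f a) = (\<Sum>i\<in>UNIV. f (Inl i)) + (\<Sum>j\<in>UNIV. f (Inr j))"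
  unfolding UNIV_Plus_UNIV[symmetric] by (subst sum.Plus) auto

lemma cdot_axis: "cdot u (axis j a) = cnj (u $ j) * a" "cdot (axis j a) u = cnj a * u $ j"
proof -
  have "cdot u (axis j a) = (\<Sum>i\<in>UNIV. if i = j then cnj (u $ j) * a else 0)"
    unfolding cdot_def by (rule sum.cong) (auto simp: axis_def)
  then show 1: "cdot u (axis j a) = cnj (u $ j) * a"
    by simp
  have "cdot (axis j a) u = (\<Sum>i\<in>UNIV. if i = j then cnj a * u $ j else 0)"
    unfolding cdot_def by (rule sum.cong) (auto simp: axis_def)
  then show "cdot (axis j a) u = cnj a * u $ j"
    by simp
qed

lemma norm_unit_vec: "norm (unit_vec b) = 1"
  by (cases b) (simp_all add: unit_vec_def)

abbreviation step :: "nat \<Rightarrow> 'n + 'n \<Rightarrow> complex^'n"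
  where "step m b \<equiv> (1/2) ^ m *\<^sub>R unit_vec b"

definition diff_form :: "nat \<Rightarrow> 'n::finite fock \<Rightarrow> real"
  where "diff_form m f = (\<Sum>b\<in>UNIV. (norm (weyl (step m b) f - f))\<^sup>2 / ((1/2) ^ m)\<^sup>2)"

text \<open>The bounded self-adjoint operator with form \<open>diff_form m\<close>: since W(-u) is
  the adjoint of W(u), the squared norm of W(u) f - f equals <(2 - W(u) - W(-u)) f, f>.\<close>

definition diff_op :: "nat \<Rightarrow> 'n::finite fock \<Rightarrow> 'n fock"
  where "diff_op m f = (\<Sum>b\<in>UNIV. inverse (((1/2) ^ m)\<^sup>2) *\<^sub>R
    (2 *\<^sub>R f - weyl (step m b) f - weyl (- (step m b)) f))"

lemma cinner_scaleR: "fock_cinner f (r *\<^sub>R g) = complex_of_real r * fock_cinner f g"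
    "fock_cinner (r *\<^sub>R f) g = complex_of_real r * fock_cinner f g"
  by (simp_all add: scaleR_fock_def cinner_bilinear)

lemma cinner_weyl: "fock_cinner f (weyl u g) = fock_cinner (weyl (- u) f) g"
  by (simp add: unitaryD(7)[OF unitary_weyl] inv_weyl)

lemma cinner_weyl_weyl: "fock_cinner (weyl u f) (weyl u g) = fock_cinner f g"
  by (rule unitaryD(2)[OF unitary_weyl])

lemma cinner_second_difference:
  "fock_cinner (weyl u f - f) (weyl u g - g) = fock_cinner (2 *\<^sub>R f - weyl u f - weyl (- u) f) g"
  using cinner_weyl[of f u g] by (simp add: cinner_bilinear cinner_scaleR cinner_weyl_weyl)

lemma cinner_diff_op:
  "fock_cinner (diff_op m f) g = (\<Sum>b\<in>UNIV. fock_cinner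
    (weyl (step m b) f - f) (weyl (step m b) g - g) / complex_of_real (((1/2) ^ m)\<^sup>2))"
  unfolding diff_op_def cinner_sum_left cinner_scaleR cinner_second_difference divide_inverse of_real_inverse
  by (intro sum.cong refl mult.commute)

lemma diff_form_eq: "complex_of_real (diff_form m f) = fock_cinner (diff_op m f) f"
  unfolding cinner_diff_op diff_form_def cinner_self by simp

lemma diff_form_nonneg: "0 \<le> diff_form m f"
  unfolding diff_form_def by (intro sum_nonneg) auto

text \<open>Cauchy-Schwarz in the Fock space for each direction, then in the sum over the 2 n
  directions. It permits testing a vector of unknown regularity against one in the domain of
  N.\<close>

lemma diff_form_Cauchy_Schwarz:
  fixes f g :: "'n::finite fock"
  shows "cmod (fock_cinner (diff_op m f) g) \<le> sqrt (diff_form m f) * sqrt (diff_form m g)"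
proof -
  define N where "N = (\<lambda>(f :: 'n fock) b. norm (weyl (step m b) f - f) / (1/2) ^ m)"
  have form: "diff_form m f = (\<Sum>b\<in>UNIV. (N f b)\<^sup>2)" for f
    by (simp add: diff_form_def N_def power_divide power_mult_distrib)
  have "cmod (fock_cinner (diff_op m f) g) \<le> (\<Sum>b\<in>UNIV. \<bar>N f b\<bar> * \<bar>N g b\<bar>)"
    unfolding cinner_diff_op
  proof (rule sum_norm_le)
    fix b
    show "cmod (fock_cinner (weyl (step m b) f - f) (weyl (step m b) g - g)
        / complex_of_real (((1/2) ^ m)\<^sup>2)) \<le> \<bar>N f b\<bar> * \<bar>N g b\<bar>"
      by (simp add: N_def norm_divide norm_power norm_mult power2_eq_square divide_right_mono cinner_bound)
  qed
  also have "\<dots> \<le> L2_set (N f) UNIV * L2_set (N g) UNIV"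
    by (rule L2_set_mult_ineq)
  finally show ?thesis
    by (simp add: form L2_set_def)
qed

text \<open>W(2 v) - 1 = W(v) (W(v) - 1) + (W(v) - 1), so doubling the step at most doubles the norm
  of the difference, and the factor 4 of the squares is the ratio of the denominators.\<close>

lemma diff_form_Suc: "diff_form m f \<le> diff_form (Suc m) f"
  unfolding diff_form_def
proof (rule sum_mono)
  fix b :: "'a + 'a"
  let ?u = "(1/2) ^ m *\<^sub>R unit_vec b :: complex^'a" and ?v = "(1/2) ^ Suc m *\<^sub>R unit_vec b :: complex^'a"
  have "weyl ?u f = weyl ?v (weyl ?v f)"
    by (simp add: weyl_multiples)
  then have "weyl ?u f - f = weyl ?v (weyl ?v f - f) + (weyl ?v f - f)"
    by (simp add: weyl_linear)
  then have "norm (weyl ?u f - f) \<le> norm (weyl ?v (weyl ?v f - f)) + norm (weyl ?v f - f)"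
    using norm_triangle_ineq by metis
  also have "norm (weyl ?v (weyl ?v f - f)) = norm (weyl ?v f - f)"
    by (rule unitaryD(3)[OF unitary_weyl])
  finally have "(norm (weyl ?u f - f))\<^sup>2 \<le> (2 * norm (weyl ?v f - f))\<^sup>2"
    by (intro power_mono) auto
  then show "(norm (weyl ?u f - f))\<^sup>2 / ((1/2) ^ m)\<^sup>2 \<le> (norm (weyl ?v f - f))\<^sup>2 / ((1/2) ^ Suc m)\<^sup>2"
    by (simp add: field_simps)
qed

lemma incseq_diff_form: "incseq (\<lambda>m. diff_form m f)"
  by (rule incseq_SucI) (rule diff_form_Suc)

lemma tendsto_weyl: "(F \<longlongrightarrow> f) net \<Longrightarrow> ((\<lambda>x. weyl u (F x)) \<longlongrightarrow> weyl u f) net"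
  by (rule bounded_linear.tendsto[OF bounded_clinearD(1)[OF bounded_clinear_weyl]])

lemma tendsto_diff_form: "(F \<longlongrightarrow> f) net \<Longrightarrow> ((\<lambda>x. diff_form m (F x)) \<longlongrightarrow> diff_form m f) net"
  unfolding diff_form_def by (intro tendsto_intros tendsto_weyl) auto

lemma diff_op_linear: "diff_op m (f + g) = diff_op m f + diff_op m g" "diff_op m (c *\<^sub>C f) = c *\<^sub>C diff_op m f"
  "diff_op m 0 = 0"
  by (simp_all add: diff_op_def weyl_linear fock_scale_laws fock_scale_sum algebra_simps sum.distrib sum_subtractf)

text \<open>Along a line the kernel is the exponential of a quadratic polynomial in
  \<open>t\<close>, the shape treated by \<open>second_difference_exp\<close> with s = 1/2.\<close>

lemma cinner_exp_weyl_exp: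
  assumes "norm e = 1"
  shows "fock_cinner (exp_vec u) (weyl (t *\<^sub>R e) (exp_vec v))
    = exp (cdot u v) * exp (- of_real (t\<^sup>2) * (1/2) + of_real t * (cdot u e - cdot e v))"
  using assms unfolding weyl_exp_vec weyl_coeff_def cinner_scale_right cinner_exp_vec exp_add[symmetric]
  by (intro arg_cong[of _ _ exp]) (simp add: cdot_linear power_mult_distrib algebra_simps)

lemma cinner_exp_second_difference:
  assumes "norm e = 1"
  shows "fock_cinner (exp_vec u) (weyl (t *\<^sub>R e) (exp_vec v)) + fock_cinner (exp_vec u) (weyl (- (t *\<^sub>R e)) (exp_vec v))
      - 2 * fock_cinner (exp_vec u) (exp_vec v)
    = exp (cdot u v) * (exp (- of_real (t\<^sup>2) * (1/2) + of_real t * (cdot u e - cdot e v))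
      + exp (- of_real (t\<^sup>2) * (1/2) - of_real t * (cdot u e - cdot e v)) - 2)"
  using cinner_exp_weyl_exp[OF assms, of u t v] cinner_exp_weyl_exp[OF assms, of u "- t" v]
  by (simp add: cinner_exp_vec algebra_simps)

section \<open>Weak convergence of the difference operators to 4 N + 2 n\<close>

abbreviation shifted_num :: "'n::finite fock \<Rightarrow> 'n fock \<Rightarrow> 'n fock"
  where "shifted_num g f \<equiv> 4 *\<^sub>C g + of_nat (2 * CARD('n)) *\<^sub>C f"

lemma diff_op_exp_cinner_limit:
  fixes u v :: "complex^'n"
  shows "(\<lambda>m. fock_cinner (exp_vec u) (diff_op m (exp_vec v)))
    \<longlonglongrightarrow> fock_cinner (exp_vec u) (shifted_num (num_exp_vec v) (exp_vec v))"
proof -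
  define c where "c = (\<lambda>b :: 'n + 'n. cdot u (unit_vec b) - cdot (unit_vec b) v)"
  let ?E = "\<lambda>m b. (exp (- of_real (((1/2) ^ m)\<^sup>2) * (1/2) + of_real ((1/2) ^ m) * c b)
      + exp (- of_real (((1/2) ^ m)\<^sup>2) * (1/2) - of_real ((1/2) ^ m) * c b) - 2)
      / of_real (((1/2::real) ^ m)\<^sup>2)"
  have eq: "fock_cinner (exp_vec u) (diff_op m (exp_vec v)) = (\<Sum>b\<in>UNIV. - exp (cdot u v) * ?E m b)" for m
  proof -
    let ?h = "(1/2::real) ^ m"
    have "fock_cinner (exp_vec u) (inverse (?h\<^sup>2) *\<^sub>R (2 *\<^sub>R exp_vec v - weyl (?h *\<^sub>R unit_vec b) (exp_vec v)
        - weyl (- (?h *\<^sub>R unit_vec b)) (exp_vec v))) = - exp (cdot u v) * ?E m b" for b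
    proof -
      have "fock_cinner (exp_vec u) (2 *\<^sub>R exp_vec v - weyl (?h *\<^sub>R unit_vec b) (exp_vec v)
          - weyl (- (?h *\<^sub>R unit_vec b)) (exp_vec v))
        = - (fock_cinner (exp_vec u) (weyl (?h *\<^sub>R unit_vec b) (exp_vec v))
          + fock_cinner (exp_vec u) (weyl (- (?h *\<^sub>R unit_vec b)) (exp_vec v))
          - 2 * fock_cinner (exp_vec u) (exp_vec v))"
        by (simp add: cinner_bilinear cinner_scaleR)
      then show ?thesis
        unfolding cinner_scaleR cinner_exp_second_difference[OF norm_unit_vec] c_def of_real_inverse
        by (simp only: divide_inverse mult_minus_left mult_minus_right mult.assoc mult.commute mult.left_commute)
    qed
    then show ?thesis
      unfolding diff_op_def cinner_sum_right by (intro sum.cong refl)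
  qed
  have "(\<lambda>m. \<Sum>b\<in>UNIV. - exp (cdot u v) * ?E m b) \<longlonglongrightarrow> (\<Sum>b\<in>UNIV. - exp (cdot u v) * ((c b)\<^sup>2 - 2 * (1/2)))"
    by (intro tendsto_sum tendsto_mult_left second_difference_limit)
  \<comment> \<open>This is the origin of 4 N + 2 n. For mode j the two values of \<open>c\<close>
    are cnj u_j - v_j and i (cnj u_j + v_j), whose squares add up to -4 cnj u_j v_j; each of the 2 n
    directions contributes the constant 1.\<close>
  moreover have "(\<Sum>b\<in>UNIV. (c b)\<^sup>2) = - 4 * cdot u v"
    unfolding sum_UNIV_Plus c_def unit_vec_def sum.case cdot_axis
    by (simp add: cdot_def sum_distrib_left sum.distrib[symmetric] power2_eq_square algebra_simps)
  then have "(\<Sum>b\<in>UNIV. - exp (cdot u v) * ((c b)\<^sup>2 - 2 * (1/2)))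
      = fock_cinner (exp_vec u) (shifted_num (num_exp_vec v) (exp_vec v))"
    by (simp add: cinner_bilinear cinner_exp_vec cinner_num_exp_vec sum_distrib_left[symmetric] sum_subtractf card_UNIV_sum algebra_simps)
  ultimately show ?thesis
    unfolding eq by simp
qed

text \<open>The square of 2 - W - W', where W' is the inverse of W, is 6 - 4 (W + W') + (W^2 +
  W'^2). In terms of the kernel this is the second difference at 2 t minus four times that at t,
  where the terms of order t^2 cancel.\<close>

lemma second_difference_exp_vec_bounded:
  fixes v e :: "complex^'n"
  assumes "norm e = 1"
  obtains B where "\<And>t. 0 < t \<Longrightarrow> t \<le> 1 \<Longrightarrow>
    norm (2 *\<^sub>R exp_vec v - weyl (t *\<^sub>R e) (exp_vec v) - weyl (- (t *\<^sub>R e)) (exp_vec v)) \<le> B * t\<^sup>2"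
proof -
  define c where "c = cdot v e - cdot e v"
  define E where "E = (\<lambda>t::real. exp (- of_real (t\<^sup>2) * (1/2) + of_real t * c)
    + exp (- of_real (t\<^sup>2) * (1/2) - of_real t * c) - 2)"
  obtain C where C: "0 \<le> C" "\<And>t::real. \<bar>t\<bar> \<le> 2 \<Longrightarrow> cmod (E t - of_real (t\<^sup>2) * (c\<^sup>2 - 2 * (1/2))) \<le> C * t ^ 4"
    unfolding E_def using second_difference_exp[of "1/2" c] by blast
  \<comment> \<open>The two remainders are at most C (2 t)^4 and 4 C t^4, and 20 = 2^4 + 4.\<close>
  define B where "B = sqrt (cmod (exp (cdot v v)) * (20 * C))"
  have "norm (2 *\<^sub>R exp_vec v - weyl (t *\<^sub>R e) (exp_vec v) - weyl (- (t *\<^sub>R e)) (exp_vec v)) \<le> B * t\<^sup>2"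
    if t: "0 < t" "t \<le> 1" for t
  proof -
    let ?f = "exp_vec v" and ?W = "weyl (t *\<^sub>R e)" and ?W' = "weyl (- (t *\<^sub>R e))"
    let ?g = "2 *\<^sub>R ?f - ?W ?f - ?W' ?f"
    have WW: "?W (?W ?f) = weyl ((2 * t) *\<^sub>R e) ?f" "?W' (?W' ?f) = weyl (- ((2 * t) *\<^sub>R e)) ?f"
      using weyl_multiples[of t e t ?f] weyl_multiples[of "- t" e "- t" ?f] by simp_all
    have kernel: "fock_cinner ?f (weyl (r *\<^sub>R e) ?f) + fock_cinner ?f (weyl (- (r *\<^sub>R e)) ?f)
        = exp (cdot v v) * E r + 2 * fock_cinner ?f ?f" for r
      using cinner_exp_second_difference[OF assms, of v r v] by (simp only: E_def c_def diff_eq_eq)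
    have "fock_cinner ?g ?g = 6 * fock_cinner ?f ?f
        - 4 * (fock_cinner ?f (?W ?f) + fock_cinner ?f (?W' ?f))
        + (fock_cinner ?f (?W (?W ?f)) + fock_cinner ?f (?W' (?W' ?f)))"
    proof -
      have "fock_cinner (?W ?f) h = fock_cinner ?f (?W' h)" "fock_cinner (?W' ?f) h = fock_cinner ?f (?W h)" for h
        using cinner_weyl[of ?f "- (t *\<^sub>R e)" h] cinner_weyl[of ?f "t *\<^sub>R e" h] by simp_all
      then show ?thesis
        by (simp add: cinner_bilinear cinner_scaleR weyl_minus)
    qed
    also have "\<dots> = exp (cdot v v) * (E (2 * t) - 4 * E t)"
      unfolding WW kernel by (simp add: algebra_simps)
    finally have norm_g: "(norm ?g)\<^sup>2 = cmod (exp (cdot v v)) * cmod (E (2 * t) - 4 * E t)"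
      unfolding cinner_self by (metis norm_mult norm_of_real abs_power2)
    have "cmod (E (2 * t) - 4 * E t) \<le> 20 * C * t ^ 4"
    proof -
      let ?x = "E (2 * t) - of_real ((2 * t)\<^sup>2) * (c\<^sup>2 - 2 * (1/2))" and ?y = "E t - of_real (t\<^sup>2) * (c\<^sup>2 - 2 * (1/2))"
      have "E (2 * t) - 4 * E t = ?x - 4 * ?y"
        by (simp add: power2_eq_square algebra_simps)
      then have "cmod (E (2 * t) - 4 * E t) \<le> cmod ?x + cmod (4 * ?y)"
        by (simp only: norm_triangle_ineq4)
      also have "cmod (4 * ?y) = 4 * cmod ?y"
        by (simp only: norm_mult norm_numeral)
      also have "cmod ?x + 4 * cmod ?y \<le> C * (2 * t) ^ 4 + 4 * (C * t ^ 4)"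
        by (intro add_mono mult_left_mono C(2)) (use t in auto)
      finally show ?thesis
        by (simp add: power_mult_distrib)
    qed
    then have "(norm ?g)\<^sup>2 \<le> cmod (exp (cdot v v)) * (20 * C * t ^ 4)"
      unfolding norm_g by (rule mult_left_mono) simp
    also have "\<dots> = (B * t\<^sup>2)\<^sup>2"
      using C(1) by (simp add: B_def power_mult_distrib mult.assoc)
    finally show ?thesis
      by (rule power2_le_imp_le) (simp add: B_def C(1))
  qed
  then show ?thesis
    by (rule that)
qed

lemma diff_op_exp_vec_bounded:
  obtains B where "\<And>m. norm (diff_op m (exp_vec v)) \<le> B"
proof -
  have "\<forall>b. \<exists>B. \<forall>t. 0 < t \<longrightarrow> t \<le> 1 \<longrightarrow>
    norm (2 *\<^sub>R exp_vec v - weyl (t *\<^sub>R unit_vec b) (exp_vec v) - weyl (- (t *\<^sub>R unit_vec b)) (exp_vec v)) \<le> B * t\<^sup>2"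
    using second_difference_exp_vec_bounded[OF norm_unit_vec, of v] by metis
  then obtain B where B: "\<And>b t. 0 < t \<Longrightarrow> t \<le> 1 \<Longrightarrow>
    norm (2 *\<^sub>R exp_vec v - weyl (t *\<^sub>R unit_vec b) (exp_vec v) - weyl (- (t *\<^sub>R unit_vec b)) (exp_vec v)) \<le> B b * t\<^sup>2"
    by metis
  have "norm (diff_op m (exp_vec v)) \<le> (\<Sum>b\<in>UNIV. B b)" for m
    unfolding diff_op_def
  proof (rule sum_norm_le)
    fix b :: "'a + 'a"
    have "norm (2 *\<^sub>R exp_vec v - weyl (step m b) (exp_vec v) - weyl (- (step m b)) (exp_vec v))
      \<le> B b * ((1/2) ^ m)\<^sup>2"
      by (rule B) (auto intro: power_le_one)
    then show "norm (inverse (((1/2) ^ m)\<^sup>2) *\<^sub>R (2 *\<^sub>R exp_vec v - weyl (step m b) (exp_vec v)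
        - weyl (- (step m b)) (exp_vec v))) \<le> B b"
      by (simp add: divide_simps mult.commute)
  qed
  then show ?thesis
    by (rule that)
qed

text \<open>Norm bounded vectors whose inner products converge on a dense subspace converge
  weakly.\<close>

lemma diff_op_exp_weak_limit:
  fixes v :: "complex^'n"
  shows "(\<lambda>m. fock_cinner f (diff_op m (exp_vec v)))
    \<longlonglongrightarrow> fock_cinner f (shifted_num (num_exp_vec v) (exp_vec v))"
proof -
  obtain B0 where B0: "\<And>m. norm (diff_op m (exp_vec v)) \<le> B0"
    by (rule diff_op_exp_vec_bounded) blast
  let ?g = "shifted_num (num_exp_vec v) (exp_vec v)"
  define B where "B = B0 + norm ?g + 1"
  have B: "norm (diff_op m (exp_vec v) - ?g) \<le> B" for m
    using norm_triangle_ineq4[of "diff_op m (exp_vec v)" ?g] B0[of m] by (simp add: B_def)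
  have "0 < B"
    using B0[of 0] by (simp add: B_def order_le_less_trans[OF norm_ge_zero] add_nonneg_pos order_trans[OF norm_ge_zero])
  show ?thesis
  proof (induction f rule: dense_induct)
    case zero
    show ?case
      by (simp add: cinner_bilinear)
  next
    case (add c u f)
    show ?case
      unfolding cinner_add_left cinner_scale_left
      by (intro tendsto_add tendsto_mult_left diff_op_exp_cinner_limit add)
  next
    case (lim F f)
    show ?case
    proof (rule LIMSEQ_I)
      fix r :: real assume r: "0 < r"
      obtain k where "dist (F k) f < r / (2 * B)"
        using metric_LIMSEQ_D[OF lim(2), of "r / (2 * B)"] r \<open>0 < B\<close> by auto
      then have k: "norm (f - F k) * B < r / 2"
        using \<open>0 < B\<close> by (simp add: dist_norm norm_minus_commute field_simps)
      obtain M where M: "\<And>m. M \<le> m \<Longrightarrow> cmod (fock_cinner (F k) (diff_op m (exp_vec v)) - fock_cinner (F k) ?g) < r / 2"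
        using LIMSEQ_D[OF lim(1)[of k], of "r / 2"] r by auto
      have "cmod (fock_cinner f (diff_op m (exp_vec v)) - fock_cinner f ?g) < r" if "M \<le> m" for m
      proof -
        have "fock_cinner f (diff_op m (exp_vec v)) - fock_cinner f ?g
            = fock_cinner (f - F k) (diff_op m (exp_vec v) - ?g)
              + (fock_cinner (F k) (diff_op m (exp_vec v)) - fock_cinner (F k) ?g)"
          unfolding bounded_bilinear.diff_left[OF bounded_bilinear_cinner] bounded_bilinear.diff_right[OF bounded_bilinear_cinner]
          by simp
        then have "cmod (fock_cinner f (diff_op m (exp_vec v)) - fock_cinner f ?g)
            \<le> cmod (fock_cinner (f - F k) (diff_op m (exp_vec v) - ?g))
              + cmod (fock_cinner (F k) (diff_op m (exp_vec v)) - fock_cinner (F k) ?g)"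
          using norm_triangle_ineq by metis
        moreover have "cmod (fock_cinner (f - F k) (diff_op m (exp_vec v) - ?g)) \<le> norm (f - F k) * B"
          using cinner_bound mult_left_mono[OF B norm_ge_zero] by (rule order_trans)
        ultimately show ?thesis
          using M[OF that] k by linarith
      qed
      then show "\<exists>no. \<forall>m\<ge>no. norm (fock_cinner f (diff_op m (exp_vec v)) - fock_cinner f ?g) < r"
        by blast
    qed
  qed
qed

lemma diff_op_weak_limit:
  fixes f g :: "'n::finite fock"
  assumes "(f, g) \<in> exp_graph num_exp_vec"
  shows "(\<lambda>m. fock_cinner h (diff_op m f)) \<longlonglongrightarrow> fock_cinner h (shifted_num g f)"
  using assms
proof (induction rule: exp_graph_induct)
  case zero
  show ?case
    by (simp add: diff_op_linear fock_scale_laws cinner_bilinear)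
next
  case (add c v f g)
  show ?case
    using tendsto_add[OF tendsto_mult_left[OF diff_op_exp_weak_limit, of c h v] add.IH]
    by (simp add: diff_op_linear cinner_add_right cinner_scale_right algebra_simps)
qed

text \<open>An increasing sequence lies below its limit, and the limit is read off the weak
  convergence.\<close>

lemma diff_form_le_exp_graph:
  fixes f g :: "'n::finite fock"
  assumes "(f, g) \<in> exp_graph num_exp_vec"
  shows "diff_form m f \<le> Re (fock_cinner f (shifted_num g f))"
proof (rule incseq_le[OF incseq_diff_form])
  have "diff_form m f = Re (fock_cinner f (diff_op m f))" for m
    using arg_cong[OF diff_form_eq[of m f], of Re] arg_cong[OF cinner_commute[of f "diff_op m f"], of Re] by simp
  then show "(\<lambda>m. diff_form m f) \<longlonglongrightarrow> Re (fock_cinner f (shifted_num g f))"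
    using tendsto_Re[OF diff_op_weak_limit[OF assms, of f]] by simp
qed

text \<open>For fixed \<open>m\<close> the form is continuous, and the right hand side is continuous
  in the graph norm.\<close>

lemma diff_form_le_closure:
  fixes f g :: "'n::finite fock"
  assumes "(f, g) \<in> closure (exp_graph num_exp_vec)"
  shows "diff_form m f \<le> Re (fock_cinner f (shifted_num g f))"
proof -
  obtain F G where F: "\<And>k. (F k, G k) \<in> exp_graph num_exp_vec" "F \<longlonglongrightarrow> f" "G \<longlonglongrightarrow> g"
    using assms by (rule exp_graph_closureE) blast
  show ?thesis
  proof (rule LIMSEQ_le)
    show "(\<lambda>k. diff_form m (F k)) \<longlonglongrightarrow> diff_form m f"
      by (rule tendsto_diff_form[OF F(2)])
    show "(\<lambda>k. Re (fock_cinner (F k) (shifted_num (G k) (F k))))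
        \<longlonglongrightarrow> Re (fock_cinner f (shifted_num g f))"
      by (intro tendsto_Re tendsto_cinner tendsto_add tendsto_fock_scale F)
    show "\<exists>N. \<forall>k\<ge>N. diff_form m (F k) \<le> Re (fock_cinner (F k) (shifted_num (G k) (F k)))"
      using diff_form_le_exp_graph[OF F(1)] by blast
  qed
qed

text \<open>The limit of \<open>diff_form_Cauchy_Schwarz\<close> in \<open>m\<close>: on the side of
  \<open>f\<close> the limit is known, while \<open>h\<close> enters only through the uniform bound
  \<open>D\<close>.\<close>

lemma form_le_diff_form_exp_graph:
  fixes f g h :: "'n::finite fock"
  assumes "(f, g) \<in> exp_graph num_exp_vec" and D: "\<And>m. diff_form m h \<le> D"
  shows "cmod (fock_cinner h (shifted_num g f))
    \<le> sqrt (Re (fock_cinner f (shifted_num g f))) * sqrt D"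
proof (rule LIMSEQ_le_const2[OF tendsto_norm[OF diff_op_weak_limit[OF assms(1)]]])
  have "cmod (fock_cinner h (diff_op m f)) \<le> sqrt (Re (fock_cinner f (shifted_num g f))) * sqrt D" for m
  proof -
    have "cmod (fock_cinner h (diff_op m f)) = cmod (fock_cinner (diff_op m f) h)"
      by (subst cinner_commute) simp
    also have "\<dots> \<le> sqrt (diff_form m f) * sqrt (diff_form m h)"
      by (rule diff_form_Cauchy_Schwarz)
    also have "\<dots> \<le> sqrt (Re (fock_cinner f (shifted_num g f))) * sqrt D"
      using diff_form_le_exp_graph[OF assms(1), of m] D[of m] diff_form_nonneg[of m f] diff_form_nonneg[of m h]
      by (intro mult_mono real_sqrt_le_mono) auto
    finally show ?thesis .
  qed
  then show "\<exists>N. \<forall>m\<ge>N. cmod (fock_cinner h (diff_op m f))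
      \<le> sqrt (Re (fock_cinner f (shifted_num g f))) * sqrt D"
    by blast
qed

lemma form_le_diff_form_closure:
  fixes f g h :: "'n::finite fock"
  assumes "(f, g) \<in> closure (exp_graph num_exp_vec)" and D: "\<And>m. diff_form m h \<le> D"
  shows "cmod (fock_cinner h (shifted_num g f))
    \<le> sqrt (Re (fock_cinner f (shifted_num g f))) * sqrt D"
proof -
  obtain F G where F: "\<And>k. (F k, G k) \<in> exp_graph num_exp_vec" "F \<longlonglongrightarrow> f" "G \<longlonglongrightarrow> g"
    using assms(1) by (rule exp_graph_closureE) blast
  show ?thesis
  proof (rule LIMSEQ_le)
    show "(\<lambda>k. cmod (fock_cinner h (shifted_num (G k) (F k))))
        \<longlonglongrightarrow> cmod (fock_cinner h (shifted_num g f))"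
      by (intro tendsto_norm tendsto_cinner tendsto_const tendsto_add tendsto_fock_scale F)
    show "(\<lambda>k. sqrt (Re (fock_cinner (F k) (shifted_num (G k) (F k)))) * sqrt D)
        \<longlonglongrightarrow> sqrt (Re (fock_cinner f (shifted_num g f))) * sqrt D"
      by (intro tendsto_mult tendsto_const tendsto_real_sqrt tendsto_Re tendsto_cinner tendsto_add tendsto_fock_scale F)
    show "\<exists>N. \<forall>k\<ge>N. cmod (fock_cinner h (shifted_num (G k) (F k)))
        \<le> sqrt (Re (fock_cinner (F k) (shifted_num (G k) (F k)))) * sqrt D"
      using form_le_diff_form_exp_graph[OF F(1) D] by blast
  qed
qed

section \<open>Comparison of the difference form with the form of 4 N + 2 n\<close>

definition number_form_partial :: "nat \<Rightarrow> 'n::finite fock \<Rightarrow> real"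
  where "number_form_partial K f = (\<Sum>k<K. (4 * real k + 2 * real CARD('n)) * (norm (particle_proj k f))\<^sup>2)"

lemma number_form_partial_nonneg: "0 \<le> number_form_partial K f"
  unfolding number_form_partial_def by (intro sum_nonneg) auto

lemma cinner_truncate_form:
  fixes f :: "'n::finite fock"
  shows "fock_cinner f (shifted_num (truncate_num K f) (truncate K f))
      = complex_of_real (number_form_partial K f)"
    "fock_cinner (truncate K f) (shifted_num (truncate_num K f) (truncate K f))
      = complex_of_real (number_form_partial K f)"
proof -
  have 1: "fock_cinner f (truncate_num K f) = complex_of_real (\<Sum>k<K. real k * (norm (particle_proj k f))\<^sup>2)"
    "fock_cinner (truncate K f) (truncate_num K f) = complex_of_real (\<Sum>k<K. real k * (norm (particle_proj k f))\<^sup>2)"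
    by (subst cinner_commute, simp only: cinner_truncate complex_cnj_complex_of_real)+
  have 2: "number_form_partial K f = 4 * (\<Sum>k<K. real k * (norm (particle_proj k f))\<^sup>2)
      + real (2 * CARD('n)) * (\<Sum>k<K. (norm (particle_proj k f))\<^sup>2)"
    by (simp add: number_form_partial_def sum_distrib_left sum.distrib[symmetric] algebra_simps)
  show "fock_cinner f (shifted_num (truncate_num K f) (truncate K f))
      = complex_of_real (number_form_partial K f)"
    "fock_cinner (truncate K f) (shifted_num (truncate_num K f) (truncate K f))
      = complex_of_real (number_form_partial K f)"
    unfolding cinner_add_right cinner_scale_right 1 2 cinner_truncate by simp_all
qed

text \<open>Pairing \<open>f\<close> with the image of its truncation gives the same number q as
  pairing the truncation with it. The Cauchy-Schwarz bound becomes q <= sqrt q sqrt D, from which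
  sqrt q can be cancelled.\<close>

lemma number_form_partial_le:
  assumes D: "\<And>m. diff_form m f \<le> D"
  shows "number_form_partial K f \<le> D"
proof -
  let ?q = "number_form_partial K f"
  have q: "0 \<le> ?q" and D0: "0 \<le> D"
    using number_form_partial_nonneg order_trans[OF diff_form_nonneg D] by auto
  have "?q \<le> sqrt ?q * sqrt D"
    using form_le_diff_form_closure[OF truncate_in_closure[of K f] D] q
    unfolding cinner_truncate_form by simp
  moreover have "sqrt ?q * sqrt ?q = ?q"
    using q by simp
  ultimately have "sqrt ?q * sqrt ?q \<le> sqrt ?q * sqrt D"
    by (simp only:)
  then have "sqrt ?q \<le> sqrt D \<or> sqrt ?q = 0"
    using q by (metis less_eq_real_def mult_le_cancel_left_pos real_sqrt_ge_zero)
  then show ?thesis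
    using D0 by auto
qed

lemma diff_form_truncate_le: "diff_form m (truncate K f) \<le> number_form_partial K f"
  using diff_form_le_closure[OF truncate_in_closure, of m K f] unfolding cinner_truncate_form by simp

definition number_form :: "'n::finite fock \<Rightarrow> ennreal"
  where "number_form f = (\<Sum>k. ennreal ((4 * real k + 2 * real CARD('n)) * (norm (particle_proj k f))\<^sup>2))"

lemma number_form_SUP: "number_form f = (SUP K. ennreal (number_form_partial K f))"
  unfolding number_form_def suminf_eq_SUP number_form_partial_def by (simp add: sum_ennreal)

text \<open>
  The difference quotients exhaust the form of \<open>4 N + 2 n\<close> also on vectors outside the form domain
  of \<open>N\<close>, where both sides are infinite.
\<close>

lemma SUP_diff_form: "(SUP m. ennreal (diff_form m f)) = number_form f"
proof (rule antisym)
  show "(SUP m. ennreal (diff_form m f)) \<le> number_form f"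
  proof (rule SUP_least)
    fix m
    \<comment> \<open>The bound holds for every truncation and passes to \<open>f\<close> by
      continuity of \<open>diff_form m\<close>.\<close>
    show "ennreal (diff_form m f) \<le> number_form f"
    proof (rule LIMSEQ_le_const2)
      show "(\<lambda>K. ennreal (diff_form m (truncate K f))) \<longlonglongrightarrow> ennreal (diff_form m f)"
        by (intro tendsto_ennrealI tendsto_diff_form tendsto_truncate)
      have "ennreal (diff_form m (truncate K f)) \<le> number_form f" for K
        unfolding number_form_SUP by (rule SUP_upper2[of K]) (simp_all add: ennreal_leI diff_form_truncate_le)
      then show "\<exists>N. \<forall>K\<ge>N. ennreal (diff_form m (truncate K f)) \<le> number_form f"
        by blast
    qed
  qed
  show "number_form f \<le> (SUP m. ennreal (diff_form m f))"
  proof (cases "(SUP m. ennreal (diff_form m f)) = \<infinity>")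
    case False
    then obtain D where D: "0 \<le> D" "(SUP m. ennreal (diff_form m f)) = ennreal D"
      by (cases "SUP m. ennreal (diff_form m f)") auto
    have "diff_form m f \<le> D" for m
      using SUP_upper[of m UNIV "\<lambda>m. ennreal (diff_form m f)"] D by simp
    then show ?thesis
      unfolding D(2) number_form_SUP by (intro SUP_least ennreal_leI number_form_partial_le)
  next
    case True
    show ?thesis
      unfolding True by simp
  qed
qed

section \<open>Decomposition of states\<close>

text \<open>The algebraic content of positivity, in the form in which one Cholesky step hands it on
  to the next.\<close>

definition positive_op :: "('n fock \<Rightarrow> 'n fock) \<Rightarrow> bool"
  where "positive_op R \<longleftrightarrow> (\<forall>f g. R (f + g) = R f + R g) \<and> (\<forall>c f. R (c *\<^sub>C f) = c *\<^sub>C R f) \<and>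
    (\<forall>f. fock_cinner f (R f) \<in> \<real>\<^sub>\<ge>\<^sub>0)"

lemma positive_op_linear:
  assumes "positive_op R"
  shows "R (f + g) = R f + R g" "R (c *\<^sub>C f) = c *\<^sub>C R f" "R 0 = 0"
proof -
  show "R (f + g) = R f + R g" "R (c *\<^sub>C f) = c *\<^sub>C R f"
    using assms by (simp_all add: positive_op_def)
  have "R (0 *\<^sub>C 0) = 0 *\<^sub>C R 0"
    using assms unfolding positive_op_def by blast
  then show "R 0 = 0"
    by (simp add: fock_scale_laws)
qed

lemma positive_op_form:
  assumes "positive_op R"
  shows "0 \<le> Re (fock_cinner f (R f))" "Im (fock_cinner f (R f)) = 0"
  using assms by (auto simp: positive_op_def complex_nonneg_Reals_iff)

text \<open>Polarization: the form is real at f + g and at f + i g.\<close>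

lemma positive_op_hermitian:
  assumes R: "positive_op R"
  shows "fock_cinner f (R g) = cnj (fock_cinner g (R f))" "fock_cinner f (R g) = fock_cinner (R f) g"
proof -
  have "Im (fock_cinner (f + g) (R (f + g))) = 0" "Im (fock_cinner (f + \<i> *\<^sub>C g) (R (f + \<i> *\<^sub>C g))) = 0"
    by (rule positive_op_form[OF R])+
  then show "fock_cinner f (R g) = cnj (fock_cinner g (R f))"
    by (simp add: positive_op_linear[OF R] cinner_bilinear positive_op_form[OF R] complex_eq_iff)
  then show "fock_cinner f (R g) = fock_cinner (R f) g"
    by (simp flip: cinner_commute)
qed

lemma positive_op_Cauchy_Schwarz:
  assumes R: "positive_op R"
  shows "(cmod (fock_cinner f (R g)))\<^sup>2 \<le> Re (fock_cinner f (R f)) * Re (fock_cinner g (R g))"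
proof -
  let ?b = "fock_cinner f (R g)" and ?\<alpha> = "Re (fock_cinner f (R f))" and ?\<beta> = "Re (fock_cinner g (R g))"
  have quad: "0 \<le> ?\<alpha> - 2 * t * (cmod ?b)\<^sup>2 + t\<^sup>2 * (cmod ?b)\<^sup>2 * ?\<beta>" for t :: real
  proof -
    let ?t = "- (complex_of_real t * cnj ?b)"
    have "0 \<le> Re (fock_cinner (f + ?t *\<^sub>C g) (R (f + ?t *\<^sub>C g)))"
      by (rule positive_op_form[OF R])
    also have "fock_cinner (f + ?t *\<^sub>C g) (R (f + ?t *\<^sub>C g))
        = fock_cinner f (R f) + (?t * ?b + cnj (?t * ?b)) + (?t * cnj ?t) * fock_cinner g (R g)"
      using positive_op_hermitian(1)[OF R, of g f]
      by (simp add: positive_op_linear[OF R] cinner_bilinear algebra_simps)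
    also have "?t * ?b = - complex_of_real (t * (cmod ?b)\<^sup>2)"
      using complex_norm_square[of ?b] by (simp add: mult_ac)
    also have "?t * cnj ?t = complex_of_real (t\<^sup>2 * (cmod ?b)\<^sup>2)"
      using complex_norm_square[of ?b] by (simp add: power2_eq_square mult_ac)
    finally show ?thesis
      by (simp add: mult.assoc)
  qed
  have \<beta>: "0 \<le> ?\<beta>" and \<alpha>: "0 \<le> ?\<alpha>"
    by (rule positive_op_form[OF R])+
  show ?thesis
  proof (cases "?\<beta> = 0")
    case True
    have "?b = 0"
    proof (rule ccontr)
      assume "?b \<noteq> 0"
      then have "0 < (cmod ?b)\<^sup>2"
        by simp
      then show False
        \<comment> \<open>At this \<open>t\<close> the right hand side of \<open>quad\<close> is
          -1.\<close>
        using quad[of "(?\<alpha> + 1) / (2 * (cmod ?b)\<^sup>2)"] True \<alpha> by (simp add: field_simps)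
    qed
    then show ?thesis
      by (simp add: \<alpha> \<beta>)
  next
    case False
    then have "0 \<le> ?\<alpha> - (cmod ?b)\<^sup>2 / ?\<beta>"
      \<comment> \<open>The minimum of the quadratic polynomial in \<open>t\<close> when the inner
        product does not vanish.\<close>
      using quad[of "1 / ?\<beta>"] by (simp add: field_simps power2_eq_square)
    then show ?thesis
      using False \<beta> by (simp add: field_simps)
  qed
qed

text \<open>One step of the Cholesky decomposition; \<open>R e = 0\<close> if the denominator vanishes.\<close>

definition schur_complement :: "('n fock \<Rightarrow> 'n fock) \<Rightarrow> 'n fock \<Rightarrow> 'n fock \<Rightarrow> 'n fock"
  where "schur_complement R e f = R f - (fock_cinner e (R f) / fock_cinner e (R e)) *\<^sub>C R e"

text \<open>Positivity of the remainder is precisely the Cauchy-Schwarz inequality of the form of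
  \<open>R\<close>. The same inequality shows that a vanishing denominator forces
  \<open>R e = 0\<close>.\<close>

lemma schur_complement:
  assumes R: "positive_op R"
  shows "positive_op (schur_complement R e)" "schur_complement R e e = 0"
    "R f = 0 \<Longrightarrow> schur_complement R e f = 0"
proof -
  define \<beta> where "\<beta> = Re (fock_cinner e (R e))"
  have \<beta>: "fock_cinner e (R e) = complex_of_real \<beta>" "0 \<le> \<beta>"
    using positive_op_form[OF R] by (simp_all add: \<beta>_def complex_eq_iff)
  show "R f = 0 \<Longrightarrow> schur_complement R e f = 0"
    by (simp add: schur_complement_def cinner_bilinear fock_scale_laws)
  show "schur_complement R e e = 0"
  proof (cases "\<beta> = 0")
    case True
    have "fock_cinner f (R e) = 0" for f
      using positive_op_Cauchy_Schwarz[OF R, of f e] True by (simp add: \<beta>(1))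
    then have "R e = 0"
      by (intro cinner_eqI) (simp add: cinner_bilinear)
    then show ?thesis
      by (simp add: schur_complement_def fock_scale_laws)
  qed (simp add: schur_complement_def fock_scale_laws \<beta>(1))
  have "fock_cinner f (schur_complement R e f) \<in> \<real>\<^sub>\<ge>\<^sub>0" for f
  proof -
    have "fock_cinner f (schur_complement R e f)
        = fock_cinner f (R f) - (fock_cinner e (R f) * fock_cinner f (R e)) / complex_of_real \<beta>"
      by (simp add: schur_complement_def cinner_bilinear \<beta>(1))
    also have "fock_cinner e (R f) * fock_cinner f (R e) = complex_of_real ((cmod (fock_cinner f (R e)))\<^sup>2)"
      unfolding positive_op_hermitian(1)[OF R, of e f] complex_norm_square by (rule mult.commute)
    also have "fock_cinner f (R f) = complex_of_real (Re (fock_cinner f (R f)))"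
      using positive_op_form[OF R] by (simp add: complex_eq_iff)
    finally have eq: "fock_cinner f (schur_complement R e f)
        = complex_of_real (Re (fock_cinner f (R f)) - (cmod (fock_cinner f (R e)))\<^sup>2 / \<beta>)"
      by simp
    have "(cmod (fock_cinner f (R e)))\<^sup>2 / \<beta> \<le> Re (fock_cinner f (R f))"
      using positive_op_Cauchy_Schwarz[OF R, of f e] positive_op_form[OF R, of f] \<beta>
      by (cases "\<beta> = 0") (auto simp: field_simps)
    then show ?thesis
      unfolding eq by (simp add: complex_nonneg_Reals_iff)
  qed
  then show "positive_op (schur_complement R e)"
    unfolding positive_op_def
    by (auto simp: schur_complement_def positive_op_linear[OF R] cinner_bilinear fock_scale_laws
        add_divide_distrib algebra_simps)
qed

text \<open>The remainder \<open>Q i\<close> after i steps vanishes on all earlier vectors of the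
  sequence. The factors are therefore triangular, and the expansion at \<open>e k\<close> is exact
  after k + 1 steps, without any limit.\<close>

lemma cholesky_decomposition:
  fixes e :: "nat \<Rightarrow> 'n fock"
  assumes R: "positive_op R"
  obtains \<psi> where "\<And>k. R (e k) = (\<Sum>i\<le>k. fock_cinner (\<psi> i) (e k) *\<^sub>C \<psi> i)"
    "\<And>i k. k < i \<Longrightarrow> fock_cinner (\<psi> i) (e k) = 0"
proof -
  define Q where "Q = rec_nat R (\<lambda>i Q. schur_complement Q (e i))"
  have Q: "Q 0 = R" "Q (Suc i) = schur_complement (Q i) (e i)" for i
    by (simp_all add: Q_def)
  have pos: "positive_op (Q i)" for i
    by (induction i) (simp_all add: Q R schur_complement)
  have zero: "Q i (e k) = 0" if "k < i" for i k
    using that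
  proof (induction i)
    case (Suc i)
    then show ?case
      unfolding Q using schur_complement[OF pos] by (cases "k = i") auto
  qed simp
  \<comment> \<open>If the form of \<open>Q i\<close> vanishes at \<open>e i\<close>, then 1 / sqrt
    0 = 0 gives \<open>\<psi> i = 0\<close>, in agreement with the division by 0 in
    \<open>schur_complement\<close>.\<close>
  define \<psi> where "\<psi> = (\<lambda>i. complex_of_real (1 / sqrt (Re (fock_cinner (e i) (Q i (e i))))) *\<^sub>C Q i (e i))"
  have \<psi>: "fock_cinner (\<psi> i) f *\<^sub>C \<psi> i = (fock_cinner (e i) (Q i f) / fock_cinner (e i) (Q i (e i))) *\<^sub>C Q i (e i)" for i f
  proof -
    define \<beta> where "\<beta> = Re (fock_cinner (e i) (Q i (e i)))"
    have \<beta>: "fock_cinner (e i) (Q i (e i)) = complex_of_real \<beta>" "0 \<le> \<beta>"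
      using positive_op_form[OF pos] by (simp_all add: \<beta>_def complex_eq_iff)
    define s where "s = complex_of_real (1 / sqrt \<beta>)"
    have s: "cnj s * a * s = a / complex_of_real \<beta>" for a
    proof -
      have "s * s = 1 / complex_of_real \<beta>"
        using \<beta>(2) unfolding s_def by (simp flip: of_real_mult)
      then show ?thesis
        by (simp add: s_def mult_ac)
    qed
    have "\<psi> i = s *\<^sub>C Q i (e i)"
      by (simp add: \<psi>_def s_def \<beta>_def)
    then show ?thesis
      unfolding \<beta>(1) positive_op_hermitian(2)[OF pos[of i], of "e i" f] by (simp only: cinner_scale_left fock_scale_laws s)
  qed
  have "R f = Q N f + (\<Sum>i<N. fock_cinner (\<psi> i) f *\<^sub>C \<psi> i)" for f N
    by (induction N) (simp_all add: Q \<psi> schur_complement_def)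
  from this[where N = "Suc k" and f = "e k" for k]
  have "R (e k) = (\<Sum>i\<le>k. fock_cinner (\<psi> i) (e k) *\<^sub>C \<psi> i)" for k
    by (simp only: zero[OF lessI] lessThan_Suc_atMost add_0_left)
  moreover have "fock_cinner (\<psi> i) (e k) = 0" if "k < i" for i k
    unfolding \<psi>_def cinner_bilinear positive_op_hermitian(2)[OF pos, symmetric] zero[OF that] by simp
  ultimately show ?thesis
    by (rule that)
qed

section \<open>Representation of a state by a sequence of vectors\<close>

lemma multiset_enumeration:
  obtains \<pi> :: "nat \<Rightarrow> 'n::finite multiset" where "bij \<pi>"
proof -
  have "range mset = (UNIV :: 'n multiset set)"
    using ex_mset by (metis surjI)
  then have "countable (UNIV :: 'n multiset set)"
    by (metis countableI_type countable_image)
  moreover have "infinite (UNIV :: 'n multiset set)"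
  proof
    assume "finite (UNIV :: 'n multiset set)"
    then have "finite (range (\<lambda>k. replicate_mset k (undefined :: 'n)))"
      by (rule rev_finite_subset) simp
    moreover have "inj (\<lambda>k. replicate_mset k (undefined :: 'n))"
      by (metis injI size_replicate_mset)
    ultimately show False
      using finite_imageD infinite_UNIV_nat by blast
  qed
  ultimately show ?thesis
    using that bij_betw_from_nat_into by blast
qed

lemma parseval_norm:
  "((\<lambda>A. (cmod (fock_cinner (number_vec A) f))\<^sup>2) has_sum (norm f)\<^sup>2) UNIV"
proof -
  have "fock_cinner f (number_vec A) * fock_cinner (number_vec A) f = complex_of_real ((cmod (fock_cinner (number_vec A) f))\<^sup>2)" for A
    unfolding cinner_commute[of f "number_vec A"] complex_norm_square by (rule mult.commute)
  then have "((\<lambda>A. complex_of_real ((cmod (fock_cinner (number_vec A) f))\<^sup>2)) has_sum complex_of_real ((norm f)\<^sup>2)) UNIV"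
    using parseval_number_vec[of f f] by (simp add: cinner_self)
  from has_sum_Re[OF this] show ?thesis
    by simp
qed

lemma state_positive_op: "state \<rho> \<Longrightarrow> positive_op \<rho>"
  unfolding state_def positive_op_def using bounded_clinearD(2,3) by blast

lemma square_summable_pairs:
  fixes e :: "nat \<Rightarrow> 'n::finite fock" and \<phi> :: "nat \<Rightarrow> 'n fock"
  assumes e: "\<And>f. ((\<lambda>k. (cmod (fock_cinner (e k) f))\<^sup>2) has_sum (norm f)\<^sup>2) UNIV"
    and \<phi>: "(\<lambda>i. (norm (\<phi> i))\<^sup>2) summable_on UNIV"
  shows "(\<lambda>(i, k). (cmod (fock_cinner (e k) (\<phi> i)))\<^sup>2) summable_on UNIV \<times> UNIV"
  by (rule summable_on_SigmaI[where g = "\<lambda>i. (norm (\<phi> i))\<^sup>2"]) (use e \<phi> in auto)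

text \<open>The squared moduli of <e_k, psi_i> sum to the trace of rho in one order and to the
  squared norms of the psi_i in the other. For the trace formula, the adjoint \<open>T'\<close>
  moves the operator to psi_i: then Parseval handles the sum over k, and the finite expansion of rho
  the sum over i.\<close>

lemma state_decomposition:
  fixes \<rho> :: "'n::finite fock \<Rightarrow> 'n fock"
  assumes \<rho>: "state \<rho>"
  obtains \<psi> :: "nat \<Rightarrow> 'n fock" where "((\<lambda>i. (norm (\<psi> i))\<^sup>2) has_sum 1) UNIV"
    "\<And>T T'. (\<And>f g. fock_cinner f (T g) = fock_cinner (T' f) g) \<Longrightarrow> (\<And>f. norm (T' f) \<le> norm f) \<Longrightarrow>
      ((\<lambda>i. fock_cinner (\<psi> i) (T (\<psi> i))) has_sum op_trace (\<rho> \<circ> T)) UNIV"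
proof -
  note pos = state_positive_op[OF \<rho>]
  obtain \<pi> :: "nat \<Rightarrow> 'n multiset" where \<pi>: "bij \<pi>"
    by (rule multiset_enumeration)
  define e where "e = number_vec \<circ> \<pi>"
  have parseval: "((\<lambda>k. fock_cinner f (e k) * fock_cinner (e k) g) has_sum fock_cinner f g) UNIV" for f g
    using parseval_number_vec[of f g] has_sum_reindex_bij_betw[OF \<pi>, of "\<lambda>A. fock_cinner f (number_vec A) * fock_cinner (number_vec A) g"]
    by (simp add: e_def)
  have pnorm: "((\<lambda>k. (cmod (fock_cinner (e k) f))\<^sup>2) has_sum (norm f)\<^sup>2) UNIV" for f
    using parseval_norm[of f] has_sum_reindex_bij_betw[OF \<pi>, of "\<lambda>A. (cmod (fock_cinner (number_vec A) f))\<^sup>2"]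
    by (simp add: e_def)
  have trace: "op_trace T = (\<Sum>\<^sub>\<infinity>k. fock_cinner (e k) (T (e k)))" for T
    unfolding op_trace_def e_def o_def
    by (rule infsum_reindex_bij_betw[OF \<pi>, symmetric])
  obtain \<psi> where \<psi>: "\<And>k. \<rho> (e k) = (\<Sum>i\<le>k. fock_cinner (\<psi> i) (e k) *\<^sub>C \<psi> i)"
    "\<And>i k. k < i \<Longrightarrow> fock_cinner (\<psi> i) (e k) = 0"
    using cholesky_decomposition[OF pos, of e] by blast
  have row: "((\<lambda>i. fock_cinner (e k) (\<psi> i) * fock_cinner (\<psi> i) f) has_sum fock_cinner (e k) (\<rho> f)) UNIV" for k f
  proof -
    have "((\<lambda>i. fock_cinner (e k) (\<psi> i) * fock_cinner (\<psi> i) f) has_sum (\<Sum>i\<le>k. fock_cinner (e k) (\<psi> i) * fock_cinner (\<psi> i) f)) {..k}"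
      by (rule has_sum_finite) simp
    also have "(\<Sum>i\<le>k. fock_cinner (e k) (\<psi> i) * fock_cinner (\<psi> i) f) = fock_cinner (e k) (\<rho> f)"
      unfolding positive_op_hermitian(2)[OF pos] \<psi>(1) cinner_sum_left cinner_scale_left
      by (simp flip: cinner_commute)
    finally have fin: "((\<lambda>i. fock_cinner (e k) (\<psi> i) * fock_cinner (\<psi> i) f) has_sum fock_cinner (e k) (\<rho> f)) {..k}" .
    have "fock_cinner (e k) (\<psi> i) = 0" if "\<not> i \<le> k" for i
      using \<psi>(2)[of k i] that cinner_commute[of "e k" "\<psi> i"] by simp
    then show ?thesis
      using has_sum_cong_neutral[of "{..k}" UNIV "\<lambda>i. fock_cinner (e k) (\<psi> i) * fock_cinner (\<psi> i) f"
          "\<lambda>i. fock_cinner (e k) (\<psi> i) * fock_cinner (\<psi> i) f"] fin by auto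
  qed
  have row_norm: "((\<lambda>i. (cmod (fock_cinner (e k) (\<psi> i)))\<^sup>2) has_sum Re (fock_cinner (e k) (\<rho> (e k)))) UNIV" for k
  proof -
    have "Re (fock_cinner (e k) (\<psi> i) * fock_cinner (\<psi> i) (e k)) = (cmod (fock_cinner (e k) (\<psi> i)))\<^sup>2" for i
      unfolding cinner_commute[of "\<psi> i" "e k"] by (simp flip: complex_norm_square)
    then show ?thesis
      using has_sum_Re[OF row[of k "e k"]] by simp
  qed
  have tr: "(\<Sum>\<^sub>\<infinity>k. fock_cinner (e k) (\<rho> (e k))) = 1"
    using \<rho> by (simp add: state_def trace)
  \<comment> \<open>A divergent infinite sum has the value 0 by convention, so the value 1 of the
    trace entails convergence.\<close>
  then have "(\<lambda>k. fock_cinner (e k) (\<rho> (e k))) summable_on UNIV"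
    by (metis infsum_not_exists zero_neq_one)
  from has_sum_Re[OF has_sum_infsum[OF this]]
  have tr1: "((\<lambda>k. Re (fock_cinner (e k) (\<rho> (e k)))) has_sum 1) UNIV"
    by (simp add: tr)
  have "(\<lambda>(k, i). (cmod (fock_cinner (e k) (\<psi> i)))\<^sup>2) summable_on UNIV \<times> UNIV"
    by (rule summable_on_SigmaI[where g = "\<lambda>k. Re (fock_cinner (e k) (\<rho> (e k)))"])
      (use row_norm tr1 in \<open>auto simp: summable_on_def\<close>)
  then obtain s where s: "((\<lambda>(k, i). (cmod (fock_cinner (e k) (\<psi> i)))\<^sup>2) has_sum s) (UNIV \<times> UNIV)"
    unfolding summable_on_def by blast
  have "((\<lambda>k. Re (fock_cinner (e k) (\<rho> (e k)))) has_sum s) UNIV"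
    by (rule has_sum_SigmaD[OF s]) (simp add: row_norm)
  then have "s = 1"
    using tr1 has_sum_unique by blast
  have "((\<lambda>(i, k). (cmod (fock_cinner (e k) (\<psi> i)))\<^sup>2) has_sum 1) (UNIV \<times> UNIV)"
    using s unfolding \<open>s = 1\<close> by (subst (asm) has_sum_swap) (simp add: case_prod_unfold)
  then have norm_\<psi>: "((\<lambda>i. (norm (\<psi> i))\<^sup>2) has_sum 1) UNIV"
    by (rule has_sum_SigmaD) (simp add: pnorm)
  have "((\<lambda>i. fock_cinner (\<psi> i) (T (\<psi> i))) has_sum op_trace (\<rho> \<circ> T)) UNIV"
    if adj: "\<And>f g. fock_cinner f (T g) = fock_cinner (T' f) g" and contr: "\<And>f. norm (T' f) \<le> norm f" for T T'
  proof -
    have le: "x * y \<le> x\<^sup>2 + y\<^sup>2" if "0 \<le> x" "0 \<le> y" for x y :: real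
      using sum_squares_bound[of x y] mult_nonneg_nonneg[OF that] by linarith
    define F where "F = (\<lambda>(i, k). fock_cinner (T' (\<psi> i)) (e k) * fock_cinner (e k) (\<psi> i))"
    have "(\<lambda>i. (norm (\<psi> i))\<^sup>2) summable_on UNIV"
      using norm_\<psi> summable_on_def by blast
    moreover from this have "(\<lambda>i. (norm (T' (\<psi> i)))\<^sup>2) summable_on UNIV"
      by (rule summable_on_comparison_test) (simp_all add: contr power_mono)
    \<comment> \<open>Absolute summability of \<open>F\<close>: the product of two moduli is at most
      the sum of their squares, and both families of squares are summable over all pairs.\<close>
    ultimately have "(\<lambda>p. (case p of (i, k) \<Rightarrow> (cmod (fock_cinner (e k) (T' (\<psi> i))))\<^sup>2)
        + (case p of (i, k) \<Rightarrow> (cmod (fock_cinner (e k) (\<psi> i)))\<^sup>2)) summable_on UNIV \<times> UNIV"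
      by (intro summable_on_add square_summable_pairs pnorm)
    then have "(\<lambda>p. norm (F p)) summable_on UNIV \<times> UNIV"
    proof (rule summable_on_comparison_test)
      fix p :: "nat \<times> nat"
      obtain i k where p: "p = (i, k)"
        by (cases p)
      have "cmod (fock_cinner (T' (\<psi> i)) (e k)) = cmod (fock_cinner (e k) (T' (\<psi> i)))"
        by (subst cinner_commute) simp
      then show "norm (F p) \<le> (case p of (i, k) \<Rightarrow> (cmod (fock_cinner (e k) (T' (\<psi> i))))\<^sup>2)
        + (case p of (i, k) \<Rightarrow> (cmod (fock_cinner (e k) (\<psi> i)))\<^sup>2)"
        using le[of "cmod (fock_cinner (e k) (T' (\<psi> i)))" "cmod (fock_cinner (e k) (\<psi> i))"]
        by (simp add: F_def p norm_mult)
    qed auto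
    then have "F summable_on UNIV \<times> UNIV"
      by (rule abs_summable_summable)
    then obtain t where t: "(F has_sum t) (UNIV \<times> UNIV)"
      unfolding summable_on_def by blast
    have "((\<lambda>i. fock_cinner (T' (\<psi> i)) (\<psi> i)) has_sum t) UNIV"
      by (rule has_sum_SigmaD[OF t]) (simp add: F_def parseval)
    moreover have "((\<lambda>(k, i). F (i, k)) has_sum t) (UNIV \<times> UNIV)"
      using t by (subst (asm) has_sum_swap)
    then have "((\<lambda>k. fock_cinner (e k) (\<rho> (T (e k)))) has_sum t) UNIV"
    proof (rule has_sum_SigmaD)
      fix k
      show "((\<lambda>i. case (k, i) of (k, i) \<Rightarrow> F (i, k)) has_sum fock_cinner (e k) (\<rho> (T (e k)))) UNIV"
        using row[of k "T (e k)"] by (simp add: F_def adj mult.commute)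
    qed
    then have "op_trace (\<rho> \<circ> T) = t"
      by (simp add: trace infsumI)
    ultimately show ?thesis
      by (simp add: adj)
  qed
  then show ?thesis
    using that norm_\<psi> by blast
qed

lemma ennreal_suminf_swap:
  fixes f :: "nat \<Rightarrow> nat \<Rightarrow> ennreal"
  shows "(\<Sum>i. \<Sum>k. f i k) = (\<Sum>k. \<Sum>i. f i k)"
  using nn_integral_suminf[of "\<lambda>k i. f i k" "count_space UNIV"] by (simp add: nn_integral_count_space_nat)

text \<open>\<open>p k i\<close> is the weight of \<open>k\<close> particles in the vector V psi_i.
  Nonnegativity permits exchanging the sums over particle numbers and over vectors even if the
  expectation is infinite.\<close>

lemma expectation_number_form:
  fixes \<rho> :: "'n::finite fock \<Rightarrow> 'n fock"
  assumes V: "unitary V"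
    and \<psi>: "((\<lambda>i. (norm (\<psi> i))\<^sup>2) has_sum 1) UNIV"
      "\<And>T T'. (\<And>f g. fock_cinner f (T g) = fock_cinner (T' f) g) \<Longrightarrow> (\<And>f. norm (T' f) \<le> norm f) \<Longrightarrow>
      ((\<lambda>i. fock_cinner (\<psi> i) (T (\<psi> i))) has_sum op_trace (\<rho> \<circ> T)) UNIV"
  shows "4 * expectation_number \<rho> V + of_nat (2 * CARD('n)) = (\<Sum>i. number_form (V (\<psi> i)))"
proof -
  define p where "p = (\<lambda>k i. (norm (particle_proj k (V (\<psi> i))))\<^sup>2)"
  have proj_le: "norm (particle_proj k f) \<le> norm f" for k and f :: "'n fock"
    by (rule norm_fock_leI) (simp add: particle_proj.rep_eq)
  have tr: "ennreal (Re (op_trace (\<rho> \<circ> cadjoint V \<circ> particle_proj k \<circ> V))) = (\<Sum>i. ennreal (p k i))" for k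
  proof -
    let ?T = "inv V \<circ> particle_proj k \<circ> V"
    have "((\<lambda>i. fock_cinner (\<psi> i) (?T (\<psi> i))) has_sum op_trace (\<rho> \<circ> ?T)) UNIV"
    proof (rule \<psi>(2)[where T' = ?T])
      show "fock_cinner f (?T g) = fock_cinner (?T f) g" for f g
        by (simp add: unitaryD(7,8)[OF V, symmetric] cinner_particle_proj)
      show "norm (?T f) \<le> norm f" for f
        using proj_le[of k "V f"] by (simp add: unitaryD(3)[OF unitary_inv[OF V]] unitaryD(3)[OF V])
    qed
    moreover have "fock_cinner (\<psi> i) (?T (\<psi> i)) = complex_of_real (p k i)" for i
      unfolding p_def by (simp add: unitaryD(8)[OF V, symmetric] cinner_self_particle_proj)
    ultimately have "((\<lambda>i. complex_of_real (p k i)) has_sum op_trace (\<rho> \<circ> ?T)) UNIV"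
      by simp
    from has_sum_Re[OF this] have "p k sums Re (op_trace (\<rho> \<circ> ?T))"
      by (simp add: has_sum_imp_sums)
    then have "(\<Sum>i. ennreal (p k i)) = ennreal (Re (op_trace (\<rho> \<circ> ?T)))"
      by (rule suminf_ennreal_eq[rotated]) (simp add: p_def)
    then show ?thesis
      by (simp add: cadjoint_unitary[OF V] o_assoc)
  qed
  \<comment> \<open>The weights form a probability distribution, so the constant 2 n of the form
    contributes exactly 2 n.\<close>
  have total: "(\<Sum>k. \<Sum>i. ennreal (p k i)) = 1"
  proof -
    have "(\<Sum>k. ennreal (p k i)) = ennreal ((norm (\<psi> i))\<^sup>2)" for i
      using particle_norm_sums[of "V (\<psi> i)"] unfolding p_def unitaryD(3)[OF V] by (intro suminf_ennreal_eq) auto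
    moreover have "(\<Sum>i. ennreal ((norm (\<psi> i))\<^sup>2)) = ennreal 1"
      using has_sum_imp_sums[OF \<psi>(1)] by (intro suminf_ennreal_eq) auto
    ultimately show ?thesis
      by (subst ennreal_suminf_swap) simp
  qed
  have "(\<Sum>i. number_form (V (\<psi> i))) = (\<Sum>k. \<Sum>i. ennreal ((4 * real k + 2 * real CARD('n)) * p k i))"
    unfolding number_form_def p_def by (rule ennreal_suminf_swap)
  also have "\<dots> = (\<Sum>k. (4 * of_nat k + of_nat (2 * CARD('n))) * (\<Sum>i. ennreal (p k i)))"
  proof -
    have "ennreal (4 * real k + 2 * real CARD('n)) = 4 * of_nat k + of_nat (2 * CARD('n))" for k
      by (simp add: ennreal_plus ennreal_mult ennreal_of_nat_eq_real_of_nat)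
    then have "ennreal ((4 * real k + 2 * real CARD('n)) * p k i) = (4 * of_nat k + of_nat (2 * CARD('n))) * ennreal (p k i)" for k i
      by (simp add: ennreal_mult p_def)
    then show ?thesis
      by simp
  qed
  also have "\<dots> = (\<Sum>k. 4 * (of_nat k * (\<Sum>i. ennreal (p k i))) + of_nat (2 * CARD('n)) * (\<Sum>i. ennreal (p k i)))"
    by (simp add: distrib_right mult.assoc)
  also have "\<dots> = (\<Sum>k. 4 * (of_nat k * (\<Sum>i. ennreal (p k i)))) + (\<Sum>k. of_nat (2 * CARD('n)) * (\<Sum>i. ennreal (p k i)))"
    by (rule suminf_add[symmetric]) auto
  also have "\<dots> = 4 * expectation_number \<rho> V + of_nat (2 * CARD('n)) * (\<Sum>k. \<Sum>i. ennreal (p k i))"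
    unfolding expectation_number_def tr by (simp only: ennreal_suminf_cmult)
  finally show ?thesis
    by (simp add: total)
qed

section \<open>Expectations from the characteristic function\<close>

lemma has_sum_finite_sum:
  fixes f :: "'b \<Rightarrow> 'a \<Rightarrow> real"
  assumes "\<And>b. b \<in> B \<Longrightarrow> (f b has_sum s b) A"
  shows "((\<lambda>x. \<Sum>b\<in>B. f b x) has_sum (\<Sum>b\<in>B. s b)) A"
  using assms by (induction B rule: infinite_finite_induct) (auto intro: has_sum_add)

text \<open>Summed over the decomposition, the difference forms depend on the characteristic
  function alone. Monotone convergence lets the supremum in \<open>m\<close> pass through the sum,
  so the expectation is finite because the limit of \<open>D\<close> is.\<close>

lemma expectation_number_char:
  fixes \<rho> :: "'n::finite fock \<Rightarrow> 'n fock" and s c :: "'n + 'n \<Rightarrow> real"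
  assumes \<rho>: "state \<rho>" and V: "unitary V"
    and char: "\<And>b t. op_trace (\<rho> \<circ> (inv V \<circ> weyl (t *\<^sub>R unit_vec b) \<circ> V))
      = exp (- complex_of_real (t\<^sup>2) * complex_of_real (s b) - complex_of_real t * (\<i> * complex_of_real (c b)))"
  shows "4 * expectation_number \<rho> V + of_nat (2 * CARD('n)) = ennreal (\<Sum>b\<in>UNIV. 2 * s b + (c b)\<^sup>2)"
proof -
  obtain \<psi> :: "nat \<Rightarrow> 'n fock" where \<psi>: "((\<lambda>i. (norm (\<psi> i))\<^sup>2) has_sum 1) UNIV"
    "\<And>T T'. (\<And>f g. fock_cinner f (T g) = fock_cinner (T' f) g) \<Longrightarrow> (\<And>f. norm (T' f) \<le> norm f) \<Longrightarrow>
      ((\<lambda>i. fock_cinner (\<psi> i) (T (\<psi> i))) has_sum op_trace (\<rho> \<circ> T)) UNIV"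
    using state_decomposition[OF \<rho>] by blast
  define ch where "ch = (\<lambda>b t. exp (- complex_of_real (t\<^sup>2) * complex_of_real (s b) - complex_of_real t * (\<i> * complex_of_real (c b))))"
  have W: "((\<lambda>i. fock_cinner (V (\<psi> i)) (weyl (t *\<^sub>R unit_vec b) (V (\<psi> i)))) has_sum ch b t) UNIV" for b t
  proof -
    have "((\<lambda>i. fock_cinner (\<psi> i) ((inv V \<circ> weyl (t *\<^sub>R unit_vec b) \<circ> V) (\<psi> i)))
        has_sum op_trace (\<rho> \<circ> (inv V \<circ> weyl (t *\<^sub>R unit_vec b) \<circ> V))) UNIV"
    proof (rule \<psi>(2)[where T' = "inv V \<circ> weyl (- (t *\<^sub>R unit_vec b)) \<circ> V"])
      show "fock_cinner f ((inv V \<circ> weyl (t *\<^sub>R unit_vec b) \<circ> V) g)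
          = fock_cinner ((inv V \<circ> weyl (- (t *\<^sub>R unit_vec b)) \<circ> V) f) g" for f g
        by (simp add: unitaryD(7,8)[OF V, symmetric] cinner_weyl)
      show "norm ((inv V \<circ> weyl (- (t *\<^sub>R unit_vec b)) \<circ> V) f) \<le> norm f" for f
        by (simp add: unitaryD(3)[OF unitary_inv[OF V]] unitaryD(3)[OF V] unitaryD(3)[OF unitary_weyl])
    qed
    then show ?thesis
      unfolding char ch_def by (simp add: unitaryD(8)[OF V, symmetric])
  qed
  have has_sum_diff: "((\<lambda>i. f i - g i) has_sum a - b) UNIV" if "(f has_sum a) UNIV" "(g has_sum b) UNIV"
    for f g :: "nat \<Rightarrow> real" and a b
    using has_sum_add[OF that(1) has_sum_cmult_right[OF that(2), of "-1"]] by simp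
  define D where "D = (\<lambda>m. \<Sum>b\<in>UNIV. (2 - 2 * Re (ch b ((1/2) ^ m))) / ((1/2) ^ m)\<^sup>2)"
  have norm_diff: "(norm (weyl u f - f))\<^sup>2 = 2 * (norm f)\<^sup>2 - 2 * Re (fock_cinner f (weyl u f))" for u and f :: "'n fock"
  proof -
    have "Re (fock_cinner (weyl u f - f) (weyl u f - f)) = 2 * Re (fock_cinner f f) - 2 * Re (fock_cinner f (weyl u f))"
      using arg_cong[OF cinner_commute[of "weyl u f" f], of Re]
      by (simp add: cinner_bilinear cinner_weyl_weyl)
    then show ?thesis
      by (simp add: cinner_self)
  qed
  have D_sum: "((\<lambda>i. diff_form m (V (\<psi> i))) has_sum D m) UNIV" for m
  proof -
    have "((\<lambda>i. (2 * (norm (V (\<psi> i)))\<^sup>2 - 2 * Re (fock_cinner (V (\<psi> i)) (weyl (step m b) (V (\<psi> i))))) / ((1/2) ^ m)\<^sup>2)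
        has_sum ((2 * 1 - 2 * Re (ch b ((1/2) ^ m))) / ((1/2) ^ m)\<^sup>2)) UNIV" for b
      unfolding divide_inverse unitaryD(3)[OF V]
      by (intro has_sum_cmult_left has_sum_diff has_sum_cmult_right \<psi>(1) has_sum_Re W)
    then show ?thesis
      unfolding diff_form_def D_def norm_diff by (intro has_sum_finite_sum) simp_all
  qed
  have D_lim: "D \<longlonglongrightarrow> (\<Sum>b\<in>UNIV. 2 * s b + (c b)\<^sup>2)"
    unfolding D_def
  proof (intro tendsto_sum)
    fix b
    let ?c = "\<i> * complex_of_real (c b)" and ?s = "complex_of_real (s b)"
    \<comment> \<open>The two exponentials are complex conjugates, so the second difference at 0 is
      -(2 - 2 Re ch). With the imaginary c its limit is -(c b)^2 - 2 s b.\<close>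
    have eq: "(exp (- of_real (t\<^sup>2) * ?s + of_real t * ?c) + exp (- of_real (t\<^sup>2) * ?s - of_real t * ?c) - 2) / of_real (t\<^sup>2)
        = complex_of_real (- ((2 - 2 * Re (ch b t)) / t\<^sup>2))" for t :: real
    proof -
      have "exp (- of_real (t\<^sup>2) * ?s + of_real t * ?c) = cnj (ch b t)"
        by (simp add: ch_def exp_cnj)
      moreover have "exp (- of_real (t\<^sup>2) * ?s - of_real t * ?c) = ch b t"
        by (simp add: ch_def)
      moreover have "cnj (ch b t) + ch b t = complex_of_real (2 * Re (ch b t))"
        using complex_add_cnj[of "ch b t"] by (simp add: add.commute)
      ultimately show ?thesis
        by (simp add: minus_divide_left)
    qed
    from tendsto_minus[OF tendsto_Re[OF second_difference_limit[of ?s ?c, unfolded eq]]]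
    show "(\<lambda>m. (2 - 2 * Re (ch b ((1/2) ^ m))) / ((1/2) ^ m)\<^sup>2) \<longlonglongrightarrow> 2 * s b + (c b)\<^sup>2"
      by (simp add: power_mult_distrib)
  qed
  have D_mono: "incseq D"
    by (intro incseq_SucI has_sum_mono[OF D_sum D_sum]) (simp add: diff_form_Suc)
  have "4 * expectation_number \<rho> V + of_nat (2 * CARD('n)) = (\<Sum>i. number_form (V (\<psi> i)))"
    by (rule expectation_number_form[OF V \<psi>])
  also have "\<dots> = (\<Sum>i. SUP m. ennreal (diff_form m (V (\<psi> i))))"
    by (simp only: SUP_diff_form)
  also have "\<dots> = (SUP m. \<Sum>i. ennreal (diff_form m (V (\<psi> i))))"
    by (rule ennreal_suminf_SUP_eq) (auto intro!: incseq_SucI ennreal_leI diff_form_Suc)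
  also have "\<dots> = (SUP m. ennreal (D m))"
    using has_sum_imp_sums[OF D_sum] by (intro SUP_cong refl suminf_ennreal_eq diff_form_nonneg)
  also have "\<dots> = ennreal (\<Sum>b\<in>UNIV. 2 * s b + (c b)\<^sup>2)"
  proof (rule LIMSEQ_unique)
    show "(\<lambda>m. ennreal (D m)) \<longlonglongrightarrow> (SUP m. ennreal (D m))"
      using D_mono by (intro LIMSEQ_SUP) (auto simp: incseq_def ennreal_leI)
    show "(\<lambda>m. ennreal (D m)) \<longlonglongrightarrow> ennreal (\<Sum>b\<in>UNIV. 2 * s b + (c b)\<^sup>2)"
      by (intro tendsto_ennrealI D_lim)
  qed
  finally show ?thesis .
qed

section \<open>Gaussian characteristic functions\<close>

definition cvec :: "real^('n::finite + 'n) \<Rightarrow> complex^'n"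
  where "cvec r = (\<chi> j. Complex (r $ Inl j) (r $ Inr j))"

lemma cvec_join: "cvec (join x y) = cplx x y"
  by (simp add: cvec_def join_def cplx_def)

lemma join_surj: obtains x y where "r = join x y"
proof
  show "r = join (\<chi> j. r $ Inl j) (\<chi> j. r $ Inr j)"
    by (simp add: vec_eq_iff join_def split: sum.split)
qed

lemma cvec_axis: "cvec (t *\<^sub>R axis b 1) = t *\<^sub>R unit_vec b"
  by (cases b) (auto simp: cvec_def unit_vec_def vec_eq_iff axis_def complex_eq_iff)

text \<open>The characteristic function of V rho V^{-1}, in which N has the expectation that V^{-1}
  N V has in rho. A gate thus acts on the parameters \<open>k\<close> and \<open>S\<close>
  only.\<close>

definition char_gaussian ::
    "('n::finite fock \<Rightarrow> 'n fock) \<Rightarrow> ('n fock \<Rightarrow> 'n fock) \<Rightarrow> real^('n + 'n) \<Rightarrow> real^('n + 'n)^('n + 'n) \<Rightarrow> bool"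
  where "char_gaussian \<rho> V k S \<longleftrightarrow> (\<forall>r. op_trace (\<rho> \<circ> (inv V \<circ> weyl (cvec r) \<circ> V)) =
      exp (- \<i> * complex_of_real (sqrt 2 * (k \<bullet> r)) - complex_of_real (r \<bullet> (S *v r))))"

text \<open>In direction \<open>b\<close> the exponent is -t^2 S_bb - i t sqrt 2 k_b, which
  contributes 2 S_bb + 2 k_b^2.\<close>

lemma expectation_number_gaussian:
  fixes \<rho> :: "'n::finite fock \<Rightarrow> 'n fock"
  assumes \<rho>: "state \<rho>" and V: "unitary V" and char: "char_gaussian \<rho> V k S"
  shows "4 * expectation_number \<rho> V + of_nat (2 * CARD('n)) = ennreal (2 * ((\<Sum>b\<in>UNIV. S $ b $ b) + k \<bullet> k))"
proof -
  have "4 * expectation_number \<rho> V + of_nat (2 * CARD('n)) = ennreal (\<Sum>b\<in>UNIV. 2 * S $ b $ b + (sqrt 2 * k $ b)\<^sup>2)"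
  proof (rule expectation_number_char[OF \<rho> V])
    fix b :: "'n + 'n" and t :: real
    have 1: "k \<bullet> (t *\<^sub>R axis b 1) = t * k $ b"
      by (simp add: inner_axis)
    have 2: "(t *\<^sub>R axis b 1) \<bullet> (S *v (t *\<^sub>R axis b 1)) = t\<^sup>2 * S $ b $ b"
      by (simp add: matrix_vector_mult_scaleR matrix_vector_mult_basis inner_axis' column_def power2_eq_square)
    have "op_trace (\<rho> \<circ> (inv V \<circ> weyl (t *\<^sub>R unit_vec b) \<circ> V))
        = exp (- \<i> * complex_of_real (sqrt 2 * (t * k $ b)) - complex_of_real (t\<^sup>2 * S $ b $ b))"
      using char[unfolded char_gaussian_def, rule_format, of "t *\<^sub>R axis b 1"] unfolding cvec_axis 1 2 .
    also have "\<dots> = exp (- complex_of_real (t\<^sup>2) * complex_of_real (S $ b $ b) - complex_of_real t * (\<i> * complex_of_real (sqrt 2 * k $ b)))"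
      by (rule arg_cong[of _ _ exp]) (simp add: algebra_simps)
    finally show "op_trace (\<rho> \<circ> (inv V \<circ> weyl (t *\<^sub>R unit_vec b) \<circ> V)) = \<dots>" .
  qed
  also have "(\<Sum>b\<in>UNIV. 2 * S $ b $ b + (sqrt 2 * k $ b)\<^sup>2) = (\<Sum>b\<in>UNIV. 2 * S $ b $ b + 2 * (k $ b * k $ b))"
    by (intro sum.cong refl) (simp add: power_mult_distrib power2_eq_square[of "k $ _"])
  also have "\<dots> = 2 * ((\<Sum>b\<in>UNIV. S $ b $ b) + k \<bullet> k)"
    by (simp add: inner_vec_def sum.distrib sum_distrib_left)
  finally show ?thesis .
qed

section \<open>Symplectic gates\<close>

lemma embed_coords_sum:
  assumes c: "inj c"
  shows "(\<Sum>r\<in>UNIV. embed_coords c A $ r $ c a * f r) = (\<Sum>a'\<in>UNIV. A $ a' $ a * f (c a'))"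
    "(\<Sum>r\<in>UNIV. embed_coords c A $ c a $ r * f r) = (\<Sum>a'\<in>UNIV. A $ a $ a' * f (c a'))"
    "p \<notin> range c \<Longrightarrow> (\<Sum>r\<in>UNIV. embed_coords c A $ r $ p * f r) = f p"
    "p \<notin> range c \<Longrightarrow> (\<Sum>r\<in>UNIV. embed_coords c A $ p $ r * f r) = f p"
proof -
  have "(\<Sum>r\<in>UNIV. embed_coords c A $ r $ c a * f r) = (\<Sum>r\<in>range c. embed_coords c A $ r $ c a * f r)"
    by (rule sum.mono_neutral_right) (auto simp: embed_coords_def)
  then show "(\<Sum>r\<in>UNIV. embed_coords c A $ r $ c a * f r) = (\<Sum>a'\<in>UNIV. A $ a' $ a * f (c a'))"
    by (simp add: sum.reindex[OF c] embed_coords_def inv_f_f[OF c])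
  have "(\<Sum>r\<in>UNIV. embed_coords c A $ c a $ r * f r) = (\<Sum>r\<in>range c. embed_coords c A $ c a $ r * f r)"
    by (rule sum.mono_neutral_right) (auto simp: embed_coords_def)
  then show "(\<Sum>r\<in>UNIV. embed_coords c A $ c a $ r * f r) = (\<Sum>a'\<in>UNIV. A $ a $ a' * f (c a'))"
    by (simp add: sum.reindex[OF c] embed_coords_def inv_f_f[OF c])
  assume p: "p \<notin> range c"
  have "(\<Sum>r\<in>UNIV. embed_coords c A $ r $ p * f r) = (\<Sum>r\<in>UNIV. if r = p then f r else 0)"
    by (rule sum.cong) (use p in \<open>auto simp: embed_coords_def\<close>)
  then show "(\<Sum>r\<in>UNIV. embed_coords c A $ r $ p * f r) = f p"
    by simp
  have "(\<Sum>r\<in>UNIV. embed_coords c A $ p $ r * f r) = (\<Sum>r\<in>UNIV. if r = p then f r else 0)"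
    by (rule sum.cong) (use p in \<open>auto simp: embed_coords_def\<close>)
  then show "(\<Sum>r\<in>UNIV. embed_coords c A $ p $ r * f r) = f p"
    by simp
qed

lemma embed_coords_nth:
  assumes "inj c"
  shows "embed_coords c A $ c a $ c b = A $ a $ b"
  by (simp add: embed_coords_def inv_f_f[OF assms])

lemma embed_coords_mult:
  assumes c: "inj c"
  shows "embed_coords c A ** embed_coords c B = embed_coords c (A ** B)"
proof -
  have "(embed_coords c A ** embed_coords c B) $ p $ q = embed_coords c (A ** B) $ p $ q" for p q
  proof (cases "p \<in> range c")
    case True
    then obtain a where p: "p = c a"
      by blast
    show ?thesis
    proof (cases "q \<in> range c")
      case True
      then obtain b where "q = c b"
        by blast
      then show ?thesis
        by (simp add: p matrix_matrix_mult_def embed_coords_sum(2)[OF c] embed_coords_nth[OF c])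
    next
      case False
      have "embed_coords c B $ c a' $ q = 0" "embed_coords c (A ** B) $ p $ q = 0" for a'
        using False by (auto simp: embed_coords_def p)
      then show ?thesis
        by (simp add: p matrix_matrix_mult_def embed_coords_sum(2)[OF c])
    qed
  next
    case False
    then show ?thesis
      by (simp add: matrix_matrix_mult_def embed_coords_sum(4)[OF c False]) (simp add: embed_coords_def)
  qed
  then show ?thesis
    by (simp add: vec_eq_iff)
qed

lemma embed_coords_one:
  assumes "inj c"
  shows "embed_coords c (mat 1) = mat 1"
  using assms by (auto simp: vec_eq_iff embed_coords_def mat_def inv_f_f)

lemma transpose_embed_coords: "transpose (embed_coords c A) = embed_coords c (transpose A)"
  by (auto simp: vec_eq_iff embed_coords_def transpose_def)

text \<open>\<open>symp_J\<close> does not couple the chosen coordinates to the others, so the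
  identity can be checked on the block of \<open>A\<close> and on the identity block
  separately.\<close>

lemma symplectic_embed_coords:
  fixes c :: "'k::finite \<Rightarrow> 'n::finite + 'n"
  assumes c: "inj c" and J: "\<And>a b. symp_J $ c a $ c b = J $ a $ b"
    and J0: "\<And>a q. q \<notin> range c \<Longrightarrow> symp_J $ c a $ q = 0" "\<And>p b. p \<notin> range c \<Longrightarrow> symp_J $ p $ c b = 0"
    and A: "transpose A ** J ** A = J"
  shows "symplectic (embed_coords c A)"
proof -
  let ?E = "embed_coords c A"
  have entry: "(transpose ?E ** symp_J ** ?E) $ p $ q = (\<Sum>s\<in>UNIV. ?E $ s $ q * (\<Sum>r\<in>UNIV. ?E $ r $ p * symp_J $ r $ s))" for p q
    by (simp add: matrix_matrix_mult_def transpose_def mult.commute)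
  have "(transpose ?E ** symp_J ** ?E) $ p $ q = symp_J $ p $ q" for p q
  proof (cases "p \<in> range c")
    case True
    then obtain a where p: "p = c a"
      by blast
    show ?thesis
    proof (cases "q \<in> range c")
      case True
      then obtain b where q: "q = c b"
        by blast
      have "(transpose ?E ** symp_J ** ?E) $ p $ q = (transpose A ** J ** A) $ a $ b"
        unfolding entry p q embed_coords_sum(1)[OF c] J
        by (simp add: matrix_matrix_mult_def transpose_def mult.commute)
      then show ?thesis
        by (simp add: A p q J)
    next
      case False
      then show ?thesis
        unfolding entry p embed_coords_sum(1)[OF c] embed_coords_sum(3)[OF c False] by (simp add: J0)
    qed
  next
    case p: False
    show ?thesis
    proof (cases "q \<in> range c")
      case True
      then obtain b where q: "q = c b"
        by blast
      show ?thesis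
        unfolding entry q embed_coords_sum(1)[OF c] embed_coords_sum(3)[OF c p] using p by (simp add: J0)
    next
      case False
      then show ?thesis
        unfolding entry embed_coords_sum(3)[OF c p] embed_coords_sum(3)[OF c False] by simp
    qed
  qed
  then show ?thesis
    by (simp add: symplectic_def vec_eq_iff)
qed

text \<open>The trace of E S E^T is that of E^T E S, and E^T E differs from the identity only on the
  chosen coordinates, where it is B^T B.\<close>

lemma trace_embed_coords:
  fixes S :: "real^'m::finite^'m"
  assumes c: "inj c"
  shows "(\<Sum>p\<in>UNIV. (embed_coords c B ** S ** transpose (embed_coords c B)) $ p $ p)
    = (\<Sum>p\<in>UNIV. S $ p $ p) + (\<Sum>a\<in>UNIV. \<Sum>b\<in>UNIV. ((transpose B ** B) $ a $ b - mat 1 $ a $ b) * S $ c a $ c b)"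
proof -
  let ?E = "embed_coords c B"
  have "(\<Sum>p\<in>UNIV. (?E ** S ** transpose ?E) $ p $ p)
      = (\<Sum>p\<in>UNIV. \<Sum>s\<in>UNIV. \<Sum>r\<in>UNIV. ?E $ p $ r * S $ r $ s * ?E $ p $ s)"
    by (simp add: matrix_matrix_mult_def transpose_def sum_distrib_right)
  also have "\<dots> = (\<Sum>s\<in>UNIV. \<Sum>r\<in>UNIV. \<Sum>p\<in>UNIV. ?E $ p $ r * S $ r $ s * ?E $ p $ s)"
    by (subst sum.swap) (intro sum.cong refl sum.swap)
  also have "\<dots> = (\<Sum>s\<in>UNIV. \<Sum>r\<in>UNIV. (transpose ?E ** ?E) $ s $ r * S $ r $ s)"
    by (intro sum.cong refl) (simp add: matrix_matrix_mult_def transpose_def sum_distrib_left sum_distrib_right mult_ac)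
  also have "transpose ?E ** ?E = embed_coords c (transpose B ** B)"
    by (simp add: transpose_embed_coords embed_coords_mult[OF c])
  also have "(\<Sum>s\<in>UNIV. \<Sum>r\<in>UNIV. embed_coords c (transpose B ** B) $ s $ r * S $ r $ s)
      = (\<Sum>s\<in>UNIV. S $ s $ s + (\<Sum>r\<in>UNIV. (embed_coords c (transpose B ** B) $ s $ r - mat 1 $ s $ r) * S $ r $ s))"
    by (intro sum.cong refl) (simp add: left_diff_distrib sum_subtractf mat_def if_distrib[of "\<lambda>x. x * _"] cong: if_cong)
  also have "\<dots> = (\<Sum>s\<in>UNIV. S $ s $ s) + (\<Sum>s\<in>UNIV. \<Sum>r\<in>UNIV. (embed_coords c (transpose B ** B) $ s $ r - mat 1 $ s $ r) * S $ r $ s)"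
    by (rule sum.distrib)
  also have "(\<Sum>s\<in>UNIV. \<Sum>r\<in>UNIV. (embed_coords c (transpose B ** B) $ s $ r - mat 1 $ s $ r) * S $ r $ s)
      = (\<Sum>s\<in>range c. \<Sum>r\<in>range c. (embed_coords c (transpose B ** B) $ s $ r - mat 1 $ s $ r) * S $ r $ s)"
  proof -
    have "(\<Sum>r\<in>UNIV. (embed_coords c (transpose B ** B) $ s $ r - mat 1 $ s $ r) * S $ r $ s)
        = (if s \<in> range c then \<Sum>r\<in>range c. (embed_coords c (transpose B ** B) $ s $ r - mat 1 $ s $ r) * S $ r $ s else 0)" for s
    proof (cases "s \<in> range c")
      case True
      show ?thesis
        unfolding if_P[OF True] by (rule sum.mono_neutral_right) (use True in \<open>auto simp: embed_coords_def mat_def\<close>)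
    next
      case False
      then show ?thesis
        by (auto simp: embed_coords_def mat_def intro!: sum.neutral)
    qed
    then show ?thesis
      by (simp add: sum.If_cases)
  qed
  also have "\<dots> = (\<Sum>a\<in>UNIV. \<Sum>b\<in>UNIV. ((transpose B ** B) $ a $ b - mat 1 $ a $ b) * S $ c b $ c a)"
    by (simp add: sum.reindex[OF c] embed_coords_nth[OF c] mat_def inj_eq[OF c])
  also have "\<dots> = (\<Sum>a\<in>UNIV. \<Sum>b\<in>UNIV. ((transpose B ** B) $ a $ b - mat 1 $ a $ b) * S $ c a $ c b)"
    by (subst sum.swap) (intro sum.cong refl, simp add: matrix_matrix_mult_def transpose_def mat_def mult.commute)
  finally show ?thesis .
qed

section \<open>Squeezing matrices of the form U D U^T\<close>

lemma matrix_inv_eqI: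
  fixes A B :: "real^'m::finite^'m"
  assumes "A ** B = mat 1" "B ** A = mat 1"
  shows "matrix_inv A = B"
proof -
  have "A ** matrix_inv A = mat 1 \<and> matrix_inv A ** A = mat 1"
    unfolding matrix_inv_def by (rule someI[of _ B]) (use assms in simp)
  then show ?thesis
    by (metis assms(2) matrix_mul_assoc matrix_mul_lid matrix_mul_rid)
qed

text \<open>Common to both kinds of gates: with U orthogonal and symplectic and D' the inverse of D,
  \<open>L\<close> is symmetric and \<open>tau L\<close> is U D' U^T.\<close>

lemma gate_matrix:
  fixes U D D' J :: "real^'m::finite^'m"
  defines "L \<equiv> U ** D ** transpose U"
  assumes U: "transpose U ** U = mat 1" "transpose U ** J ** U = J"
    and D: "D ** D' = mat 1" "transpose D = D" "transpose D' = D'" "D' ** J ** D' = J"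
  shows "tau L ** transpose L = mat 1" "transpose L ** tau L = mat 1"
    "transpose (tau L) ** J ** tau L = J" "transpose L ** L = U ** (D ** D) ** transpose U"
proof -
  have U': "U ** transpose U = mat 1"
    using U(1) by (simp add: matrix_left_right_inverse)
  have D': "D' ** D = mat 1"
    using D(1) by (simp add: matrix_left_right_inverse)
  have conj: "(U ** A ** transpose U) ** (U ** B ** transpose U) = U ** (A ** B) ** transpose U" for A B
    by (metis U(1) matrix_mul_assoc matrix_mul_rid)
  have LD: "L ** (U ** D' ** transpose U) = mat 1" "(U ** D' ** transpose U) ** L = mat 1"
    unfolding L_def conj by (simp_all add: D D' U')
  have sym: "transpose (U ** A ** transpose U) = U ** transpose A ** transpose U" for A
    by (simp add: matrix_transpose_mul matrix_mul_assoc)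
  have tau: "tau L = U ** D' ** transpose U"
    unfolding tau_def matrix_inv_eqI[OF LD] sym by (simp add: D)
  have L: "transpose L = L"
    unfolding L_def sym by (simp add: D)
  show "tau L ** transpose L = mat 1" "transpose L ** tau L = mat 1"
    unfolding tau L by (rule LD)+
  show "transpose L ** L = U ** (D ** D) ** transpose U"
    unfolding L unfolding L_def by (rule conj)
  have J: "J = U ** J ** transpose U"
    by (metis U(2) U' matrix_mul_assoc matrix_mul_lid matrix_mul_rid)
  have "transpose (tau L) ** J ** tau L = (U ** D' ** transpose U) ** (U ** J ** transpose U) ** (U ** D' ** transpose U)"
    unfolding tau sym D(3) using J by metis
  also have "\<dots> = J"
    unfolding conj using D(4) J by metis
  finally show "transpose (tau L) ** J ** tau L = J" .
qed

section \<open>Action of the gates on the mean and the covariance\<close>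

lemma inner_join: "join a b \<bullet> join x y = a \<bullet> x + b \<bullet> y"
  unfolding inner_vec_def sum_UNIV_Plus join_def by simp

lemma gaussian_state_char:
  fixes \<rho> :: "'n::finite fock \<Rightarrow> 'n fock"
  assumes "gaussian_state \<rho> l m S"
  shows "char_gaussian \<rho> id (join l (- m)) S"
  unfolding char_gaussian_def
proof
  fix r :: "real^('n + 'n)"
  obtain x y where r: "r = join x y"
    by (rule join_surj)
  have "inv id \<circ> weyl (cvec r) \<circ> id = weyl (cplx x y)"
    by (simp add: r cvec_join)
  moreover have "op_trace (\<rho> \<circ> weyl (cplx x y)) =
      exp (- \<i> * complex_of_real (sqrt 2 * (l \<bullet> x - m \<bullet> y)) - complex_of_real (join x y \<bullet> (S *v join x y)))"
    using assms unfolding gaussian_state_def by blast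
  ultimately show "op_trace (\<rho> \<circ> (inv id \<circ> weyl (cvec r) \<circ> id)) =
      exp (- \<i> * complex_of_real (sqrt 2 * (join l (- m) \<bullet> r)) - complex_of_real (r \<bullet> (S *v r)))"
    by (simp add: r inner_join)
qed

lemma op_trace_scale: "op_trace (\<lambda>f. c *\<^sub>C T f) = c * op_trace T"
  by (simp add: op_trace_def cinner_scale_right infsum_cmult_right')

text \<open>\<open>\<delta>\<close> represents the real-linear functional in the phase of
  \<open>weyl_conjugate\<close>; the factor sqrt 2 adapts it to the normalization of the linear
  term.\<close>

lemma char_gaussian_weyl:
  assumes \<rho>: "state \<rho>" and char: "char_gaussian \<rho> id k S"
    and \<delta>: "\<And>r. sqrt 2 * Im (cdot (cvec r) u) = \<delta> \<bullet> r"
  shows "char_gaussian \<rho> (weyl u) (k + \<delta>) S"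
  unfolding char_gaussian_def
proof
  fix r
  let ?c = "exp (- 2 * \<i> * complex_of_real (Im (cdot (cvec r) u)))"
  have "\<rho> \<circ> (inv (weyl u) \<circ> weyl (cvec r) \<circ> weyl u) = (\<lambda>f. ?c *\<^sub>C (\<rho> \<circ> (inv id \<circ> weyl (cvec r) \<circ> id)) f)"
    using positive_op_linear(2)[OF state_positive_op[OF \<rho>]] by (simp add: fun_eq_iff inv_weyl weyl_conjugate)
  then have "op_trace (\<rho> \<circ> (inv (weyl u) \<circ> weyl (cvec r) \<circ> weyl u))
      = ?c * exp (- \<i> * complex_of_real (sqrt 2 * (k \<bullet> r)) - complex_of_real (r \<bullet> (S *v r)))"
    using char unfolding char_gaussian_def by (simp only: op_trace_scale)
  also have "\<dots> = exp (- \<i> * complex_of_real (sqrt 2 * ((k + \<delta>) \<bullet> r)) - complex_of_real (r \<bullet> (S *v r)))"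
  proof -
    have "sqrt 2 * ((k + \<delta>) \<bullet> r) = sqrt 2 * (k \<bullet> r) + sqrt 2 * (sqrt 2 * Im (cdot (cvec r) u))"
      unfolding \<delta> by (simp add: inner_add_left distrib_left)
    also have "sqrt 2 * (sqrt 2 * Im (cdot (cvec r) u)) = 2 * Im (cdot (cvec r) u)"
      by simp
    finally show ?thesis
      unfolding exp_add[symmetric] by (intro arg_cong[of _ _ exp]) (simp add: algebra_simps)
  qed
  finally show "op_trace (\<rho> \<circ> (inv (weyl u) \<circ> weyl (cvec r) \<circ> weyl u)) = \<dots>" .
qed

lemma implements_conjugate:
  assumes V: "implements V M" and MN: "M ** N = mat 1"
  shows "inv V \<circ> weyl (cvec r) \<circ> V = weyl (cvec (N *v r))"
proof -
  obtain x' y' where r: "r = join x' y'"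
    by (rule join_surj)
  obtain x y where Nr: "N *v r = join x y"
    by (rule join_surj)
  have "join x' y' = M *v join x y"
    unfolding Nr[symmetric] by (simp add: matrix_vector_mul_assoc MN r)
  then have W: "V \<circ> weyl (cplx x y) \<circ> inv V = weyl (cplx x' y')"
    using V unfolding implements_def by blast
  have "unitary V"
    using V by (simp add: implements_def)
  moreover have "cvec r = cplx x' y'" "cvec (N *v r) = cplx x y"
    by (simp_all only: r[symmetric] Nr cvec_join) (simp add: r cvec_join)
  ultimately show ?thesis
    by (simp add: fun_eq_iff unitaryD(5) flip: W)
qed

lemma inner_transpose: "(transpose A *v x) \<bullet> y = x \<bullet> (A *v y)" for A :: "real^'a::finite^'b::finite"
  by (simp add: transpose_matrix_vector dot_lmul_matrix)

lemma char_gaussian_implements: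
  assumes char: "char_gaussian \<rho> id k S" and V: "implements V M" and MN: "M ** N = mat 1"
  shows "char_gaussian \<rho> V (transpose N *v k) (transpose N ** S ** N)"
  unfolding char_gaussian_def
proof
  fix r
  have "op_trace (\<rho> \<circ> (inv V \<circ> weyl (cvec r) \<circ> V)) = op_trace (\<rho> \<circ> (inv id \<circ> weyl (cvec (N *v r)) \<circ> id))"
    unfolding implements_conjugate[OF V MN] by simp
  also have "\<dots> = exp (- \<i> * complex_of_real (sqrt 2 * (k \<bullet> (N *v r))) - complex_of_real ((N *v r) \<bullet> (S *v (N *v r))))"
    using char unfolding char_gaussian_def by blast
  also have "k \<bullet> (N *v r) = (transpose N *v k) \<bullet> r"
    by (rule inner_transpose[symmetric])
  also have "(N *v r) \<bullet> (S *v (N *v r)) = r \<bullet> ((transpose N ** S ** N) *v r)"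
  proof -
    have "(N *v r) \<bullet> (S *v (N *v r)) = (transpose N *v (S *v (N *v r))) \<bullet> r"
      unfolding inner_transpose by (rule inner_commute)
    then show ?thesis
      by (simp add: matrix_vector_mul_assoc matrix_mul_assoc inner_commute)
  qed
  finally show "op_trace (\<rho> \<circ> (inv V \<circ> weyl (cvec r) \<circ> V)) = exp (- \<i> * complex_of_real (sqrt 2 * ((transpose N *v k) \<bullet> r))
      - complex_of_real (r \<bullet> ((transpose N ** S ** N) *v r)))" .
qed

lemma expectation_eqD:
  fixes \<rho> \<rho>' V :: "'n::finite fock \<Rightarrow> 'n fock"
  assumes "state \<rho>" "state \<rho>'" "unitary V" "char_gaussian \<rho> V k S" "char_gaussian \<rho>' V k' S'"
    and eq: "expectation_number \<rho> V = expectation_number \<rho>' V"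
  shows "(\<Sum>b\<in>UNIV. S $ b $ b) + k \<bullet> k = (\<Sum>b\<in>UNIV. S' $ b $ b) + k' \<bullet> k'"
proof -
  let ?A = "2 * ((\<Sum>b\<in>UNIV. S $ b $ b) + k \<bullet> k)" and ?B = "2 * ((\<Sum>b\<in>UNIV. S' $ b $ b) + k' \<bullet> k')"
  have AB: "ennreal ?A = ennreal ?B"
    using expectation_number_gaussian[OF assms(1,3,4)] expectation_number_gaussian[OF assms(2,3,5)]
    unfolding eq by simp
  \<comment> \<open>\<^const>\<open>ennreal\<close> maps negative numbers to \<open>0\<close>, but both sides are at least \<open>2 n > 0\<close>.\<close>
  have "0 < (of_nat (2 * CARD('n)) :: ennreal)"
    by (metis of_nat_0_less_iff nat_0_less_mult_iff zero_less_card_finite zero_less_numeral)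
  then have A0: "0 < ennreal ?A"
    unfolding expectation_number_gaussian[OF assms(1,3,4), symmetric] by (simp add: add_nonneg_pos)
  then have "0 < ?A"
    by (simp only: ennreal_less_zero_iff)
  moreover have "0 < ?B"
    using A0 unfolding AB by (simp only: ennreal_less_zero_iff)
  ultimately have "?A = ?B"
    using AB by (simp only: ennreal_inj less_imp_le)
  then show ?thesis
    by simp
qed

text \<open>The gate implements the inverse transpose of \<open>L\<close>, and conjugation brings in
  its inverse L^T, so \<open>S\<close> becomes L S L^T. The means agree and cancel; subtracting the
  equation for the plain traces leaves L^T L - 1 as the coefficients.\<close>

lemma symplectic_gate_equation:
  fixes \<Gamma> :: "real^('n::finite + 'n)^('n + 'n) \<Rightarrow> 'n fock \<Rightarrow> 'n fock"
    and c :: "'k::finite \<Rightarrow> 'n + 'n" and S S' :: "real^('n + 'n)^('n + 'n)"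
  assumes \<Gamma>: "\<And>L. symplectic L \<Longrightarrow> implements (\<Gamma> L) L"
    and \<rho>: "state \<rho>" "char_gaussian \<rho> id k S" "state \<rho>'" "char_gaussian \<rho>' id k S'"
    and tr: "(\<Sum>b\<in>UNIV. S $ b $ b) = (\<Sum>b\<in>UNIV. S' $ b $ b)"
    and c: "inj c" and M: "symplectic (embed_coords c (tau L))" and L: "tau L ** transpose L = mat 1"
    and eq: "expectation_number \<rho> (\<Gamma> (embed_coords c (tau L))) = expectation_number \<rho>' (\<Gamma> (embed_coords c (tau L)))"
  shows "(\<Sum>a\<in>UNIV. \<Sum>b\<in>UNIV. ((transpose L ** L) $ a $ b - mat 1 $ a $ b) * (S - S') $ c a $ c b) = 0"
proof -
  let ?N = "embed_coords c (transpose L)"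
  let ?M = "embed_coords c (tau L)"
  have MN: "?M ** ?N = mat 1"
    by (simp add: embed_coords_mult[OF c] L embed_coords_one[OF c])
  have N: "transpose ?N = embed_coords c L"
    by (simp add: transpose_embed_coords)
  have V: "implements (\<Gamma> ?M) ?M"
    by (rule \<Gamma>[OF M])
  then have "unitary (\<Gamma> ?M)"
    by (simp add: implements_def)
  from expectation_eqD[OF \<rho>(1,3) this char_gaussian_implements[OF \<rho>(2) V MN] char_gaussian_implements[OF \<rho>(4) V MN] eq]
  have "(\<Sum>b\<in>UNIV. (transpose ?N ** S ** ?N) $ b $ b) = (\<Sum>b\<in>UNIV. (transpose ?N ** S' ** ?N) $ b $ b)"
    by simp
  then have "(\<Sum>b\<in>UNIV. (embed_coords c L ** S ** transpose (embed_coords c L)) $ b $ b)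
      = (\<Sum>b\<in>UNIV. (embed_coords c L ** S' ** transpose (embed_coords c L)) $ b $ b)"
    unfolding N by (simp add: transpose_embed_coords)
  then show ?thesis
    unfolding trace_embed_coords[OF c] tr
    by (simp add: right_diff_distrib sum_subtractf)
qed

section \<open>The concrete one-mode and two-mode matrices\<close>

lemma vector_4:
  "(vector [x, y, z, w] :: 'a::zero^4) $ 1 = x" "(vector [x, y, z, w] :: 'a::zero^4) $ 2 = y"
  "(vector [x, y, z, w] :: 'a::zero^4) $ 3 = z" "(vector [x, y, z, w] :: 'a::zero^4) $ 4 = w"
  unfolding vector_def by simp_all

lemma distinct_4: "(1::4) \<noteq> 2" "(1::4) \<noteq> 3" "(1::4) \<noteq> 4" "(2::4) \<noteq> 3" "(2::4) \<noteq> 4" "(3::4) \<noteq> 4"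
  by simp_all

lemmas matrix_2_simps = vec_eq_iff forall_2 sum_2 matrix_matrix_mult_def transpose_def mat_def diag_def
lemmas matrix_4_simps = vec_eq_iff forall_4 sum_4 matrix_matrix_mult_def transpose_def mat_def diag_def
  vector_4 distinct_4 distinct_4[symmetric]

definition symp_J2 :: "real^2^2"
  where "symp_J2 = vector [vector [0, -1], vector [1, 0]]"

text \<open>Coordinates are grouped by mode here, as in \<open>two_mode_coords\<close>, whereas
  \<open>symp_J\<close> has all x before all y.\<close>

definition symp_J4 :: "real^4^4"
  where "symp_J4 = vector
    [vector [0, -1, 0, 0], vector [1, 0, 0, 0], vector [0, 0, 0, -1], vector [0, 0, 1, 0]]"

lemma symp_J_nth:
  "symp_J $ Inl i $ Inl j = 0" "symp_J $ Inr i $ Inr j = 0"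
  "symp_J $ Inl i $ Inr j = (if i = j then -1 else 0)" "symp_J $ Inr i $ Inl j = (if i = j then 1 else 0)"
  by (simp_all add: symp_J_def)

lemma L1_gate:
  assumes "x \<noteq> 0"
  shows "tau (L1 x \<alpha>) ** transpose (L1 x \<alpha>) = mat 1"
    "transpose (tau (L1 x \<alpha>)) ** symp_J2 ** tau (L1 x \<alpha>) = symp_J2"
    "transpose (L1 x \<alpha>) ** L1 x \<alpha> = rot \<alpha> ** (diag (vector [x, inverse x]) ** diag (vector [x, inverse x])) ** transpose (rot \<alpha>)"
proof -
  have cs: "cos \<alpha> * cos \<alpha> = 1 - sin \<alpha> * sin \<alpha>"
    using sin_cos_squared_add3[of \<alpha>] by linarith
  have "transpose (rot \<alpha>) ** rot \<alpha> = mat 1" "transpose (rot \<alpha>) ** symp_J2 ** rot \<alpha> = symp_J2"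
    "diag (vector [x, inverse x]) ** diag (vector [inverse x, x]) = (mat 1 :: real^2^2)"
    "transpose (diag (vector [x, inverse x])) = (diag (vector [x, inverse x]) :: real^2^2)"
    "transpose (diag (vector [inverse x, x])) = (diag (vector [inverse x, x]) :: real^2^2)"
    "diag (vector [inverse x, x]) ** symp_J2 ** diag (vector [inverse x, x]) = symp_J2"
    using assms by (simp_all add: matrix_2_simps rot_def symp_J2_def cs)
  from gate_matrix[OF this]
  show "tau (L1 x \<alpha>) ** transpose (L1 x \<alpha>) = mat 1"
    "transpose (tau (L1 x \<alpha>)) ** symp_J2 ** tau (L1 x \<alpha>) = symp_J2"
    "transpose (L1 x \<alpha>) ** L1 x \<alpha> = rot \<alpha> ** (diag (vector [x, inverse x]) ** diag (vector [x, inverse x])) ** transpose (rot \<alpha>)"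
    unfolding L1_def by auto
qed

text \<open>\<open>O4 U\<close> is the real form of the special unitary matrix with first row that
  of \<open>U\<close>: each complex entry becomes a 2 x 2 block. This makes it orthogonal and
  symplectic.\<close>

lemma L2_gate:
  assumes U: "(cmod (U $ 1 $ 1))\<^sup>2 + (cmod (U $ 1 $ 2))\<^sup>2 = 1" and x: "x \<noteq> 0" "y \<noteq> 0"
  shows "tau (L2 U x y) ** transpose (L2 U x y) = mat 1"
    "transpose (tau (L2 U x y)) ** symp_J4 ** tau (L2 U x y) = symp_J4"
    "transpose (L2 U x y) ** L2 U x y = O4 U **
      (diag (vector [x, inverse x, y, inverse y]) ** diag (vector [x, inverse x, y, inverse y])) ** transpose (O4 U)"
proof -
  define a b c d where "a = Re (U $ 1 $ 1)" and "b = Im (U $ 1 $ 1)" and "c = Re (U $ 1 $ 2)" and "d = Im (U $ 1 $ 2)"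
  \<comment> \<open>Oriented as a rewrite rule that eliminates the square of \<open>a\<close> from
    all entries.\<close>
  have r: "a * a = 1 - (b * b + c * c + d * d)"
    using U unfolding cmod_power2 by (simp add: a_def b_def c_def d_def power2_eq_square)
  have O4: "O4 U = vector [vector [a, - b, c, - d], vector [b, a, d, c], vector [- c, - d, a, b], vector [d, - c, - b, a]]"
    by (simp add: O4_def a_def b_def c_def d_def Let_def)
  have "transpose (O4 U) ** O4 U = mat 1" "transpose (O4 U) ** symp_J4 ** O4 U = symp_J4"
    unfolding O4 symp_J4_def by (simp_all add: matrix_4_simps r algebra_simps)
  moreover have "diag (vector [x, inverse x, y, inverse y]) ** diag (vector [inverse x, x, inverse y, y]) = (mat 1 :: real^4^4)"
    "transpose (diag (vector [x, inverse x, y, inverse y])) = (diag (vector [x, inverse x, y, inverse y]) :: real^4^4)"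
    "transpose (diag (vector [inverse x, x, inverse y, y])) = (diag (vector [inverse x, x, inverse y, y]) :: real^4^4)"
    "diag (vector [inverse x, x, inverse y, y]) ** symp_J4 ** diag (vector [inverse x, x, inverse y, y]) = symp_J4"
    using x unfolding symp_J4_def by (simp_all add: matrix_4_simps)
  ultimately show "tau (L2 U x y) ** transpose (L2 U x y) = mat 1"
    "transpose (tau (L2 U x y)) ** symp_J4 ** tau (L2 U x y) = symp_J4"
    "transpose (L2 U x y) ** L2 U x y = O4 U **
      (diag (vector [x, inverse x, y, inverse y]) ** diag (vector [x, inverse x, y, inverse y])) ** transpose (O4 U)"
    unfolding L2_def by (blast intro: gate_matrix)+
qed

lemma mode_coords_simps: "mode_coords j 1 = Inl j" "mode_coords j 2 = Inr j"
  by (simp_all add: mode_coords_def)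

lemma inj_mode_coords: "inj (mode_coords j)"
  by (rule injI) (metis exhaust_2 mode_coords_simps sum.distinct(1))

lemma range_mode_coords: "range (mode_coords j) = {Inl j, Inr j}"
  unfolding UNIV_2 by (simp add: mode_coords_simps)

lemma two_mode_coords_simps:
  "two_mode_coords i j 1 = Inl i" "two_mode_coords i j 2 = Inr i" "two_mode_coords i j 3 = Inl j" "two_mode_coords i j 4 = Inr j"
  by (simp_all add: two_mode_coords_def)

lemma inj_two_mode_coords:
  assumes "i \<noteq> j"
  shows "inj (two_mode_coords i j)"
proof (rule injI)
  fix a b
  show "two_mode_coords i j a = two_mode_coords i j b \<Longrightarrow> a = b"
    using exhaust_4[of a] exhaust_4[of b] assms by (elim disjE) (simp_all add: two_mode_coords_simps)
qed

lemma range_two_mode_coords: "range (two_mode_coords i j) = {Inl i, Inr i, Inl j, Inr j}"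
  unfolding UNIV_4 by (simp add: two_mode_coords_simps)

lemma symplectic_one_mode:
  assumes "x \<noteq> 0"
  shows "symplectic (embed_coords (mode_coords (j :: 'n::finite)) (tau (L1 x \<alpha>)))"
proof (rule symplectic_embed_coords[OF inj_mode_coords _ _ _ L1_gate(2)[OF assms]])
  show "symp_J $ mode_coords j a $ mode_coords j b = symp_J2 $ a $ b" for a b
    using exhaust_2[of a] exhaust_2[of b] by (auto simp: mode_coords_simps symp_J_nth symp_J2_def)
  show "symp_J $ mode_coords j a $ q = 0" "symp_J $ q $ mode_coords j a = 0" if "q \<notin> range (mode_coords j)" for a q
    using exhaust_2[of a] that unfolding range_mode_coords
    by (cases q; auto simp: mode_coords_simps symp_J_nth)+
qed

lemma symplectic_two_mode:
  assumes "(cmod (U $ 1 $ 1))\<^sup>2 + (cmod (U $ 1 $ 2))\<^sup>2 = 1" "x \<noteq> 0" "y \<noteq> 0" "i \<noteq> (j :: 'n::finite)"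
  shows "symplectic (embed_coords (two_mode_coords i j) (tau (L2 U x y)))"
proof (rule symplectic_embed_coords[OF inj_two_mode_coords[OF assms(4)] _ _ _ L2_gate(2)[OF assms(1-3)]])
  show "symp_J $ two_mode_coords i j a $ two_mode_coords i j b = symp_J4 $ a $ b" for a b
    using exhaust_4[of a] exhaust_4[of b] assms(4)
    by (elim disjE) (simp_all add: two_mode_coords_simps symp_J_nth symp_J4_def vector_4)
  show "symp_J $ two_mode_coords i j a $ q = 0" "symp_J $ q $ two_mode_coords i j a = 0"
    if "q \<notin> range (two_mode_coords i j)" for a q
    using exhaust_4[of a] that unfolding range_two_mode_coords
    by (cases q; auto simp: two_mode_coords_simps symp_J_nth)+
qed

text \<open>The equation that the gate with matrix \<open>L\<close> gives for the difference \<open>\<Delta>\<close> of two covariance matrices.\<close>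

definition gate_equation :: "('k::finite \<Rightarrow> 'm::finite) \<Rightarrow> real^'k^'k \<Rightarrow> real^'m^'m \<Rightarrow> bool"
  where "gate_equation c L \<Delta> \<longleftrightarrow>
    (\<Sum>a\<in>UNIV. \<Sum>b\<in>UNIV. ((transpose L ** L) $ a $ b - mat 1 $ a $ b) * \<Delta> $ c a $ c b) = 0"

lemma gate_equation_one_mode_diagonal:
  assumes "gate_equation (mode_coords j) (L1 x 0) \<Delta>" "x \<noteq> 0"
  shows "(x\<^sup>2 - 1) * \<Delta> $ Inl j $ Inl j + (inverse (x\<^sup>2) - 1) * \<Delta> $ Inr j $ Inr j = 0"
  using assms(1) unfolding gate_equation_def L1_gate(3)[OF assms(2)]
  by (simp add: matrix_2_simps mode_coords_simps rot_def power2_eq_square)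

text \<open>The rotation by pi/4 gives L^T L the off-diagonal entry (2 - 1/2) / 2 = 3/4, so once the
  diagonal entries are 0 only the mixed entry is left.\<close>

lemma gate_equation_one_mode_rotated:
  assumes eq: "gate_equation (mode_coords j) (L1 (sqrt 2) (pi / 4)) \<Delta>" and sym: "transpose \<Delta> = \<Delta>"
    and 0: "\<Delta> $ Inl j $ Inl j = 0" "\<Delta> $ Inr j $ Inr j = 0"
  shows "\<Delta> $ Inl j $ Inr j = 0"
proof -
  have "\<Delta> $ Inr j $ Inl j = \<Delta> $ Inl j $ Inr j"
    using arg_cong[OF sym, of "\<lambda>A. A $ Inl j $ Inr j"] by (simp add: transpose_def)
  moreover have "sqrt 2 \<noteq> 0"
    by simp
  ultimately show ?thesis
    using eq unfolding gate_equation_def L1_gate(3)[OF \<open>sqrt 2 \<noteq> 0\<close>]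
    by (simp add: matrix_2_simps mode_coords_simps rot_def cos_45 sin_45 0 field_simps)
qed

text \<open>Since the first squeezing parameter is 1, only the third and fourth columns of
  \<open>O4\<close> enter L^T L - 1. For \<open>matH\<close> they are (1,0,1,0) and (0,1,0,1) over
  sqrt 2, which couple x with x and y with y. For \<open>matK\<close> they are (1,0,0,-1) and
  (0,1,1,0) over sqrt 2, which couple x with y.\<close>

lemma gate_equation_two_modes:
  assumes sym: "transpose \<Delta> = \<Delta>" and y: "y \<noteq> 0"
    and 0: "\<And>k. \<Delta> $ Inl k $ Inl k = 0" "\<And>k. \<Delta> $ Inl k $ Inr k = 0" "\<And>k. \<Delta> $ Inr k $ Inr k = 0"
  shows "gate_equation (two_mode_coords i j) (L2 matH 1 y) \<Delta> \<Longrightarrow>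
      (y\<^sup>2 - 1) * \<Delta> $ Inl i $ Inl j + (inverse (y\<^sup>2) - 1) * \<Delta> $ Inr i $ Inr j = 0"
    "gate_equation (two_mode_coords i j) (L2 matK 1 y) \<Delta> \<Longrightarrow>
      (1 - y\<^sup>2) * \<Delta> $ Inl i $ Inr j + (inverse (y\<^sup>2) - 1) * \<Delta> $ Inr i $ Inl j = 0"
proof -
  have sym': "\<Delta> $ p $ q = \<Delta> $ q $ p" for p q
    using arg_cong[OF sym, of "\<lambda>A. A $ q $ p"] by (simp add: transpose_def)
  have off: "\<Delta> $ Inl j $ Inl i = \<Delta> $ Inl i $ Inl j" "\<Delta> $ Inr j $ Inr i = \<Delta> $ Inr i $ Inr j"
    "\<Delta> $ Inr j $ Inl i = \<Delta> $ Inl i $ Inr j" "\<Delta> $ Inl j $ Inr i = \<Delta> $ Inr i $ Inl j"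
    "\<Delta> $ Inr k $ Inl k = 0" for k
    using 0(2)[of k] sym' by metis+
  have one: "(1::real) \<noteq> 0"
    by simp
  have H: "(cmod (matH $ 1 $ 1))\<^sup>2 + (cmod (matH $ 1 $ 2))\<^sup>2 = 1" and K: "(cmod (matK $ 1 $ 1))\<^sup>2 + (cmod (matK $ 1 $ 2))\<^sup>2 = 1"
    by (simp_all add: matH_def matK_def power_divide norm_divide)
  have O4H: "O4 matH = vector [vector [1 / sqrt 2, 0, 1 / sqrt 2, 0], vector [0, 1 / sqrt 2, 0, 1 / sqrt 2],
      vector [- (1 / sqrt 2), 0, 1 / sqrt 2, 0], vector [0, - (1 / sqrt 2), 0, 1 / sqrt 2]]"
    by (simp add: O4_def matH_def Let_def)
  have O4K: "O4 matK = vector [vector [0, - (1 / sqrt 2), 1 / sqrt 2, 0], vector [1 / sqrt 2, 0, 0, 1 / sqrt 2],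
      vector [- (1 / sqrt 2), 0, 0, 1 / sqrt 2], vector [0, - (1 / sqrt 2), - (1 / sqrt 2), 0]]"
    by (simp add: O4_def matK_def Let_def)
  show "gate_equation (two_mode_coords i j) (L2 matH 1 y) \<Delta> \<Longrightarrow>
      (y\<^sup>2 - 1) * \<Delta> $ Inl i $ Inl j + (inverse (y\<^sup>2) - 1) * \<Delta> $ Inr i $ Inr j = 0"
    unfolding gate_equation_def L2_gate(3)[OF H one y] O4H
    by (simp add: matrix_4_simps two_mode_coords_simps 0 off power2_eq_square) (simp add: algebra_simps)
  show "gate_equation (two_mode_coords i j) (L2 matK 1 y) \<Delta> \<Longrightarrow>
      (1 - y\<^sup>2) * \<Delta> $ Inl i $ Inr j + (inverse (y\<^sup>2) - 1) * \<Delta> $ Inr i $ Inl j = 0"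
    unfolding gate_equation_def L2_gate(3)[OF K one y] O4K
    by (simp add: matrix_4_simps two_mode_coords_simps 0 off power2_eq_square) (simp add: algebra_simps)
qed

section \<open>The spectrum of the observables\<close>

lemma number_vec_nonzero: "number_vec A \<noteq> 0"
proof
  assume "number_vec A = 0"
  moreover obtain w where "mset w = A"
    using ex_mset by blast
  ultimately have "complex_of_real (1 / sqrt (card (permutations_of_multiset A))) = 0"
    using fun_cong[OF number_vec.rep_eq, of A w] by (simp add: zero_fock.rep_eq)
  then show False
    using card_permutations_pos[of A] by simp
qed

lemma number_op_number_vec: "(number_vec A, of_nat (size A) *\<^sub>C number_vec A) \<in> number_op"
  by (auto simp: number_op_def fock_scale.rep_eq number_vec.rep_eq)

lemma conjugate_number_op:
  assumes "unitary V"
  shows "(f, h) \<in> conjugate_op V number_op \<longleftrightarrow> (V f, V h) \<in> number_op"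
  unfolding conjugate_op_def cadjoint_unitary[OF assms]
  using unitaryD(5,6)[OF assms] by (auto, metis)

text \<open>All but finitely many natural numbers have distance at least 1 from \<open>z\<close>.
  The bound makes the diagonal resolvent bounded.\<close>

lemma dist_naturals:
  assumes "z \<notin> \<nat>"
  obtains \<delta> where "0 < \<delta>" "\<And>k. \<delta> \<le> cmod (of_nat k - z)"
proof -
  obtain K :: nat where K: "cmod z + 1 \<le> real K"
    using real_arch_simple by blast
  define \<delta> where "\<delta> = Min (insert 1 ((\<lambda>k. cmod (of_nat k - z)) ` {..<K}))"
  have "of_nat k \<noteq> z" for k
    using assms by auto
  then have "0 < \<delta>"
    by (simp add: \<delta>_def)
  moreover have "\<delta> \<le> cmod (of_nat k - z)" for k
  proof (cases "k < K")
    case False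
    then have "1 \<le> cmod (of_nat k - z)"
      using norm_triangle_ineq2[of "of_nat k" z] K by simp
    moreover have "\<delta> \<le> 1"
      by (simp add: \<delta>_def)
    ultimately show ?thesis
      by linarith
  qed (simp add: \<delta>_def)
  ultimately show ?thesis
    by (rule that)
qed

lemma number_op_resolvent:
  fixes z :: complex
  assumes "z \<notin> \<nat>"
  obtains Q :: "'n fock \<Rightarrow> 'n fock" where "bounded_clinear Q"
    "\<And>f w. fock_coord (Q f) w = fock_coord f w / (of_nat (length w) - z)"
proof -
  obtain \<delta> where \<delta>: "0 < \<delta>" "\<And>k. \<delta> \<le> cmod (of_nat k - z)"
    using assms by (rule dist_naturals) blast
  have le: "cmod (a / (of_nat k - z)) \<le> inverse \<delta> * cmod a" for a k
  proof -
    have "inverse (cmod (of_nat k - z)) \<le> inverse \<delta>"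
      using \<delta> by (intro le_imp_inverse_le)
    then have "inverse (cmod (of_nat k - z)) * cmod a \<le> inverse \<delta> * cmod a"
      by (rule mult_right_mono) simp
    then show ?thesis
      by (simp add: divide_inverse norm_mult norm_inverse mult.commute)
  qed
  define Q where "Q = (\<lambda>f :: 'n fock. Abs_fock (\<lambda>w. fock_coord f w / (of_nat (length w) - z)))"
  have coord: "fock_coord (Q f) w = fock_coord f w / (of_nat (length w) - z)" for f w
  proof -
    have "fock_fun (\<lambda>w. fock_coord f w / (of_nat (length w) - z))"
    proof (rule fock_funI)
      show "fock_coord f u / (of_nat (length u) - z) = fock_coord f v / (of_nat (length v) - z)" if "mset u = mset v" for u v
        using fock_coord_perm[OF that] mset_eq_length[OF that] by simp
      show "(\<lambda>w. (cmod (fock_coord f w / (of_nat (length w) - z)))\<^sup>2) summable_on UNIV"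
      proof (rule summable_on_comparison_test)
        show "(\<lambda>w. (inverse \<delta>)\<^sup>2 * (cmod (fock_coord f w))\<^sup>2) summable_on UNIV"
          by (intro summable_on_cmult_right fock_coord_square_summable)
        show "(cmod (fock_coord f w / (of_nat (length w) - z)))\<^sup>2 \<le> (inverse \<delta>)\<^sup>2 * (cmod (fock_coord f w))\<^sup>2" for w
          unfolding power_mult_distrib[symmetric] by (intro power_mono le) simp
      qed auto
    qed
    then show ?thesis
      by (simp add: Q_def Abs_fock_inverse)
  qed
  have "Q (f + g) = Q f + Q g" "Q (c *\<^sub>C f) = c *\<^sub>C Q f" for f g c
    by (rule fock_eqI; simp add: coord fock_coord_simps add_divide_distrib)+
  moreover have "norm (Q f) \<le> norm f * inverse \<delta>" for f
  proof -
    have "norm (Q f) \<le> norm (inverse \<delta> *\<^sub>R f)"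
      by (rule norm_fock_leI) (use le \<delta>(1) in \<open>simp add: coord fock_coord_scaleR norm_mult norm_inverse\<close>)
    then show ?thesis
      using \<delta>(1) by (simp add: mult.commute)
  qed
  ultimately have "bounded_clinear Q"
    unfolding bounded_clinear_def
    by (intro conjI bounded_linear_intro[where K = "inverse \<delta>"]) (simp_all add: scaleR_fock_def)
  then show ?thesis
    using coord by (rule that)
qed

lemma op_spectrum_number:
  fixes V :: "'n fock \<Rightarrow> 'n fock"
  assumes V: "unitary V"
  shows "op_spectrum (conjugate_op V number_op) = \<nat>"
proof -
  note V' = unitaryD[OF V] and L = bounded_clinearD[OF unitaryD(1)[OF V]]
  have "z \<in> resolvent_set (conjugate_op V number_op) \<longleftrightarrow> z \<notin> \<nat>" for z
  proof
    assume "z \<in> resolvent_set (conjugate_op V number_op)"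
    then obtain R where R: "bounded_clinear R"
      "\<And>f h. (f, h) \<in> conjugate_op V number_op \<Longrightarrow> R (h - z *\<^sub>C f) = f"
      unfolding resolvent_set_def by blast
    show "z \<notin> \<nat>"
    proof
      assume "z \<in> \<nat>"
      then obtain k where z: "z = of_nat k"
        by (auto elim: Nats_cases)
      \<comment> \<open>Putting all \<open>k\<close> particles into one arbitrary mode gives an
        eigenvector of N for \<open>k\<close>; its preimage under \<open>V\<close> is one of the
        observable.\<close>
      let ?n = "number_vec (replicate_mset k (undefined :: 'n))"
      have "(inv V ?n, z *\<^sub>C inv V ?n) \<in> conjugate_op V number_op"
        using number_op_number_vec[of "replicate_mset k (undefined :: 'n)"]
        by (simp add: conjugate_number_op[OF V] L V'(6) z)
      from R(2)[OF this] have "inv V ?n = 0"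
        by (simp add: bounded_clinearD(5)[OF R(1)])
      then have "?n = 0"
        using V'(6)[of ?n] by (simp add: L)
      then show False
        by (simp add: number_vec_nonzero)
    qed
  next
    assume z: "z \<notin> \<nat>"
    obtain Q :: "'n fock \<Rightarrow> 'n fock" where Q: "bounded_clinear Q"
      "\<And>f w. fock_coord (Q f) w = fock_coord f w / (of_nat (length w) - z)"
      using z by (rule number_op_resolvent) blast
    have nz: "of_nat k - z \<noteq> 0" for k
      using z by auto
    define R where "R = inv V \<circ> (Q \<circ> V)"
    have "bounded_clinear R"
      unfolding R_def by (intro bounded_clinear_compose Q V' unitaryD(1)[OF unitary_inv[OF V]])
    moreover have "\<exists>h. (R f, h) \<in> conjugate_op V number_op \<and> h - z *\<^sub>C R f = f" for f
    proof (intro exI conjI)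
      show "(R f, f + z *\<^sub>C R f) \<in> conjugate_op V number_op"
        unfolding conjugate_number_op[OF V]
        by (simp add: R_def V'(6) L number_op_def fock_coord_simps Q(2)) (use nz in \<open>simp add: field_simps\<close>)
    qed simp
    moreover have "R (h - z *\<^sub>C f) = f" if "(f, h) \<in> conjugate_op V number_op" for f h
    proof -
      have "Q (V (h - z *\<^sub>C f)) = V f"
        using that nz unfolding conjugate_number_op[OF V]
        by (intro fock_eqI) (simp add: number_op_def Q(2) L fock_coord_simps left_diff_distrib[symmetric])
      then show ?thesis
        by (simp add: R_def V'(5))
    qed
    ultimately show "z \<in> resolvent_set (conjugate_op V number_op)"
      unfolding resolvent_set_def by blast
  qed
  then show ?thesis
    unfolding op_spectrum_def by blast
qed

section \<open>The measured observables determine the state\<close>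

lemma modes: "set (modes :: 'n::{finite, linorder} list) = UNIV" "distinct (modes :: 'n list)"
  "length (modes :: 'n list) = CARD('n)" "(modes :: 'n list) \<noteq> []"
proof -
  show set: "set (modes :: 'n list) = UNIV"
    by (simp add: modes_def)
  show "distinct (modes :: 'n list)" "length (modes :: 'n list) = CARD('n)"
    by (simp_all add: modes_def)
  show "(modes :: 'n list) \<noteq> []"
    using set by auto
qed

text \<open>The n^2 pairs split into increasing, decreasing and equal ones, and swapping matches the
  first two kinds.\<close>

lemma ordered_pairs_count:
  "2 * (\<Sum>i\<leftarrow>modes. \<Sum>j\<leftarrow>modes. if (i :: 'n::{finite, linorder}) < j then 1 else 0) + CARD('n) = CARD('n) * CARD('n)"
proof -
  let ?T = "\<Sum>i\<in>UNIV. \<Sum>j\<in>UNIV. if (i :: 'n) < j then 1 else (0 :: nat)"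
  have "?T + ?T + CARD('n) = ?T + (\<Sum>j\<in>UNIV. \<Sum>i\<in>UNIV. if (i :: 'n) < j then 1 else 0)
      + (\<Sum>i\<in>UNIV. \<Sum>j\<in>UNIV. if (i :: 'n) = j then 1 else (0 :: nat))"
    by (subst sum.swap[of "\<lambda>j i. if (i :: 'n) < j then 1 else (0 :: nat)"]) simp
  also have "\<dots> = (\<Sum>i\<in>UNIV. \<Sum>j\<in>UNIV. (if (i :: 'n) < j then 1 else 0) + (if j < i then 1 else 0) + (if i = j then 1 else (0 :: nat)))"
    by (simp only: sum.distrib)
  also have "\<dots> = (\<Sum>i\<in>(UNIV :: 'n set). \<Sum>j\<in>(UNIV :: 'n set). 1)"
    by (intro sum.cong refl) auto
  also have "\<dots> = CARD('n) * CARD('n)"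
    by simp
  finally show ?thesis
    by (simp add: sum_list_distinct_conv_sum_set modes)
qed

lemma length_gates: "length (gates (\<Gamma> :: real^('n::{finite, linorder} + 'n)^('n + 'n) \<Rightarrow> _)) = CARD('n) * (2 * CARD('n) + 3)"
proof -
  let ?T = "\<Sum>i\<leftarrow>modes. \<Sum>j\<leftarrow>modes. if (i :: 'n) < j then 1 else (0 :: nat)"
  have count: "length (concat (map (\<lambda>i. concat (map (\<lambda>j. if i < j then map (g i j) xs else []) modes)) modes))
      = length xs * ?T" for g :: "'n \<Rightarrow> 'n \<Rightarrow> 'b \<Rightarrow> 'c" and xs
  proof -
    have "length (if i < j then map (g i j) xs else []) = length xs * (if i < j then 1 else 0)" for i j
      by simp
    then show ?thesis
      by (simp only: length_concat map_map o_def sum_list_const_mult)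
  qed
  have "length (gates \<Gamma>) = 1 + CARD('n) + CARD('n) + 3 * (CARD('n) - 1) + 2 + 4 * ?T"
    unfolding gates_def length_append count
    by (simp add: modes length_concat o_def sum_list_triv)
  \<comment> \<open>Ensures that the natural number subtraction in CARD('n) - 1 is not cut
    off.\<close>
  moreover have "1 \<le> CARD('n)"
    by (simp add: Suc_le_eq)
  moreover have "CARD('n) * (2 * CARD('n) + 3) = 2 * (CARD('n) * CARD('n)) + 3 * CARD('n)"
    by (simp add: algebra_simps)
  ultimately show ?thesis
    using ordered_pairs_count[where 'n = 'n] by linarith
qed

lemma in_gates:
  fixes \<Gamma> :: "real^('n::{finite, linorder} + 'n)^('n + 'n) \<Rightarrow> 'n fock \<Rightarrow> 'n fock"
  shows "id \<in> set (gates \<Gamma>)" "gate_p j \<in> set (gates \<Gamma>)" "gate_q j \<in> set (gates \<Gamma>)"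
    "\<Gamma> (embed_coords (mode_coords j) (tau (L1 (sqrt 2) 0))) \<in> set (gates \<Gamma>)"
    "\<Gamma> (embed_coords (mode_coords j) (tau (L1 (sqrt 2) (pi / 4)))) \<in> set (gates \<Gamma>)"
    "j \<noteq> last modes \<Longrightarrow> \<Gamma> (embed_coords (mode_coords j) (tau (L1 (sqrt 3) 0))) \<in> set (gates \<Gamma>)"
    "i < j \<Longrightarrow> U \<in> {matH, matK} \<Longrightarrow> y \<in> {2, 3} \<Longrightarrow>
      \<Gamma> (embed_coords (two_mode_coords i j) (tau (L2 U 1 y))) \<in> set (gates \<Gamma>)"
proof -
  have j: "j \<in> set (butlast modes) \<or> j = last modes"
    using modes(1,4) append_butlast_last_id[OF modes(4)] by (metis UNIV_I Un_iff empty_iff list.set(1) list.simps(15) insert_iff set_append)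
  show "id \<in> set (gates \<Gamma>)" "gate_p j \<in> set (gates \<Gamma>)" "gate_q j \<in> set (gates \<Gamma>)"
    by (auto simp: gates_def modes)
  show "\<Gamma> (embed_coords (mode_coords j) (tau (L1 (sqrt 2) 0))) \<in> set (gates \<Gamma>)"
    "\<Gamma> (embed_coords (mode_coords j) (tau (L1 (sqrt 2) (pi / 4)))) \<in> set (gates \<Gamma>)"
    using j by (auto simp: gates_def)
  show "\<Gamma> (embed_coords (mode_coords j) (tau (L1 (sqrt 3) 0))) \<in> set (gates \<Gamma>)" if "j \<noteq> last modes"
    using j that by (auto simp: gates_def)
  show "\<Gamma> (embed_coords (two_mode_coords i j) (tau (L2 U 1 y))) \<in> set (gates \<Gamma>)"
    if "i < j" "U \<in> {matH, matK}" "y \<in> {2, 3}"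
  proof -
    have "(U, 1, y) \<in> set [(matH, 1, 2), (matH, 1, 3), (matK, 1, 2), (matK, 1, 3)]"
      using that(2,3) by auto
    then show ?thesis
      using that(1) unfolding gates_def by (auto simp: modes)
  qed
qed

lemma cmod_matH_matK:
  "U \<in> {matH, matK} \<Longrightarrow> (cmod (U $ 1 $ 1))\<^sup>2 + (cmod (U $ 1 $ 2))\<^sup>2 = 1"
  by (auto simp: matH_def matK_def power_divide norm_divide)

lemma unitary_gates:
  assumes \<Gamma>: "\<And>L. symplectic L \<Longrightarrow> implements (\<Gamma> L) L" and V: "V \<in> set (gates \<Gamma>)"
  shows "unitary V"
proof -
  have un: "unitary (\<Gamma> L)" if "symplectic L" for L
    using \<Gamma>[OF that] by (simp add: implements_def)
  have "unitary (\<Gamma> (embed_coords (mode_coords j) (tau (L1 x \<alpha>))))" if "x \<noteq> 0" for j x \<alpha>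
    by (intro un symplectic_one_mode that)
  moreover have "unitary (\<Gamma> (embed_coords (two_mode_coords i j) (tau (L2 U x y))))"
    if "U \<in> {matH, matK}" "i < j" "x \<noteq> 0" "y \<noteq> 0" for i j U x y
    by (intro un symplectic_two_mode cmod_matH_matK that less_imp_neq)
  ultimately show ?thesis
    using V unfolding gates_def by (auto simp: unitary_id gate_p_def gate_q_def unitary_weyl split: if_splits)
qed

section \<open>The linear equations for the difference of the covariance matrices\<close>

lemma symmetric_matrix_zeroI:
  fixes \<Delta> :: "real^('n::{finite, linorder} + 'n)^('n + 'n)"
  assumes sym: "transpose \<Delta> = \<Delta>"
    and diag: "\<And>k. \<Delta> $ Inl k $ Inl k = 0" "\<And>k. \<Delta> $ Inl k $ Inr k = 0" "\<And>k. \<Delta> $ Inr k $ Inr k = 0"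
    and off: "\<And>i j. i < j \<Longrightarrow> \<Delta> $ Inl i $ Inl j = 0 \<and> \<Delta> $ Inr i $ Inr j = 0 \<and> \<Delta> $ Inl i $ Inr j = 0 \<and> \<Delta> $ Inr i $ Inl j = 0"
  shows "\<Delta> = 0"
proof -
  have sym': "\<Delta> $ p $ q = \<Delta> $ q $ p" for p q
    using arg_cong[OF sym, of "\<lambda>A. A $ q $ p"] by (simp add: transpose_def)
  have "\<Delta> $ Inl i $ Inl j = 0" "\<Delta> $ Inr i $ Inr j = 0" "\<Delta> $ Inl i $ Inr j = 0" for i j
    using off[of i j] off[of j i] diag sym' by (metis linorder_cases)+
  moreover from this have "\<Delta> $ Inr i $ Inl j = 0" for i j
    using sym' by metis
  ultimately have "\<Delta> $ p $ q = 0" for p q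
    by (cases p; cases q) auto
  then show ?thesis
    by (simp add: vec_eq_iff)
qed

text \<open>In one mode, sqrt 2 gives yy = 2 xx and sqrt 3 gives yy = 3 xx, so both vanish; in the
  last mode the trace equation stands in for sqrt 3. In a pair of modes, y = 2 and y = 3 force the
  ratios 4 and 9 for \<open>matH\<close>, and -4 and -9 for \<open>matK\<close>, which again leaves
  only 0.\<close>

lemma gate_equations_imp_zero:
  fixes \<Delta> :: "real^('n::{finite, linorder} + 'n)^('n + 'n)"
  assumes sym: "transpose \<Delta> = \<Delta>" and tr: "(\<Sum>b\<in>UNIV. \<Delta> $ b $ b) = 0"
    and diag2: "\<And>j. gate_equation (mode_coords j) (L1 (sqrt 2) 0) \<Delta>"
    and rot: "\<And>j. gate_equation (mode_coords j) (L1 (sqrt 2) (pi / 4)) \<Delta>"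
    and diag3: "\<And>j. j \<noteq> last modes \<Longrightarrow> gate_equation (mode_coords j) (L1 (sqrt 3) 0) \<Delta>"
    and two: "\<And>i j U y. i < j \<Longrightarrow> U \<in> {matH, matK} \<Longrightarrow> y \<in> {2, 3} \<Longrightarrow>
      gate_equation (two_mode_coords i j) (L2 U 1 y) \<Delta>"
  shows "\<Delta> = 0"
proof -
  have d2: "\<Delta> $ Inr j $ Inr j = 2 * \<Delta> $ Inl j $ Inl j" for j
    using gate_equation_one_mode_diagonal[OF diag2, of j] by simp
  have other: "\<Delta> $ Inl j $ Inl j = 0" if "j \<noteq> last modes" for j
    using gate_equation_one_mode_diagonal[OF diag3[OF that]] by (simp add: d2)
  \<comment> \<open>Each mode contributes xx + yy = 3 xx to the trace, and all modes but the last
    contribute 0.\<close>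
  have "(\<Sum>j\<in>UNIV. 3 * \<Delta> $ Inl j $ Inl j) = (\<Sum>b\<in>UNIV. \<Delta> $ b $ b)"
    unfolding sum_UNIV_Plus sum.distrib[symmetric] by (intro sum.cong refl) (simp add: d2)
  also have "(\<Sum>j\<in>UNIV. 3 * \<Delta> $ Inl j $ Inl j) = (\<Sum>j\<in>{last modes}. 3 * \<Delta> $ Inl j $ Inl j)"
    by (rule sum.mono_neutral_right) (auto simp: other)
  finally have "\<Delta> $ Inl (last modes) $ Inl (last modes) = 0"
    by (simp add: tr)
  then have l: "\<Delta> $ Inl j $ Inl j = 0" and r: "\<Delta> $ Inr j $ Inr j = 0" for j
    using other[of j] by (cases "j = last modes"; simp add: d2)+
  have lr: "\<Delta> $ Inl j $ Inr j = 0" for j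
    by (rule gate_equation_one_mode_rotated[OF rot sym l r])
  show ?thesis
  proof (rule symmetric_matrix_zeroI[OF sym l lr r])
    fix i j :: 'n
    assume "i < j"
    note eq = gate_equation_two_modes[OF sym _ l lr r, OF _ two[OF \<open>i < j\<close>]]
    show "\<Delta> $ Inl i $ Inl j = 0 \<and> \<Delta> $ Inr i $ Inr j = 0 \<and> \<Delta> $ Inl i $ Inr j = 0 \<and> \<Delta> $ Inr i $ Inl j = 0"
      using eq(1)[of 2] eq(1)[of 3] eq(2)[of 2] eq(2)[of 3] by simp
  qed
qed

theorem mainTheorem4:
  fixes \<Gamma> :: "real^('n::{finite, linorder} + 'n)^('n + 'n) \<Rightarrow> 'n fock \<Rightarrow> 'n fock"
  assumes "\<And>L. symplectic L \<Longrightarrow> implements (\<Gamma> L) L"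
  shows "length (gates \<Gamma>) = CARD('n) * (2 * CARD('n) + 3) \<and>
    (\<forall>V \<in> set (gates \<Gamma>). op_spectrum (conjugate_op V number_op) = \<nat>) \<and>
    (\<forall>\<rho> l m S \<rho>' l' m' S'.
      gaussian_state \<rho> l m S \<and> gaussian_state \<rho>' l' m' S' \<and>
      (\<forall>V \<in> set (gates \<Gamma>). expectation_number \<rho> V = expectation_number \<rho>' V) \<longrightarrow>
      l = l' \<and> m = m' \<and> S = S')"
proof (intro conjI ballI allI impI)
  show "length (gates \<Gamma>) = CARD('n) * (2 * CARD('n) + 3)"
    by (rule length_gates)
  show "op_spectrum (conjugate_op V number_op) = \<nat>" if "V \<in> set (gates \<Gamma>)" for V
    by (intro op_spectrum_number unitary_gates[OF assms that])
next
  fix \<rho> l m S \<rho>' l' m' S'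
  assume H: "gaussian_state \<rho> l m S \<and> gaussian_state \<rho>' l' m' S' \<and>
      (\<forall>V \<in> set (gates \<Gamma>). expectation_number \<rho> V = expectation_number \<rho>' V)"
  then have \<rho>: "state \<rho>" "state \<rho>'" and S: "transpose S = S" "transpose S' = S'"
    by (simp_all add: gaussian_state_def)
  define k k' where "k = join l (- m)" and "k' = join l' (- m')"
  have char: "char_gaussian \<rho> id k S" "char_gaussian \<rho>' id k' S'"
    using H by (simp_all add: k_def k'_def gaussian_state_char)
  have eq: "expectation_number \<rho> V = expectation_number \<rho>' V" if "V \<in> set (gates \<Gamma>)" for V
    using H that by blast
  have tr: "(\<Sum>b\<in>UNIV. S $ b $ b) + k \<bullet> k = (\<Sum>b\<in>UNIV. S' $ b $ b) + k' \<bullet> k'"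
    by (rule expectation_eqD[OF \<rho> unitary_id char eq]) (rule in_gates)
  \<comment> \<open>Expanding |k + delta|^2 and subtracting the equation for N itself leaves twice
    the inner product of delta and k.\<close>
  have shift: "\<delta> \<bullet> k = \<delta> \<bullet> k'"
    if "\<And>r. sqrt 2 * Im (cdot (cvec r) u) = \<delta> \<bullet> r" "weyl u \<in> set (gates \<Gamma>)" for \<delta> u
  proof -
    have "(\<Sum>b\<in>UNIV. S $ b $ b) + (k + \<delta>) \<bullet> (k + \<delta>) = (\<Sum>b\<in>UNIV. S' $ b $ b) + (k' + \<delta>) \<bullet> (k' + \<delta>)"
      by (rule expectation_eqD[OF \<rho> unitary_weyl char_gaussian_weyl[OF \<rho>(1) char(1)] char_gaussian_weyl[OF \<rho>(2) char(2)] eq])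
        (rule that)+
    then show ?thesis
      using tr by (simp add: inner_add_left inner_add_right inner_commute)
  qed
  have "k $ b = k' $ b" for b
  proof (cases b)
    case (Inl j)
    \<comment> \<open>The phase of \<open>gate_p j\<close> is the x coordinate of mode j, so this
      gate shifts \<open>k\<close> by a unit vector.\<close>
    have "sqrt 2 * Im (cdot (cvec r) (axis j (\<i> / complex_of_real (sqrt 2)))) = axis (Inl j) 1 \<bullet> r" for r
      by (simp add: cdot_axis cvec_def inner_axis' Im_divide_of_real)
    from shift[OF this] show ?thesis
      using in_gates(2)[of j \<Gamma>] by (simp add: gate_p_def inner_axis' Inl)
  next
    case (Inr j)
    \<comment> \<open>Complex conjugation in the first argument of \<open>cdot\<close> makes the y
      coordinate appear with a minus sign.\<close>
    have "sqrt 2 * Im (cdot (cvec r) (axis j (1 / complex_of_real (sqrt 2)))) = axis (Inr j) (- 1) \<bullet> r" for r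
      by (simp add: cdot_axis cvec_def inner_axis' Im_divide_of_real)
    from shift[OF this] show ?thesis
      using in_gates(3)[of j \<Gamma>] by (simp add: gate_q_def inner_axis' Inr)
  qed
  then have k: "k = k'"
    by (simp add: vec_eq_iff)
  then have "join l (- m) $ Inl j = join l' (- m') $ Inl j" "join l (- m) $ Inr j = join l' (- m') $ Inr j" for j
    by (simp_all add: k_def k'_def)
  then show "l = l'" "m = m'"
    by (simp_all add: join_def vec_eq_iff)
  have tr': "(\<Sum>b\<in>UNIV. S $ b $ b) = (\<Sum>b\<in>UNIV. S' $ b $ b)"
    using tr by (simp add: k)
  note sym_eq = symplectic_gate_equation[OF assms \<rho>(1) char(1) \<rho>(2) char(2)[folded k] tr' _ _ _ eq,
      folded gate_equation_def]
  have one: "gate_equation (mode_coords j) (L1 x \<alpha>) (S - S')"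
    if "x \<noteq> 0" "\<Gamma> (embed_coords (mode_coords j) (tau (L1 x \<alpha>))) \<in> set (gates \<Gamma>)" for j x \<alpha>
    by (intro sym_eq inj_mode_coords symplectic_one_mode L1_gate that)
  have two: "gate_equation (two_mode_coords i j) (L2 U 1 y) (S - S')"
    if "i < j" "U \<in> {matH, matK}" "y \<in> {2, 3}" for i j U and y :: real
  proof -
    have "1 \<noteq> (0::real)" "y \<noteq> 0" "i \<noteq> j"
      using that by auto
    then show ?thesis
      by (intro sym_eq inj_two_mode_coords symplectic_two_mode L2_gate cmod_matH_matK in_gates that)
  qed
  have "S - S' = 0"
  proof (rule gate_equations_imp_zero)
    show "transpose (S - S') = S - S'"
      using S by (simp add: transpose_def vec_eq_iff)
    show "(\<Sum>b\<in>UNIV. (S - S') $ b $ b) = 0"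
      by (simp add: sum_subtractf tr')
  qed (simp_all add: one two in_gates)
  then show "S = S'"
    by simp
qed

end
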